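(* Let $\bm A\in\mathbb R^{n\times n}$ be symmetric positive semi-definite, let $2\le k\le \operatorname{rank}(\bm A)$ be a target rank and $p\ge 2$ an oversampling parameter. Let $\bm\Omega\in\mathbb R^{n\times(k+p)}$ be a random matrix whose columns are i.i.d. $\mathcal N(\bm 0,\bm K)$, where $\bm K\in\mathbb R^{n\times n}$ is symmetric positive semi-definite and such that $\widetilde{\bm K}_{11}$ (defined in the context) is invertible. Then the Nyström approximation $\widehat{\bm A}=\bm A\bm\Omega(\bm\Omega^*\bm A\bm\Omega)^\dagger\bm\Omega^*\bm A$ satisfies \[ \mathbb E[\|\bm A-\widehat{\bm A}\|_2]\le\Big(1+\frac{3k}{p-1}\beta_k^{(2)}+3\delta_k^{(2)}\Big)\|\bm\Sigma_2\|_2+\frac{3e^2(k+p)}{p^2-1}\beta_k^{( * )}\|\bm\Sigma_2\|_*, \] \[ \mathbb E[\|\bm A-\widehat{\bm A}\|_*]\le\Big(1+\frac{k}{p-1}\beta_k^{( * )}+\delta_k^{( * )}\Big)\|\bm\Sigma_2\|_*. \]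
   Context: Write the eigendecomposition $\bm A=\bm U\bm\Sigma\bm U^*$ with $\bm U=[\bm U_1\ \bm U_2]$ orthogonal, $\bm U_1\in\mathbb R^{n\times k}$, eigenvalues $\sigma_1\ge\dots\ge\sigma_n\ge0$, $\bm\Sigma_1=\operatorname{diag}(\sigma_1,\dots,\sigma_k)$, $\bm\Sigma_2=\operatorname{diag}(\sigma_{k+1},\dots,\sigma_n)$. Set $\widetilde{\bm K}=\bm U^*\bm K\bm U$ with blocks $\widetilde{\bm K}_{11}=\bm U_1^*\bm K\bm U_1\in\mathbb R^{k\times k}$, $\widetilde{\bm K}_{21}=\bm U_2^*\bm K\bm U_1$, $\widetilde{\bm K}_{22}=\bm U_2^*\bm K\bm U_2$, and the Schur complement $\widetilde{\bm K}_{22.1}=\widetilde{\bm K}_{22}-\widetilde{\bm K}_{21}\widetilde{\bm K}_{11}^{-1}\widetilde{\bm K}_{21}^*$. For $\xi\in\{\mathrm F,2,*\}$ define $\beta_k^{(\xi)}=\frac{\|\bm\Sigma_2^{1/2}\widetilde{\bm K}_{22.1}\bm\Sigma_2^{1/2}\|_\xi}{\|\bm\Sigma_2\|_\xi}\|\widetilde{\bm K}_{11}^{-1}\|_2$ and $\delta_k^{(\xi)}=\frac{\|\bm\Sigma_2^{1/2}\widetilde{\bm K}_{21}\widetilde{\bm K}_{11}^{-2}\widetilde{\bm K}_{21}^*\bm\Sigma_2^{1/2}\|_\xi}{\|\bm\Sigma_2\|_\xi}$. Here $\|\cdot\|_\mathrm F,\|\cdot\|_2,\|\cdot\|_*$ are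 the Frobenius, spectral and nuclear norms, and $\dagger$ is the Moore–Penrose pseudoinverse. *)

theory Defs
  imports "HOL-Probability.Probability" "Jordan_Normal_Form.Matrix"
    "Jordan_Normal_Form.Char_Poly" "Jordan_Normal_Form.DL_Rank"
    "Jordan_Normal_Form.Gauss_Jordan_Elimination"
begin

definition psd_mat :: "nat \<Rightarrow> real mat \<Rightarrow> bool" where
  "psd_mat n M \<longleftrightarrow> M \<in> carrier_mat n n \<and> transpose_mat M = M \<and>
     (\<forall>v \<in> carrier_vec n. 0 \<le> v \<bullet> (M *\<^sub>v v))"

definition pinv :: "real mat \<Rightarrow> real mat" where
  "pinv M = (THE X. X \<in> carrier_mat (dim_col M) (dim_row M) \<and>
      M * X * M = M \<and> X * M * X = X \<and>
      transpose_mat (M * X) = M * X \<and> transpose_mat (X * M) = X * M)"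

definition minv :: "real mat \<Rightarrow> real mat" where
  "minv M = the (mat_inverse M)"

text \<open>Norms. Singular values are the square roots of the eigenvalues of M^T M
  (counted with algebraic multiplicity).\<close>
definition frob_norm :: "real mat \<Rightarrow> real" where
  "frob_norm M = sqrt (\<Sum>i<dim_row M. \<Sum>j<dim_col M. (M $$ (i,j))^2)"

definition spec_norm :: "real mat \<Rightarrow> real" where
  "spec_norm M = sqrt (Max (insert 0 {l. eigenvalue (transpose_mat M * M) l}))"

definition nuc_norm :: "real mat \<Rightarrow> real" where
  "nuc_norm M = (\<Sum>l \<in> {l. eigenvalue (transpose_mat M * M) l}.
       real (Polynomial.order l (char_poly (transpose_mat M * M))) * sqrt l)"

definition diag_m :: "(nat \<Rightarrow> real) \<Rightarrow> nat \<Rightarrow> real mat" where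
  "diag_m d m = mat m m (\<lambda>(i,j). if i = j then d i else 0)"

definition block :: "real mat \<Rightarrow> nat \<Rightarrow> nat \<Rightarrow> nat \<Rightarrow> nat \<Rightarrow> real mat" where
  "block M r c r0 c0 = mat r c (\<lambda>(i,j). M $$ (i + r0, j + c0))"

definition nystrom :: "real mat \<Rightarrow> real mat \<Rightarrow> real mat" where
  "nystrom A Om = A * Om * pinv (transpose_mat Om * A * Om) * transpose_mat Om * A"

text \<open>Gaussian sketch: the columns of K^(1/2) G, G with i.i.d. N(0,1) entries,
  are i.i.d. N(0,K).\<close>
definition psd_sqrt :: "real mat \<Rightarrow> real mat" where
  "psd_sqrt K = (THE S. psd_mat (dim_row K) S \<and> S * S = K)"

definition gauss_entries :: "nat \<Rightarrow> nat \<Rightarrow> (nat \<times> nat \<Rightarrow> real) measure" where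
  "gauss_entries n m = PiM ({..<n} \<times> {..<m}) (\<lambda>_. std_normal_distribution)"

definition cov_sample :: "real mat \<Rightarrow> nat \<Rightarrow> (nat \<times> nat \<Rightarrow> real) \<Rightarrow> real mat" where
  "cov_sample K m G = psd_sqrt K * mat (dim_row K) m G"

end

theory Submission
  imports Defs "HOL-Real_Asymp.Real_Asymp"
begin

unbundle no vec_syntax

text \<open>
  For every \<open>z\<close>, the form of the error \<open>A - A'\<close> of the Nystrom approximation \<open>A'\<close> at \<open>x\<close> is at most the form of \<open>A\<close> at \<open>x - \<Omega> z\<close>. Taking for \<open>z\<close> a
  regularized right inverse of \<open>\<Omega>\<^sub>1 = U\<^sub>1\<^sup>T \<Omega>\<close> applied to \<open>U\<^sub>1\<^sup>T x\<close> bounds the error by \<open>\<Sigma>\<^sub>2\<close>, a deterministic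
  term (the \<open>\<delta>\<close> part) and \<open>X = S G \<Omega>\<^sub>1\<^sup>\<dagger>\<close>, where \<open>S S\<^sup>T\<close> is the matrix in \<open>\<beta>\<close> and \<open>S G\<close> is uncorrelated with \<open>\<Omega>\<^sub>1\<close>.

  The nuclear bound is the second moment of \<open>X\<close>. For the spectral bound no Gaussian comparison theorem is
  needed: testing \<open>X\<close> on Gaussian vectors reduces \<open>E \<parallel>X\<parallel>\<^sup>2\<^sup>q\<close> to moments of scalar quadratic forms, and these satisfy
  recursions by Gaussian integration by parts. With \<open>q\<close> proportional to \<open>min k p\<close> this loses less than the constants allow.
\<close>

section \<open>Choice of the moment order\<close>

text \<open>Near rank deficiency the pseudoinverse of Omega_1 is unbounded, whereas integration by
  parts is run on functions of polynomial growth. Hence the ridge R = (Omega_1 Omega_1^T + e H)^-1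
  with H = \<open>K11\<close>. Then Omega_1^T R is a right inverse only up to e H R, but |e H R u|^2
  is at most e times a multiple of tr R, and the mean of tr R is bounded uniformly in e. This defect
  is split off with a weight \<eta>; e is chosen after \<eta>, and finally \<eta> tends to 0.

  Differentiating R costs the trace of a regularized projection of rank k, so of the k + p columns
  only p remain: the recursion for E (v^T R v)^q has the factors p - 1 - 2 i, positive exactly as
  long as 2 q \<le> p. The parameter k returns through the Gaussian test vector in R^k. Both
  together tie q to min k p.

  In the spectral bound |L + X|^2 \<le> 3 |L|^2 + 3/2 |X|^2, where L is the deterministic part: this
  is the 3 before \<delta>, and 3/2 times the factor 2 from the choice of q gives the other 3s. In
  the nuclear bound the cross term has mean zero, so nothing is lost.\<close>

lemma midpoint_ln:
  assumes "0 < (x::real)"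
  shows "(x + 1) * ln (x + 1) - x * ln x - 1 \<le> ln (x + 1/2)"
proof -
  define m where "m = x + 1/2"
  have m: "1/2 < m" using assms by (simp add: m_def)
  \<comment> \<open>\<open>?F h\<close> is the integral of ln over [m - h, m + h] minus 2 h ln m,
    that is, the error of the midpoint rule. Concavity of ln makes it decrease from 0, and h = 1/2
    is the claim.\<close>
  let ?F = "\<lambda>h. (m + h) * ln (m + h) - (m - h) * ln (m - h) - 2 * h - 2 * h * ln m"
  have "?F (1/2) \<le> ?F 0"
  proof (rule DERIV_nonpos_imp_nonincreasing[where f = ?F])
    fix h :: real assume h: "0 \<le> h" "h \<le> 1/2"
    have pos: "0 < m + h" "0 < m - h" "0 < m" using h m by linarith+
    have "((\<lambda>h. (m + h) * ln (m + h)) has_real_derivative ln (m + h) + 1) (at h)"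
      using pos by (auto intro!: derivative_eq_intros)
    moreover have "((\<lambda>h. (m - h) * ln (m - h)) has_real_derivative - ln (m - h) - 1) (at h)"
      using pos by (auto intro!: derivative_eq_intros)
    moreover have "((\<lambda>h. 2 * h) has_real_derivative 2) (at h)" "((\<lambda>h. 2 * h * ln m) has_real_derivative 2 * ln m) (at h)"
      by (auto intro!: derivative_eq_intros)
    ultimately have "(?F has_real_derivative (ln (m + h) + 1) - (- ln (m - h) - 1) - 2 - 2 * ln m) (at h)"
      by (intro DERIV_diff)
    moreover have "ln (m + h) + ln (m - h) \<le> 2 * ln m"
    proof -
      have "ln (m + h) + ln (m - h) = ln ((m + h) * (m - h))" using pos by (simp add: ln_mult)
      also have "\<dots> \<le> ln (m * m)"
      proof -
        have "0 < (m + h) * (m - h)" "0 < m * m" using pos by simp_all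
        moreover have "(m + h) * (m - h) \<le> m * m" by (simp add: algebra_simps)
        ultimately show ?thesis by (simp only: ln_le_cancel_iff)
      qed
      also have "\<dots> = 2 * ln m" using pos by (simp add: ln_mult)
      finally show ?thesis .
    qed
    ultimately show "\<exists>y. (?F has_real_derivative y) (at h) \<and> y \<le> 0"
      by (intro exI[of _ "(ln (m + h) + 1) - (- ln (m - h) - 1) - 2 - 2 * ln m"]) simp
  qed simp
  then show ?thesis by (simp add: m_def add.commute)
qed

text \<open>A Stirling bound for the Gaussian moment (2q - 1)!!. In logarithms the induction step is
  \<open>midpoint_ln\<close>, after the powers of 2 cancel.\<close>

lemma prod_odd_ge: "(2 * real q / exp 1) ^ q \<le> (\<Prod>i<q. 2 * real i + 1)"
proof (induction q)
  case (Suc q)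
  show ?case
  proof (cases "q = 0")
    case True
    then show ?thesis using exp_ge_add_one_self[of 1] by simp
  next
    case False
    define x where "x = real q"
    have x: "0 < x" using False by (simp add: x_def)
    have pow: "(2 * real r / exp 1) ^ r = exp (real r * ln (2 * real r) - real r)" if "0 < r" for r
    proof -
      have "exp (real r * ln (2 * real r) - real r) = exp (real r * (ln (2 * real r) - 1))"
        by (simp add: algebra_simps)
      also have "\<dots> = exp (ln (2 * real r) - 1) ^ r" by (simp add: exp_of_nat_mult)
      finally show ?thesis using that by (simp add: exp_diff)
    qed
    have "(x + 1) * ln (2 * (x + 1)) - (x + 1) \<le> ln (2 * x + 1) + (x * ln (2 * x) - x)"
    proof -
      have "ln (2 * (x + 1)) = ln 2 + ln (x + 1)" "ln (2 * x) = ln 2 + ln x"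
        using x ln_mult[of 2 "x + 1"] ln_mult[of 2 x] by simp_all
      moreover have "ln (2 * x + 1) = ln 2 + ln (x + 1/2)"
        using x ln_mult[of 2 "x + 1/2"] by (simp add: algebra_simps)
      ultimately show ?thesis using midpoint_ln[OF x] by (simp add: algebra_simps)
    qed
    then have "exp ((x + 1) * ln (2 * (x + 1)) - (x + 1)) \<le> exp (ln (2 * x + 1) + (x * ln (2 * x) - x))"
      by (simp only: exp_le_cancel_iff)
    also have "\<dots> = (2 * x + 1) * exp (x * ln (2 * x) - x)" using x by (simp only: exp_add) simp
    also have "\<dots> \<le> (2 * x + 1) * (\<Prod>i<q. 2 * real i + 1)"
      using Suc pow[of q] False x by (intro mult_left_mono) (simp_all add: x_def)
    also have "\<dots> = (\<Prod>i<Suc q. 2 * real i + 1)" by (simp add: x_def mult.commute)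
    also have "exp ((x + 1) * ln (2 * (x + 1)) - (x + 1)) = (2 * real (Suc q) / exp 1) ^ Suc q"
      using pow[of "Suc q"] by (simp add: x_def add.commute)
    finally show ?thesis .
  qed
qed simp

text \<open>The arithmetic-geometric mean inequality: pairing the factors i and q - 1 - i gives the
  square of the mean minus a square.\<close>

lemma prod_arith_upper:
  fixes a d :: real
  assumes "0 \<le> a" "0 \<le> d"
  shows "(\<Prod>i<q. a + 2 * real i * d) \<le> (a + (real q - 1) * d) ^ q"
proof (cases "q = 0")
  case False
  let ?f = "\<lambda>i. a + 2 * real i * d" and ?M = "a + (real q - 1) * d"
  have "(\<Prod>i<q. ?f i)\<^sup>2 = (\<Prod>i<q. ?f i * ?f (q - Suc i))"
    by (simp only: prod.distrib power2_eq_square prod.nat_diff_reindex[of ?f])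
  also have "\<dots> \<le> (\<Prod>i<q. ?M\<^sup>2)"
  proof (intro prod_mono conjI)
    fix i assume "i \<in> {..<q}"
    then have q: "real (q - Suc i) = real q - 1 - real i" by (auto simp: of_nat_diff)
    have "?f i * ?f (q - Suc i) = ?M\<^sup>2 - ((real q - 1 - 2 * real i) * d)\<^sup>2"
      unfolding q by (simp add: power2_eq_square algebra_simps)
    then show "?f i * ?f (q - Suc i) \<le> ?M\<^sup>2" by simp
    show "0 \<le> ?f i * ?f (q - Suc i)" using assms by simp
  qed
  also have "\<dots> = (?M ^ q)\<^sup>2" by (simp add: power_mult[symmetric] mult.commute)
  finally show ?thesis using assms False by (intro power2_le_imp_le[of "prod ?f {..<q}"]) auto
qed simp

text \<open>The same pairing from below. A pair is at least B (B - 2 (q - 1)), and the assumption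
  makes 2 (q - 1) at most B / 3, whence the 2/3.\<close>

lemma prod_arith_lower:
  fixes B :: real
  assumes "6 * (real q - 1) \<le> B" "0 < B"
  shows "(B * sqrt (2/3)) ^ q \<le> (\<Prod>i<q. B - 2 * real i)"
proof (cases "q = 0")
  case False
  let ?f = "\<lambda>i. B - 2 * real i"
  have pos: "0 \<le> ?f i" if "i < q" for i
  proof -
    have "real i \<le> real q - 1" using that by linarith
    then show ?thesis using assms False by (simp add: field_simps)
  qed
  have "((B * sqrt (2/3)) ^ q)\<^sup>2 = (\<Prod>i<q. B * (2/3 * B))"
  proof -
    have "((B * sqrt (2/3)) ^ q)\<^sup>2 = ((B * sqrt (2/3))\<^sup>2) ^ q" by (simp only: power_mult[symmetric] mult.commute)
    then show ?thesis by (simp add: power_mult_distrib) (simp add: power2_eq_square power_mult_distrib mult_ac)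
  qed
  also have "\<dots> \<le> (\<Prod>i<q. ?f i * ?f (q - Suc i))"
  proof (intro prod_mono conjI)
    fix i assume i: "i \<in> {..<q}"
    then have q: "real (q - Suc i) = real q - 1 - real i" by (auto simp: of_nat_diff)
    have "0 \<le> real i * (real q - 1 - real i)" using i by (intro mult_nonneg_nonneg) auto
    moreover have "B * (2/3 * B) \<le> B * (B - 2 * (real q - 1))"
      using assms by (intro mult_left_mono) auto
    ultimately show "B * (2/3 * B) \<le> ?f i * ?f (q - Suc i)"
      unfolding q by (simp add: algebra_simps)
    show "0 \<le> B * (2/3 * B)" using assms by simp
  qed
  also have "\<dots> = (\<Prod>i<q. ?f i)\<^sup>2"
    by (simp only: prod.distrib power2_eq_square prod.nat_diff_reindex[of ?f])
  finally show ?thesis by (rule power2_le_imp_le) (use pos in \<open>auto intro: prod_nonneg\<close>)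
qed simp

text \<open>The first five terms of the exponential series sum to exactly 7. This turns the 14 of
  \<open>moment_order\<close> into 2 e^2.\<close>

lemma e_square_ge: "7 \<le> exp (2::real)"
proof -
  have "(\<Sum>n<5. (2::real) ^ n /\<^sub>R fact n) \<le> exp 2"
    unfolding exp_def by (intro sum_le_suminf summable_exp_generic) auto
  then show ?thesis by (simp add: eval_nat_numeral)
qed

text \<open>The quadratic bound on exp gives only 3 at the point 1; applied at 1/32 and raised to
  the power 32 it is sharp enough for \<theta> \<le> 2 in \<open>moment_order\<close>.\<close>

lemma e_le: "exp (1::real) \<le> 2.77"
proof -
  have "exp (1/32::real) \<le> 1 + 1/32 + (1/32)\<^sup>2" by (rule exp_bound) auto
  also have "\<dots> \<le> 1.0323" by (simp add: power2_eq_square)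
  finally have "exp (1/32::real) ^ 32 \<le> 1.0323 ^ 32" by (intro power_mono) auto
  moreover have "exp (1/32::real) ^ 32 = exp 1" using exp_of_nat_mult[of 32 "1/32::real"] by simp
  moreover have "(1.0323::real) ^ 32 \<le> 2.77" by (simp add: power_divide)
  ultimately show ?thesis by linarith
qed

text \<open>\<open>q\<close> is about \<open>min k p / 6\<close>: then the means of the three arithmetic progressions combine to the
  factor \<open>7/6 * sqrt (3/2) * e/2 < 2\<close> in front of \<open>b\<close>.\<close>
lemma moment_order:
  fixes k p :: nat and b c :: real
  assumes k: "2 \<le> k" and p: "2 \<le> p" and b: "0 \<le> b" and c: "0 \<le> c"
  obtains q where "0 < q" "2 * q \<le> p"
    "(\<Prod>i<q. c + 2 * real i * b) * (\<Prod>i<q. real k + 2 * real i)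
       \<le> (\<Prod>i<q. 2 * real i + 1) * (\<Prod>i<q. real p - 1 - 2 * real i)
          * (2 * real k / (real p - 1) * b + 2 * exp 2 * real (k + p) / ((real p)\<^sup>2 - 1) * c) ^ q"
proof -
  define m where "m = min k p"
  \<comment> \<open>The ceiling of m / 6. It satisfies 6 (q - 1) \<le> m - 1 \<le> p - 1, which is
    what \<open>prod_arith_lower\<close> asks for with B = p - 1.\<close>
  define q where "q = (m + 5) div 6"
  have q: "m \<le> 6 * q" "6 * q \<le> m + 5" unfolding q_def by presburger+
  have m: "2 \<le> m" "m \<le> k" "m \<le> p" using k p by (auto simp: m_def)
  have qr: "real m \<le> 6 * real q" "6 * real q \<le> real m + 5" "2 \<le> real m" "real m \<le> real k" "real m \<le> real p"
    using q m of_nat_mono[OF q(1), where ?'a = real] of_nat_mono[OF q(2), where ?'a = real] by simp_all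
  have q0: "0 < q" "2 * q \<le> p" using q m by linarith+
  have p1: "1 < real p" using p by simp
  have sq: "(real p)\<^sup>2 - 1 = (real p - 1) * (real p + 1)" by (simp add: power2_eq_square algebra_simps)
  let ?T = "2 * real k / (real p - 1) * b + 2 * exp 2 * real (k + p) / ((real p)\<^sup>2 - 1) * c"
  have "(\<Prod>i<q. c + 2 * real i * b) * (\<Prod>i<q. real k + 2 * real i)
     \<le> (\<Prod>i<q. 2 * real i + 1) * (\<Prod>i<q. real p - 1 - 2 * real i) * ?T ^ q"
  proof (cases "q = 1")
    \<comment> \<open>For q = 1 every product has a single factor, so b disappears from the
      left-hand side and no estimate of the progressions is lost. This case covers all m \<le>
      6.\<close>
    case True
    have "real k * (real p + 1) \<le> 14 * real (k + p)"
    proof (cases "k \<le> p")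
      case True
      then have "real k \<le> 6" using q \<open>q = 1\<close> by (simp add: m_def)
      then have "real k * (real p + 1) \<le> 6 * (real p + 1)" by (intro mult_right_mono) auto
      then show ?thesis using p1 by simp
    next
      case False
      then have "real p + 1 \<le> 7" using q \<open>q = 1\<close> by (simp add: m_def)
      then have "real k * (real p + 1) \<le> real k * 7" by (intro mult_left_mono) auto
      then show ?thesis by simp
    qed
    also have "\<dots> \<le> 2 * exp 2 * real (k + p)" using e_square_ge by (intro mult_right_mono) auto
    finally have "real k \<le> 2 * exp 2 * real (k + p) / (real p + 1)"
      using p1 by (simp add: pos_le_divide_eq)
    also have "\<dots> = (real p - 1) * (2 * exp 2 * real (k + p) / ((real p)\<^sup>2 - 1))"
      unfolding sq using p1 by simp
    finally have "real k \<le> (real p - 1) * (2 * exp 2 * real (k + p) / ((real p)\<^sup>2 - 1))" .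
    then have "c * real k \<le> c * ((real p - 1) * (2 * exp 2 * real (k + p) / ((real p)\<^sup>2 - 1)))"
      using c by (rule mult_left_mono)
    moreover have "0 \<le> (real p - 1) * (2 * real k / (real p - 1) * b)" using b p1 by simp
    ultimately show ?thesis using True by (simp add: distrib_left mult_ac del: times_divide_eq_right times_divide_eq_left)
  next
    case False
    then have m7: "7 \<le> m" using q q0 by linarith
    define s where "s = sqrt (2/3::real)"
    have s: "0.81 \<le> s" unfolding s_def by (intro real_le_rsqrt) (simp add: power2_eq_square)
    define \<theta> where "\<theta> = 7 * exp 1 / (12 * s)"
    have th: "0 \<le> \<theta>" "\<theta> \<le> 2" using s e_le by (auto simp: \<theta>_def field_simps)
    define Z where "Z = \<theta> * (c / real q + b) * (real k / (real p - 1))"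
    have bq: "b * 1 \<le> b * real q" using b q0 by (intro mult_left_mono) auto
    have 1: "(\<Prod>i<q. c + 2 * real i * b) \<le> (c + real q * b) ^ q"
      by (rule order_trans[OF prod_arith_upper[OF c b] power_mono]) (use b c q0 bq in \<open>auto simp: algebra_simps\<close>)
    have 2: "(\<Prod>i<q. real k + 2 * real i) \<le> (7 / 6 * real k) ^ q"
    proof -
      have "6 * (real q - 1) \<le> real k" using qr by (simp add: right_diff_distrib)
      then have "(real k + (real q - 1) * 1) ^ q \<le> (7 / 6 * real k) ^ q"
        using q0 by (intro power_mono) auto
      with prod_arith_upper[of "real k" 1 q] show ?thesis by simp
    qed
    have 3: "(\<Prod>i<q. real p - 1 - 2 * real i) \<ge> ((real p - 1) * s) ^ q"
      unfolding s_def using qr p1 by (intro prod_arith_lower) (simp_all add: right_diff_distrib)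
    have "(\<Prod>i<q. c + 2 * real i * b) * (\<Prod>i<q. real k + 2 * real i) \<le> (c + real q * b) ^ q * (7 / 6 * real k) ^ q"
      using b c by (intro mult_mono 1 2 prod_nonneg) auto
    also have "\<dots> = (2 * real q / exp 1) ^ q * ((real p - 1) * s) ^ q * Z ^ q"
    proof -
      have "(c + real q * b) * (7 / 6 * real k) = 2 * real q / exp 1 * ((real p - 1) * s) * Z"
        using q0 s p1 unfolding Z_def \<theta>_def by (simp add: divide_simps)
      then show ?thesis by (simp only: power_mult_distrib[symmetric])
    qed
    also have "\<dots> \<le> (\<Prod>i<q. 2 * real i + 1) * (\<Prod>i<q. real p - 1 - 2 * real i) * ?T ^ q"
    proof (intro mult_mono prod_odd_ge 3 power_mono)
      \<comment> \<open>This decides the coefficient of c: \<theta> k / q is at most 12 k / m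
        because \<theta> \<le> 2 and m \<le> 6 q. If k exceeds p, the margin between 12 and 14 pays
        for the denominator p + 1 in place of p.\<close>
      have "12 * real k / real m \<le> 14 * real (k + p) / (real p + 1)"
      proof (cases "k \<le> p")
        case True
        then show ?thesis using p1 k by (simp add: m_def field_simps)
      next
        case False
        then have "m = p" "7 \<le> real p" using m7 by (auto simp: m_def)
        have "12 * real k * (real p + 1) \<le> 14 * real k * real p"
        proof -
          have "real k * 6 \<le> real k * real p" using \<open>7 \<le> real p\<close> by (intro mult_left_mono) auto
          then show ?thesis by (simp add: algebra_simps)
        qed
        also have "\<dots> \<le> 14 * real (k + p) * real p" by (simp add: algebra_simps)
        finally show ?thesis using p1 \<open>m = p\<close> by (simp add: field_simps)
      qed
      also have "\<dots> \<le> 2 * exp 2 * real (k + p) / (real p + 1)"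
        using e_square_ge by (intro divide_right_mono mult_right_mono) auto
      finally have "12 * real k / real m \<le> 2 * exp 2 * real (k + p) / (real p + 1)" .
      moreover have "\<theta> * real k / real q \<le> 12 * real k / real m"
      proof -
        have "\<theta> * real k * real m \<le> 2 * real k * (6 * real q)"
          using th qr by (intro mult_mono) auto
        then show ?thesis using q0 m by (simp add: field_simps)
      qed
      ultimately have i1: "c / (real p - 1) * (\<theta> * real k / real q) \<le> c / (real p - 1) * (2 * exp 2 * real (k + p) / (real p + 1))"
        using c p1 by (intro mult_left_mono) auto
      have i2: "\<theta> * (b * (real k / (real p - 1))) \<le> 2 * (b * (real k / (real p - 1)))"
        using th b p1 by (intro mult_right_mono) auto
      have e1: "\<theta> * (c / Q + b) * (real k / P) = c / P * (\<theta> * real k / Q) + \<theta> * (b * (real k / P))" for P Q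
        by (simp add: algebra_simps)
      have e2: "2 * real k / P * b + X / (P * Q) * c = c / P * (X / Q) + 2 * (b * (real k / P))" for P Q X
        by (simp add: algebra_simps)
      show "Z \<le> ?T" unfolding Z_def sq e1 e2 by (rule add_mono[OF i1 i2])
      show "0 \<le> Z" using th b c p1 by (simp add: Z_def)
      show "0 \<le> (\<Prod>i<q. 2 * real i + 1) * (\<Prod>i<q. real p - 1 - 2 * real i)"
      proof (intro mult_nonneg_nonneg prod_nonneg)
        show "0 \<le> real p - 1 - 2 * real i" if "i \<in> {..<q}" for i using that q0(2) by auto
      qed auto
      show "0 \<le> ((real p - 1) * s) ^ q" using p1 s by simp
    qed (use th b c p1 in \<open>auto simp: Z_def intro!: prod_nonneg zero_le_power\<close>)
    finally show ?thesis .
  qed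
  with q0 that show ?thesis by blast
qed

section \<open>Real symmetric matrices\<close>

lemma index_mult_mat_sum:
  assumes "A \<in> carrier_mat nr n" "B \<in> carrier_mat n nc" "i < nr" "j < nc"
  shows "(A * B) $$ (i, j) = (\<Sum>l<n. A $$ (i, l) * B $$ (l, j))"
  using assms by (simp add: scalar_prod_def atLeast0LessThan)

lemma index_mult_mat_vec_sum:
  assumes "A \<in> carrier_mat nr n" "v \<in> carrier_vec n" "i < nr"
  shows "(A *\<^sub>v v) $ i = (\<Sum>l<n. A $$ (i, l) * v $ l)"
  using assms by (simp add: scalar_prod_def atLeast0LessThan)

lemma scalar_prod_sum:
  assumes "v \<in> carrier_vec n"
  shows "scalar_prod u v = (\<Sum>l<n. u $ l * v $ l)"
  using assms by (simp add: scalar_prod_def atLeast0LessThan)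

lemma scalar_prod_self_nonneg: "0 \<le> v \<bullet> (v :: real vec)"
  by (simp add: scalar_prod_def sum_nonneg)

lemma scalar_prod_self_eq_0:
  fixes v :: "real vec"
  assumes "v \<in> carrier_vec n" shows "v \<bullet> v = 0 \<longleftrightarrow> v = 0\<^sub>v n"
proof
  assume "v \<bullet> v = 0"
  then have "\<forall>l<n. v $ l = 0" using assms by (simp add: scalar_prod_sum[OF assms] sum_nonneg_eq_0_iff)
  then show "v = 0\<^sub>v n" using assms by (auto intro!: eq_vecI)
qed (use assms in auto)

section \<open>Diagonal matrices and the spectral theorem\<close>

lemma diag_m_carrier [simp]: "diag_m d n \<in> carrier_mat n n" by (simp add: diag_m_def)

lemma transpose_diag_m [simp]: "transpose_mat (diag_m d n) = diag_m d n"
  by (auto simp: diag_m_def)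

lemma diag_m_mult: "diag_m d n * diag_m e n = diag_m (\<lambda>i. d i * e i) n"
proof (rule eq_matI)
  fix i j assume "i < dim_row (diag_m (\<lambda>i. d i * e i) n)" "j < dim_col (diag_m (\<lambda>i. d i * e i) n)"
  then have ij: "i < n" "j < n" by (auto simp: diag_m_def)
  have "(diag_m d n * diag_m e n) $$ (i, j) = (\<Sum>l<n. (if l = i then d i * (if i = j then e i else 0) else 0))"
    unfolding index_mult_mat_sum[OF diag_m_carrier diag_m_carrier ij]
    using ij by (intro sum.cong) (auto simp: diag_m_def)
  then show "(diag_m d n * diag_m e n) $$ (i, j) = diag_m (\<lambda>i. d i * e i) n $$ (i, j)"
    using ij by (simp add: diag_m_def)
qed (auto simp: diag_m_def)

lemma diag_m_mult_vec:
  assumes "v \<in> carrier_vec n" "i < n" shows "(diag_m d n *\<^sub>v v) $ i = d i * v $ i"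
proof -
  have "(diag_m d n *\<^sub>v v) $ i = (\<Sum>l<n. (if l = i then d i * v $ i else 0))"
    unfolding index_mult_mat_vec_sum[OF diag_m_carrier assms]
    using assms(2) by (intro sum.cong) (auto simp: diag_m_def)
  then show ?thesis using assms by simp
qed

text \<open>A complex eigenvector u = x + i y exists because the characteristic polynomial splits
  over the complex numbers. Symmetry forces its eigenvalue to be real, so whichever of x and y is
  nonzero is a real eigenvector.\<close>

lemma real_symmetric_has_eigenvector:
  fixes A :: "real mat"
  assumes A: "A \<in> carrier_mat n n" and sym: "transpose_mat A = A" and n: "0 < n"
  obtains l v where "v \<in> carrier_vec n" "v \<noteq> 0\<^sub>v n" "A *\<^sub>v v = l \<cdot>\<^sub>v v"
proof -
  let ?c = "map_mat complex_of_real A"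
  have c: "?c \<in> carrier_mat n n" using A by simp
  obtain as where as: "char_poly ?c = (\<Prod>a\<leftarrow>as. [:- a, 1:])" "length as = n"
    using char_poly_factorized[OF c] by blast
  then obtain z where "z \<in> set as" using n by (cases as) auto
  then have "poly (char_poly ?c) z = 0" unfolding as(1) poly_prod_list prod_list_zero_iff
    by (auto intro!: image_eqI[of _ _ "[:-z, 1:]"])
  then have "eigenvalue ?c z" using eigenvalue_root_char_poly[OF c] by simp
  then obtain u where u: "u \<in> carrier_vec n" "u \<noteq> 0\<^sub>v n" "?c *\<^sub>v u = z \<cdot>\<^sub>v u"
    using A by (auto simp: eigenvalue_def eigenvector_def)
  define x where "x = map_vec Re u"
  define y where "y = map_vec Im u"
  have xy: "x \<in> carrier_vec n" "y \<in> carrier_vec n" using u(1) by (auto simp: x_def y_def)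
  have eq: "(\<Sum>l<n. complex_of_real (A $$ (i, l)) * u $ l) = z * u $ i" if "i < n" for i
  proof -
    have "(?c *\<^sub>v u) $ i = (\<Sum>l<n. complex_of_real (A $$ (i, l)) * u $ l)"
      unfolding index_mult_mat_vec_sum[OF c u(1) that] using A that by simp
    then show ?thesis using u that by simp
  qed
  have Ax: "A *\<^sub>v x = Re z \<cdot>\<^sub>v x - Im z \<cdot>\<^sub>v y"
  proof (rule eq_vecI)
    fix i assume "i < dim_vec (Re z \<cdot>\<^sub>v x - Im z \<cdot>\<^sub>v y)"
    then have i: "i < n" using xy by simp
    have "(A *\<^sub>v x) $ i = Re (\<Sum>l<n. complex_of_real (A $$ (i, l)) * u $ l)"
      unfolding index_mult_mat_vec_sum[OF A xy(1) i] using u(1) by (simp add: x_def)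
    then show "(A *\<^sub>v x) $ i = (Re z \<cdot>\<^sub>v x - Im z \<cdot>\<^sub>v y) $ i"
      unfolding eq[OF i] using i u(1) xy by (simp add: x_def y_def)
  qed (use A xy in auto)
  have Ay: "A *\<^sub>v y = Im z \<cdot>\<^sub>v x + Re z \<cdot>\<^sub>v y"
  proof (rule eq_vecI)
    fix i assume "i < dim_vec (Im z \<cdot>\<^sub>v x + Re z \<cdot>\<^sub>v y)"
    then have i: "i < n" using xy by simp
    have "(A *\<^sub>v y) $ i = Im (\<Sum>l<n. complex_of_real (A $$ (i, l)) * u $ l)"
      unfolding index_mult_mat_vec_sum[OF A xy(2) i] using u(1) by (simp add: y_def)
    then show "(A *\<^sub>v y) $ i = (Im z \<cdot>\<^sub>v x + Re z \<cdot>\<^sub>v y) $ i"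
      unfolding eq[OF i] using i u(1) xy by (simp add: x_def y_def)
  qed (use A xy in auto)
  \<comment> \<open>Expanding both sides by the two real equations leaves Im z (x.x + y.y) =
    0.\<close>
  have "(A *\<^sub>v x) \<bullet> y = x \<bullet> (A *\<^sub>v y)"
    using transpose_vec_mult_scalar[OF A xy(2,1)] sym by simp
  then have "Im z * (x \<bullet> x + y \<bullet> y) = 0"
    unfolding Ax Ay using xy
    by (simp add: minus_scalar_prod_distrib[of _ n] scalar_prod_add_distrib[of _ n] algebra_simps)
  moreover have "x \<bullet> x + y \<bullet> y \<noteq> 0"
  proof
    assume "x \<bullet> x + y \<bullet> y = 0"
    then have xy0: "x = 0\<^sub>v n" "y = 0\<^sub>v n"
      using scalar_prod_self_nonneg[of x] scalar_prod_self_nonneg[of y] xy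
      by (auto simp flip: scalar_prod_self_eq_0)
    have "u = 0\<^sub>v n"
    proof (rule eq_vecI)
      fix i assume "i < dim_vec (0\<^sub>v n)"
      then have i: "i < n" by simp
      have "x $ i = 0" "y $ i = 0" using xy0 i by auto
      then show "u $ i = 0\<^sub>v n $ i" using i u(1) by (simp add: x_def y_def complex_eq_iff)
    qed (use u in auto)
    with u(2) show False by simp
  qed
  ultimately have im: "Im z = 0" by simp
  have "x \<noteq> 0\<^sub>v n \<or> y \<noteq> 0\<^sub>v n" using \<open>x \<bullet> x + y \<bullet> y \<noteq> 0\<close> by auto
  moreover have "A *\<^sub>v x = Re z \<cdot>\<^sub>v x" unfolding Ax im using xy by (auto intro!: eq_vecI)
  moreover have "A *\<^sub>v y = Re z \<cdot>\<^sub>v y" unfolding Ay im using xy by (auto intro!: eq_vecI)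
  ultimately show ?thesis using that xy by blast
qed

definition orth :: "nat \<Rightarrow> real mat \<Rightarrow> bool" where
  "orth n V \<longleftrightarrow> V \<in> carrier_mat n n \<and> transpose_mat V * V = 1\<^sub>m n \<and> V * transpose_mat V = 1\<^sub>m n"

lemma orthI:
  assumes "V \<in> carrier_mat n n" "transpose_mat V * V = 1\<^sub>m n" shows "orth n V"
  using assms mat_mult_left_right_inverse[of "transpose_mat V" n V] by (simp add: orth_def)

lemma orthD:
  assumes "orth n V"
  shows "V \<in> carrier_mat n n" "transpose_mat V \<in> carrier_mat n n"
    "transpose_mat V * V = 1\<^sub>m n" "V * transpose_mat V = 1\<^sub>m n"
  using assms by (auto simp: orth_def)

text \<open>The Householder reflection exchanging \<open>v\<close> and the first unit vector.\<close>
lemma orth_with_first_column: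
  fixes v :: "real vec"
  assumes v: "v \<in> carrier_vec n" "v \<bullet> v = 1" and n: "0 < n"
  obtains V where "orth n V" "V *\<^sub>v unit_vec n 0 = v"
proof (cases "v = unit_vec n 0")
  case True
  then show ?thesis using that[of "1\<^sub>m n"] by (simp add: orthI)
next
  case False
  \<comment> \<open>The reflection is V = 1 - c w w^T with w = v - e_0 and c = 2 / |w|^2.\<close>
  define w where "w = (\<lambda>i. v $ i - (if i = 0 then 1 else 0))"
  define c where "c = 2 / (\<Sum>i<n. (w i)\<^sup>2)"
  let ?V = "mat n n (\<lambda>(i, j). (if i = j then 1 else 0) - c * w i * w j)"
  have "(\<Sum>i<n. (w i)\<^sup>2) = (\<Sum>i<n. v $ i * v $ i - 2 * (if i = 0 then v $ i else 0) + (if i = 0 then 1 else 0))"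
    by (intro sum.cong) (auto simp: w_def power2_eq_square algebra_simps)
  also have "\<dots> = 2 - 2 * v $ 0"
    using n v by (simp add: sum.distrib sum_subtractf scalar_prod_sum[OF v(1)] sum_distrib_left[symmetric])
  finally have w2: "(\<Sum>i<n. (w i)\<^sup>2) = - 2 * w 0" by (simp add: w_def)
  have w0: "w 0 \<noteq> 0"
  proof
    assume "w 0 = 0"
    then have "\<forall>i<n. w i = 0" using w2 by (simp add: sum_nonneg_eq_0_iff)
    then have "v = unit_vec n 0" using v by (intro eq_vecI) (auto simp: w_def unit_vec_def)
    with False show False by simp
  qed
  \<comment> \<open>As v is a unit vector, |w|^2 = - 2 w_0, so c w_0 = -1 and V e_0 = e_0 - c w_0 w
    = v. The identity c |w|^2 = 2 below is orthogonality.\<close>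
  have c: "c * w 0 = -1" using w0 by (simp add: c_def w2)
  have cw: "c * (\<Sum>l<n. (w l)\<^sup>2) = 2" using w0 by (simp add: c_def w2)
  have "transpose_mat ?V * ?V = 1\<^sub>m n"
  proof (rule eq_matI)
    fix i j assume "i < dim_row (1\<^sub>m n :: real mat)" "j < dim_col (1\<^sub>m n :: real mat)"
    then have ij: "i < n" "j < n" by auto
    have "(transpose_mat ?V * ?V) $$ (i, j)
        = (\<Sum>l<n. ((if l = i then 1 else 0) - c * w l * w i) * ((if l = j then 1 else 0) - c * w l * w j))"
      using ij by (subst index_mult_mat_sum[of _ n n _ n]) auto
    also have "\<dots> = (\<Sum>l<n. (if l = i then (if i = j then 1 else 0) - c * w i * w j else 0)
        - (if l = j then c * w i * w j else 0) + c\<^sup>2 * w i * w j * (w l)\<^sup>2)"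
      by (intro sum.cong) (auto simp: power2_eq_square algebra_simps)
    also have "\<dots> = (if i = j then 1 else 0) - 2 * c * w i * w j + c * w i * w j * (c * (\<Sum>l<n. (w l)\<^sup>2))"
      using ij by (simp add: sum.distrib sum_subtractf sum_distrib_left[symmetric] power2_eq_square)
    also have "\<dots> = 1\<^sub>m n $$ (i, j)" unfolding cw using ij by simp
    finally show "(transpose_mat ?V * ?V) $$ (i, j) = 1\<^sub>m n $$ (i, j)" .
  qed auto
  then have "orth n ?V" by (intro orthI) auto
  moreover have "?V *\<^sub>v unit_vec n 0 = v"
  proof (rule eq_vecI)
    fix i assume "i < dim_vec v"
    then have i: "i < n" using v by simp
    have "(?V *\<^sub>v unit_vec n 0) $ i = ?V $$ (i, 0)"
      using i n by (simp add: scalar_prod_right_unit)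
    also have "\<dots> = (if i = 0 then 1 else 0) - w i * (c * w 0)" using i n by simp
    also have "\<dots> = v $ i" unfolding c by (simp add: w_def)
    finally show "(?V *\<^sub>v unit_vec n 0) $ i = v $ i" .
  qed (use v in auto)
  ultimately show ?thesis using that by blast
qed

lemma orth_mult:
  assumes "orth n V" "orth n W" shows "orth n (V * W)"
proof (rule orthI)
  note c = orthD(1,2)[OF assms(1)] orthD(1,2)[OF assms(2)]
  have "transpose_mat (V * W) * (V * W) = transpose_mat W * (transpose_mat V * V) * W"
    using c by (simp add: transpose_mult[of _ n n _ n] assoc_mult_mat[of _ n n _ n _ n] mult_carrier_mat[of _ n n _ n])
  then show "transpose_mat (V * W) * (V * W) = 1\<^sub>m n"
    using c by (simp add: orthD[OF assms(1)] orthD[OF assms(2)])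
  show "V * W \<in> carrier_mat n n" using c by simp
qed

lemma orth_conj_solve:
  assumes V: "orth n V" and A: "A \<in> carrier_mat n n"
  shows "V * (transpose_mat V * A * V) * transpose_mat V = A"
proof -
  note c = orthD(1,2)[OF V]
  have "V * (transpose_mat V * A * V) * transpose_mat V = (V * transpose_mat V) * A * (V * transpose_mat V)"
    using c A by (simp add: assoc_mult_mat[of _ n n _ n _ n] mult_carrier_mat[of _ n n _ n])
  then show ?thesis using A by (simp add: orthD[OF V])
qed

text \<open>Deflation: in an orthonormal basis starting with a unit eigenvector, symmetry clears
  both the first column and the first row outside the diagonal, and the induction hypothesis
  diagonalizes the remaining block.\<close>

theorem real_spectral:
  fixes A :: "real mat"
  assumes "A \<in> carrier_mat n n" "transpose_mat A = A"
  obtains V d where "orth n V" "A = V * diag_m d n * transpose_mat V"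
proof -
  have "\<exists>V d. orth n V \<and> A = V * diag_m d n * transpose_mat V"
    using assms
  proof (induction n arbitrary: A)
    case 0
    then show ?case by (intro exI[of _ "1\<^sub>m 0"] exI) (auto intro!: orthI)
  next
    case (Suc m)
    let ?n = "Suc m"
    note A = Suc.prems(1)
    obtain l u where u: "u \<in> carrier_vec ?n" "u \<noteq> 0\<^sub>v ?n" "A *\<^sub>v u = l \<cdot>\<^sub>v u"
      using real_symmetric_has_eigenvector[OF Suc.prems] by blast
    have uu: "0 < u \<bullet> u"
      using scalar_prod_self_nonneg[of u] scalar_prod_self_eq_0[OF u(1)] u(2) by linarith
    define v where "v = (1 / sqrt (u \<bullet> u)) \<cdot>\<^sub>v u"
    have v: "v \<in> carrier_vec ?n" "v \<bullet> v = 1" "A *\<^sub>v v = l \<cdot>\<^sub>v v"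
      using u uu by (auto simp: v_def mult_mat_vec[OF A u(1)] smult_smult_assoc mult.commute)
    obtain V where V: "orth ?n V" "V *\<^sub>v unit_vec ?n 0 = v"
      using orth_with_first_column[OF v(1,2)] by blast
    note c = orthD(1,2)[OF V(1)]
    define B where "B = transpose_mat V * A * V"
    have B: "B \<in> carrier_mat ?n ?n" using c A by (simp add: B_def)
    have Bt: "transpose_mat B = B"
      using c A Suc.prems(2) by (simp add: B_def transpose_mult[of _ ?n ?n _ ?n] assoc_mult_mat[of _ ?n ?n _ ?n _ ?n] mult_carrier_mat[of _ ?n ?n _ ?n])
    have Be: "B *\<^sub>v unit_vec ?n 0 = l \<cdot>\<^sub>v unit_vec ?n 0"
    proof -
      have "B *\<^sub>v unit_vec ?n 0 = transpose_mat V *\<^sub>v (A *\<^sub>v (V *\<^sub>v unit_vec ?n 0))"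
        using c A by (simp add: B_def assoc_mult_mat_vec[of _ ?n ?n _ ?n])
      also have "\<dots> = l \<cdot>\<^sub>v (transpose_mat V *\<^sub>v v)" using c v V by (simp add: mult_mat_vec[OF c(2) v(1)])
      also have "transpose_mat V *\<^sub>v v = (transpose_mat V * V) *\<^sub>v unit_vec ?n 0"
        using c V(2) by (simp add: assoc_mult_mat_vec[of _ ?n ?n _ ?n])
      finally show ?thesis by (simp add: orthD[OF V(1)])
    qed
    have B0: "B $$ (i, 0) = (if i = 0 then l else 0)" if "i < ?n" for i
    proof -
      have "(B *\<^sub>v unit_vec ?n 0) $ i = B $$ (i, 0)" using that B by (simp add: scalar_prod_right_unit)
      then show ?thesis using that by (auto simp: Be split: if_splits)
    qed
    have B0': "B $$ (0, i) = (if i = 0 then l else 0)" if "i < ?n" for i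
      using B0[OF that] that arg_cong[OF Bt, of "\<lambda>M. M $$ (i, 0)"] B by simp
    define B' where "B' = mat m m (\<lambda>(i, j). B $$ (Suc i, Suc j))"
    have "transpose_mat B' = B'"
    proof (rule eq_matI)
      fix i j assume "i < dim_row B'" "j < dim_col B'"
      then show "transpose_mat B' $$ (i, j) = B' $$ (i, j)"
        using arg_cong[OF Bt, of "\<lambda>M. M $$ (Suc i, Suc j)"] B by (simp add: B'_def)
    qed (auto simp: B'_def)
    then obtain V' d where V': "orth m V'" "B' = V' * diag_m d m * transpose_mat V'"
      using Suc.IH[of B'] by (auto simp: B'_def)
    note c' = orthD(1,2)[OF V'(1)]
    define L where "L = mat 1 1 (\<lambda>_. l)"
    define d' where "d' = case_nat l d"
    define V2 where "V2 = four_block_mat (1\<^sub>m 1) (0\<^sub>m 1 m) (0\<^sub>m m 1) V'"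
    have V2c: "V2 \<in> carrier_mat ?n ?n" using c' four_block_carrier_mat[of "1\<^sub>m 1" 1 1 V' m m] by (simp add: V2_def)
    have V2t: "transpose_mat V2 = four_block_mat (1\<^sub>m 1) (0\<^sub>m 1 m) (0\<^sub>m m 1) (transpose_mat V')"
      unfolding V2_def using c' by (subst transpose_four_block_mat[of _ 1 1 _ m _ m]) auto
    have Bf: "B = four_block_mat L (0\<^sub>m 1 m) (0\<^sub>m m 1) B'"
    proof (rule eq_matI)
      fix i j assume "i < dim_row (four_block_mat L (0\<^sub>m 1 m) (0\<^sub>m m 1) B')" "j < dim_col (four_block_mat L (0\<^sub>m 1 m) (0\<^sub>m m 1) B')"
      then have ij: "i < ?n" "j < ?n" by (auto simp: L_def B'_def)
      then show "B $$ (i, j) = four_block_mat L (0\<^sub>m 1 m) (0\<^sub>m m 1) B' $$ (i, j)"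
        using B0[OF ij(1)] B0'[OF ij(2)] by (cases i; cases j) (auto simp: L_def B'_def)
    qed (use B in \<open>auto simp: L_def B'_def\<close>)
    have Df: "diag_m d' ?n = four_block_mat L (0\<^sub>m 1 m) (0\<^sub>m m 1) (diag_m d m)"
      by (rule eq_matI) (auto simp: L_def d'_def diag_m_def split: nat.splits)
    have Lc: "L \<in> carrier_mat 1 1" by (simp add: L_def)
    have z1: "0\<^sub>m (Suc 0) m * X = 0\<^sub>m (Suc 0) m" if "X \<in> carrier_mat m m" for X :: "real mat"
      using that by (rule left_mult_zero_mat)
    have z2: "X * 0\<^sub>m m (Suc 0) = 0\<^sub>m m (Suc 0)" if "X \<in> carrier_mat m m" for X :: "real mat"
      using that by (rule right_mult_zero_mat)
    have "orth ?n V2"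
    proof (rule orthI[OF V2c])
      have "transpose_mat V2 * V2 = four_block_mat (1\<^sub>m 1) (0\<^sub>m 1 m) (0\<^sub>m m 1) (1\<^sub>m m)"
        unfolding V2t unfolding V2_def using c'
        by (subst mult_four_block_mat[of _ 1 1 _ m _ m]) (auto simp: orthD[OF V'(1)] z1 z2)
      also have "\<dots> = 1\<^sub>m ?n" by (rule eq_matI) auto
      finally show "transpose_mat V2 * V2 = 1\<^sub>m ?n" .
    qed
    moreover have "V2 * diag_m d' ?n * transpose_mat V2 = B"
    proof -
      have s1: "V2 * diag_m d' ?n = four_block_mat L (0\<^sub>m 1 m) (0\<^sub>m m 1) (V' * diag_m d m)"
        unfolding Df V2_def using c' Lc by (subst mult_four_block_mat[of _ 1 1 _ m _ m]) (auto simp: z1 z2)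
      have "V2 * diag_m d' ?n * transpose_mat V2 = four_block_mat L (0\<^sub>m 1 m) (0\<^sub>m m 1) (V' * diag_m d m * transpose_mat V')"
        unfolding s1 V2t using c' Lc by (subst mult_four_block_mat[of _ 1 1 _ m _ m]) (auto simp: z1 z2)
      then show ?thesis by (simp add: Bf V'(2))
    qed
    moreover have "A = V * B * transpose_mat V" unfolding B_def using orth_conj_solve[OF V(1) A] by simp
    ultimately have "orth ?n (V * V2) \<and> A = (V * V2) * diag_m d' ?n * transpose_mat (V * V2)"
      using V(1) c V2c
      by (auto simp: orth_mult transpose_mult[of _ ?n ?n _ ?n] assoc_mult_mat[of _ ?n ?n _ ?n _ ?n] mult_carrier_mat[of _ ?n ?n _ ?n])
    then show ?case by blast
  qed
  then show ?thesis using that by blast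
qed

lemma conj_diag_carrier: "orth n V \<Longrightarrow> V * diag_m d n * transpose_mat V \<in> carrier_mat n n"
  using orthD by (metis diag_m_carrier mult_carrier_mat)

lemma conj_diag_transpose:
  assumes "orth n V"
  shows "transpose_mat (V * diag_m d n * transpose_mat V) = V * diag_m d n * transpose_mat V"
  using orthD(1,2)[OF assms]
  by (simp add: transpose_mult[of _ n n _ n] assoc_mult_mat[of _ n n _ n _ n] mult_carrier_mat[of _ n n _ n])

lemma conj_diag_mult:
  assumes V: "orth n V"
  shows "(V * diag_m d n * transpose_mat V) * (V * diag_m e n * transpose_mat V)
       = V * diag_m (\<lambda>i. d i * e i) n * transpose_mat V"
proof -
  note c = orthD(1,2)[OF V]
  have "(V * diag_m d n * transpose_mat V) * (V * diag_m e n * transpose_mat V)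
      = V * (diag_m d n * (transpose_mat V * V) * diag_m e n) * transpose_mat V"
    using c by (simp add: assoc_mult_mat[of _ n n _ n _ n] mult_carrier_mat[of _ n n _ n])
  then show ?thesis using orthD(3)[OF V] by (simp add: diag_m_mult right_mult_one_mat[of _ n n])
qed

lemma conj_diag_form:
  assumes V: "orth n V" and x: "x \<in> carrier_vec n"
  shows "x \<bullet> ((V * diag_m d n * transpose_mat V) *\<^sub>v x) = (\<Sum>i<n. d i * ((transpose_mat V *\<^sub>v x) $ i)\<^sup>2)"
proof -
  note c = orthD(1,2)[OF V]
  define y where "y = transpose_mat V *\<^sub>v x"
  have y: "y \<in> carrier_vec n" using c x by (simp add: y_def)
  have "x \<bullet> ((V * diag_m d n * transpose_mat V) *\<^sub>v x) = x \<bullet> (V *\<^sub>v (diag_m d n *\<^sub>v y))"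
    using c x by (simp add: y_def assoc_mult_mat_vec[of _ n n _ n] assoc_mult_mat[of _ n n _ n _ n] mult_carrier_mat[of _ n n _ n])
  also have "\<dots> = y \<bullet> (diag_m d n *\<^sub>v y)"
    using transpose_vec_mult_scalar[OF c(1), of "diag_m d n *\<^sub>v y" x] x y
    by (simp add: y_def mult_mat_vec_carrier[OF diag_m_carrier])
  also have "\<dots> = (\<Sum>i<n. y $ i * (d i * y $ i))"
    using y by (subst scalar_prod_sum[of _ n]) (auto simp: diag_m_mult_vec mult_mat_vec_carrier[OF diag_m_carrier])
  finally show ?thesis by (simp add: y_def power2_eq_square mult_ac)
qed

lemma orth_norm:
  assumes V: "orth n V" and x: "x \<in> carrier_vec n"
  shows "(\<Sum>i<n. ((transpose_mat V *\<^sub>v x) $ i)\<^sup>2) = x \<bullet> x"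
proof -
  note c = orthD(1,2)[OF V]
  have "diag_m (\<lambda>_. 1) n = 1\<^sub>m n" by (rule eq_matI) (auto simp: diag_m_def)
  then have "V * diag_m (\<lambda>_. 1) n * transpose_mat V = 1\<^sub>m n"
    using c orthD(4)[OF V] by (simp add: right_mult_one_mat[of _ n n])
  then show ?thesis using conj_diag_form[OF V x, of "\<lambda>_. 1"] x by simp
qed

lemma conj_diag_eigen:
  assumes V: "orth n V" and i: "i < n"
  shows "(V * diag_m d n * transpose_mat V) *\<^sub>v (V *\<^sub>v unit_vec n i) = d i \<cdot>\<^sub>v (V *\<^sub>v unit_vec n i)"
    and "V *\<^sub>v unit_vec n i \<in> carrier_vec n" "V *\<^sub>v unit_vec n i \<noteq> 0\<^sub>v n"
    and "transpose_mat V *\<^sub>v (V *\<^sub>v unit_vec n i) = unit_vec n i"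
proof -
  note c = orthD(1,2)[OF V]
  show cc: "V *\<^sub>v unit_vec n i \<in> carrier_vec n" using c by simp
  have "transpose_mat V *\<^sub>v (V *\<^sub>v unit_vec n i) = (transpose_mat V * V) *\<^sub>v unit_vec n i"
    using c by (simp add: assoc_mult_mat_vec[of _ n n _ n])
  then show VV: "transpose_mat V *\<^sub>v (V *\<^sub>v unit_vec n i) = unit_vec n i"
    using orthD(3)[OF V] by simp
  have "diag_m d n *\<^sub>v unit_vec n i = d i \<cdot>\<^sub>v unit_vec n i"
  proof (rule eq_vecI)
    fix j assume "j < dim_vec (d i \<cdot>\<^sub>v (unit_vec n i :: real vec))"
    then show "(diag_m d n *\<^sub>v unit_vec n i) $ j = (d i \<cdot>\<^sub>v unit_vec n i) $ j"
      using i by (subst diag_m_mult_vec[of _ n]) auto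
  qed (auto simp: diag_m_def)
  then have "(V * diag_m d n * transpose_mat V) *\<^sub>v (V *\<^sub>v unit_vec n i) = V *\<^sub>v (d i \<cdot>\<^sub>v unit_vec n i)"
    using c cc VV by (simp add: assoc_mult_mat_vec[of _ n n _ n] assoc_mult_mat[of _ n n _ n _ n] mult_carrier_mat[of _ n n _ n])
  then show "(V * diag_m d n * transpose_mat V) *\<^sub>v (V *\<^sub>v unit_vec n i) = d i \<cdot>\<^sub>v (V *\<^sub>v unit_vec n i)"
    using c by (simp add: mult_mat_vec[of _ n n])
  show "V *\<^sub>v unit_vec n i \<noteq> 0\<^sub>v n"
  proof
    assume "V *\<^sub>v unit_vec n i = 0\<^sub>v n"
    then have "unit_vec n i = transpose_mat V *\<^sub>v 0\<^sub>v n" using VV by simp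
    also have "\<dots> = 0\<^sub>v n" using c by auto
    finally have "unit_vec n i $ i = (0 :: real)" using i by simp
    then show False using i by simp
  qed
qed

section \<open>Positive semidefinite matrices, square roots and pseudoinverses\<close>

lemma psd_matD:
  assumes "psd_mat n A"
  shows "A \<in> carrier_mat n n" "transpose_mat A = A" "\<And>v. v \<in> carrier_vec n \<Longrightarrow> 0 \<le> v \<bullet> (A *\<^sub>v v)"
  using assms by (auto simp: psd_mat_def)

lemma psd_spectral:
  assumes "psd_mat n A"
  obtains V d where "orth n V" "A = V * diag_m d n * transpose_mat V" "\<And>i. i < n \<Longrightarrow> 0 \<le> d i"
proof -
  obtain V d where V: "orth n V" and A: "A = V * diag_m d n * transpose_mat V"
    using real_spectral psd_matD[OF assms] by blast
  have "0 \<le> d i" if i: "i < n" for i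
  proof -
    note e = conj_diag_eigen[OF V i]
    have "0 \<le> (V *\<^sub>v unit_vec n i) \<bullet> (A *\<^sub>v (V *\<^sub>v unit_vec n i))"
      by (rule psd_matD(3)[OF assms e(2)])
    also have "\<dots> = (\<Sum>j<n. d j * (unit_vec n i $ j)\<^sup>2)"
      unfolding A conj_diag_form[OF V e(2)] e(4) ..
    also have "\<dots> = (\<Sum>j<n. if j = i then d i else 0)"
      by (intro sum.cong) (auto simp: unit_vec_def)
    finally show ?thesis using i by simp
  qed
  with V A that show ?thesis by blast
qed

lemma psd_conj_diag:
  assumes "orth n V" "\<And>i. i < n \<Longrightarrow> 0 \<le> d i"
  shows "psd_mat n (V * diag_m d n * transpose_mat V)"
  unfolding psd_mat_def using assms
  by (auto simp: conj_diag_carrier conj_diag_transpose conj_diag_form intro!: sum_nonneg)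

text \<open>Let Q = V^T W be the change between the two eigenbases. Equality of the squares reads
  (a_i^2 - b_j^2) Q_ij = 0, so by nonnegativity a_i = b_j wherever Q_ij is nonzero. Hence Q
  intertwines the roots as well.\<close>

lemma psd_sqrt_unique:
  assumes S: "psd_mat n S" and T: "psd_mat n T" and eq: "S * S = T * T"
  shows "S = T"
proof -
  obtain V a where V: "orth n V" and Sd: "S = V * diag_m a n * transpose_mat V" and a: "\<And>i. i < n \<Longrightarrow> 0 \<le> a i"
    using psd_spectral[OF S] by blast
  obtain W b where W: "orth n W" and Td: "T = W * diag_m b n * transpose_mat W" and b: "\<And>i. i < n \<Longrightarrow> 0 \<le> b i"
    using psd_spectral[OF T] by blast
  note c = orthD(1,2)[OF V] orthD(1,2)[OF W]
  define Q where "Q = transpose_mat V * W"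
  have Q: "Q \<in> carrier_mat n n" using c by (simp add: Q_def)
  have shift: "diag_m x n * Q = transpose_mat V * (V * diag_m x n * transpose_mat V) * W" for x
  proof -
    have "transpose_mat V * (V * diag_m x n * transpose_mat V) * W = (transpose_mat V * V) * diag_m x n * Q"
      using c by (simp add: Q_def assoc_mult_mat[of _ n n _ n _ n] mult_carrier_mat[of _ n n _ n])
    then show ?thesis by (simp add: orthD[OF V] left_mult_one_mat[OF diag_m_carrier])
  qed
  have shift': "Q * diag_m x n = transpose_mat V * (W * diag_m x n * transpose_mat W) * W" for x
  proof -
    have "transpose_mat V * (W * diag_m x n * transpose_mat W) * W = Q * diag_m x n * (transpose_mat W * W)"
      using c by (simp add: Q_def assoc_mult_mat[of _ n n _ n _ n] mult_carrier_mat[of _ n n _ n])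
    then show ?thesis using Q by (simp add: orthD[OF W] right_mult_one_mat[of _ n n])
  qed
  have left: "(diag_m x n * Q) $$ (i, j) = x i * Q $$ (i, j)" if "i < n" "j < n" for x i j
  proof -
    have "(diag_m x n * Q) $$ (i, j) = (\<Sum>l<n. if l = i then x i * Q $$ (i, j) else 0)"
      unfolding index_mult_mat_sum[OF diag_m_carrier Q that] using that by (intro sum.cong) (auto simp: diag_m_def)
    then show ?thesis using that by simp
  qed
  have right: "(Q * diag_m x n) $$ (i, j) = Q $$ (i, j) * x j" if "i < n" "j < n" for x i j
  proof -
    have "(Q * diag_m x n) $$ (i, j) = (\<Sum>l<n. if l = j then Q $$ (i, j) * x j else 0)"
      unfolding index_mult_mat_sum[OF Q diag_m_carrier that] using that by (intro sum.cong) (auto simp: diag_m_def)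
    then show ?thesis using that by simp
  qed
  have "S * S = V * diag_m (\<lambda>i. a i * a i) n * transpose_mat V" "T * T = W * diag_m (\<lambda>i. b i * b i) n * transpose_mat W"
    by (simp_all add: Sd Td conj_diag_mult V W)
  then have "diag_m (\<lambda>i. a i * a i) n * Q = Q * diag_m (\<lambda>i. b i * b i) n"
    unfolding shift shift' using eq by simp
  then have *: "a i * a i * Q $$ (i, j) = Q $$ (i, j) * (b j * b j)" if "i < n" "j < n" for i j
    using left[OF that] right[OF that] by metis
  have "diag_m a n * Q = Q * diag_m b n"
  proof (rule eq_matI)
    fix i j assume "i < dim_row (Q * diag_m b n)" "j < dim_col (Q * diag_m b n)"
    then have ij: "i < n" "j < n" using Q by (auto simp: diag_m_def)
    have "a i * Q $$ (i, j) = Q $$ (i, j) * b j"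
    proof (cases "Q $$ (i, j) = 0")
      case False
      then have "(a i)\<^sup>2 = (b j)\<^sup>2" using *[OF ij] by (simp add: power2_eq_square)
      then have "a i = b j" using a b ij by (simp add: power2_eq_iff_nonneg)
      then show ?thesis by simp
    qed simp
    then show "(diag_m a n * Q) $$ (i, j) = (Q * diag_m b n) $$ (i, j)" using left right ij by simp
  qed (use Q in \<open>auto simp: diag_m_def\<close>)
  then have "transpose_mat V * S * W = transpose_mat V * T * W" unfolding shift shift' Sd Td .
  then have "V * (transpose_mat V * S * W) * transpose_mat W = V * (transpose_mat V * T * W) * transpose_mat W" by simp
  moreover have "V * (transpose_mat V * X * W) * transpose_mat W = X" if X: "X \<in> carrier_mat n n" for X
  proof -
    have "V * (transpose_mat V * X * W) * transpose_mat W = (V * transpose_mat V) * X * (W * transpose_mat W)"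
      using c X by (simp add: assoc_mult_mat[of _ n n _ n _ n] mult_carrier_mat[of _ n n _ n])
    then show ?thesis using X by (simp add: orthD[OF V] orthD[OF W])
  qed
  ultimately show ?thesis using psd_matD(1)[OF S] psd_matD(1)[OF T] by simp
qed

lemma psd_sqrt:
  assumes K: "psd_mat n K"
  shows "psd_mat n (psd_sqrt K)" "psd_sqrt K * psd_sqrt K = K"
proof -
  obtain V d where V: "orth n V" and Kd: "K = V * diag_m d n * transpose_mat V" and d: "\<And>i. i < n \<Longrightarrow> 0 \<le> d i"
    using psd_spectral[OF K] by blast
  let ?S = "V * diag_m (\<lambda>i. sqrt (d i)) n * transpose_mat V"
  have dim: "dim_row K = n" using psd_matD(1)[OF K] by simp
  have psd: "psd_mat n ?S" using V d by (intro psd_conj_diag) auto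
  have "diag_m (\<lambda>i. sqrt (d i) * sqrt (d i)) n = diag_m d n"
    by (rule eq_matI) (auto simp: diag_m_def d)
  then have sq: "?S * ?S = K" by (simp add: conj_diag_mult[OF V] Kd)
  have "psd_mat n (psd_sqrt K) \<and> psd_sqrt K * psd_sqrt K = K"
    unfolding psd_sqrt_def dim
  proof (rule theI)
    show "psd_mat n ?S \<and> ?S * ?S = K" using psd sq by blast
    show "T = ?S" if "psd_mat n T \<and> T * T = K" for T
      using psd_sqrt_unique[of n T ?S] that psd sq by simp
  qed
  then show "psd_mat n (psd_sqrt K)" "psd_sqrt K * psd_sqrt K = K" by auto
qed

text \<open>The core Om^T A Om of the approximation is symmetric, so the spectral theorem provides
  the Penrose inverse. Uniqueness, required by the \<open>THE\<close> in \<open>pinv\<close>, is the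
  classical computation from the four equations.\<close>

lemma pinv_symmetric:
  assumes C: "C \<in> carrier_mat n n" and sym: "transpose_mat C = C"
  shows "pinv C \<in> carrier_mat n n" "transpose_mat (pinv C) = pinv C"
    "C * pinv C * C = C" "pinv C * C * pinv C = pinv C" "transpose_mat (C * pinv C) = C * pinv C"
proof -
  let ?P = "\<lambda>X. X \<in> carrier_mat n n \<and> C * X * C = C \<and> X * C * X = X
      \<and> transpose_mat (C * X) = C * X \<and> transpose_mat (X * C) = X * C"
  obtain V d where V: "orth n V" and Cd: "C = V * diag_m d n * transpose_mat V"
    using real_spectral[OF C sym] by blast
  \<comment> \<open>The convention \<open>inverse 0 = 0\<close> is exactly what a pseudoinverse does
    on the kernel.\<close>
  let ?X = "V * diag_m (\<lambda>i. inverse (d i)) n * transpose_mat V"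
  have X: "?P ?X"
  proof (intro conjI)
    have "diag_m (\<lambda>i. d i * inverse (d i) * d i) n = diag_m d n"
      "diag_m (\<lambda>i. inverse (d i) * d i * inverse (d i)) n = diag_m (\<lambda>i. inverse (d i)) n"
      by (auto intro!: eq_matI simp: diag_m_def mult.assoc[symmetric]) (metis mult.commute right_inverse)+
    then show "C * ?X * C = C" "?X * C * ?X = ?X" by (simp_all add: Cd conj_diag_mult[OF V])
    show "transpose_mat (C * ?X) = C * ?X" "transpose_mat (?X * C) = ?X * C"
      by (simp_all add: Cd conj_diag_mult[OF V] conj_diag_transpose[OF V])
  qed (rule conj_diag_carrier[OF V])
  have uniq: "Y = X" if X: "?P X" and Y: "?P Y" for X Y
  proof -
    have c: "C \<in> carrier_mat n n" "X \<in> carrier_mat n n" "Y \<in> carrier_mat n n" using C X Y by auto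
    have XX: "C * X * C = C" "X * C * X = X" "transpose_mat (C * X) = C * X" "transpose_mat (X * C) = X * C"
      and YY: "C * Y * C = C" "Y * C * Y = Y" "transpose_mat (C * Y) = C * Y" "transpose_mat (Y * C) = Y * C"
      using X Y by auto
    have assoc: "P * Q * S = P * (Q * S)" if "P \<in> carrier_mat n n" "Q \<in> carrier_mat n n" "S \<in> carrier_mat n n" for P Q S :: "real mat"
      using that by (rule assoc_mult_mat)
    have m: "P * Q \<in> carrier_mat n n" if "P \<in> carrier_mat n n" "Q \<in> carrier_mat n n" for P Q :: "real mat"
      using that by simp
    have 1: "C * X = C * Y"
    proof -
      have "C * X = (C * Y) * (C * X)" using assoc[of "C * Y" C X] c m YY(1) by simp
      then have "C * X = transpose_mat ((C * Y) * (C * X))" using XX(3) by simp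
      also have "\<dots> = transpose_mat (C * X) * transpose_mat (C * Y)"
        using c by (intro transpose_mult[of _ n n _ n]) auto
      also have "\<dots> = (C * X) * (C * Y)" by (simp only: XX YY)
      also have "\<dots> = C * Y" using assoc[of "C * X" C Y] c m XX(1) by simp
      finally show ?thesis .
    qed
    have 2: "X * C = Y * C"
    proof -
      have "X * C = (X * C) * (Y * C)" using assoc[of X C "Y * C"] assoc[of C Y C] c m YY(1) by simp
      then have "X * C = transpose_mat ((X * C) * (Y * C))" using XX(4) by simp
      also have "\<dots> = transpose_mat (Y * C) * transpose_mat (X * C)"
        using c by (intro transpose_mult[of _ n n _ n]) auto
      also have "\<dots> = (Y * C) * (X * C)" by (simp only: XX YY)
      also have "\<dots> = Y * C" using assoc[of Y C "X * C"] assoc[of C X C] c m XX(1) by simp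
      finally show ?thesis .
    qed
    have "Y = (Y * C) * Y" using YY by simp
    also have "\<dots> = (X * C) * Y" by (simp only: 2)
    also have "\<dots> = X * (C * Y)" using assoc c by simp
    also have "\<dots> = X * (C * X)" by (simp only: 1)
    also have "\<dots> = X" using assoc[of X C X] c XX by simp
    finally show ?thesis .
  qed
  have "pinv C = (THE X. ?P X)" using C unfolding pinv_def by simp
  also have "\<dots> = ?X" using X uniq by (intro the_equality) blast+
  finally have eq: "pinv C = ?X" .
  show "pinv C \<in> carrier_mat n n" "C * pinv C * C = C" "pinv C * C * pinv C = pinv C" "transpose_mat (C * pinv C) = C * pinv C"
    using X by (auto simp: eq)
  show "transpose_mat (pinv C) = pinv C" unfolding eq by (rule conj_diag_transpose[OF V])
qed

section \<open>Spectral and nuclear norms of positive semidefinite matrices\<close>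

lemma finite_eigenvalues:
  fixes M :: "real mat"
  assumes "M \<in> carrier_mat n n" shows "finite {l. eigenvalue M l}"
proof -
  have "char_poly M \<noteq> 0" using degree_monic_char_poly[OF assms] by auto
  then show ?thesis unfolding eigenvalue_root_char_poly[OF assms] by (rule poly_roots_finite)
qed

text \<open>For positive semidefinite M = V D V^T the eigenvalues of M^T M are the squares of those
  of M, and the latter are values of the form at unit vectors. Together with
  \<open>spec_norm_form\<close> this replaces the norm by quadratic forms in everything that
  follows.\<close>

lemma spec_norm_le:
  assumes M: "psd_mat n M" and t: "0 \<le> t"
    and le: "\<And>x. x \<in> carrier_vec n \<Longrightarrow> x \<bullet> (M *\<^sub>v x) \<le> t * (x \<bullet> x)"
  shows "spec_norm M \<le> t"
proof -
  obtain V d where V: "orth n V" and Md: "M = V * diag_m d n * transpose_mat V" and d: "\<And>i. i < n \<Longrightarrow> 0 \<le> d i"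
    using psd_spectral[OF M] by blast
  note Mc = psd_matD(1,2)[OF M]
  have dle: "d i \<le> t" if i: "i < n" for i
  proof -
    note e = conj_diag_eigen[OF V i]
    let ?x = "V *\<^sub>v unit_vec n i"
    have xx: "?x \<bullet> ?x = 1"
      using orth_norm[OF V e(2)] e(4) i by (simp add: unit_vec_def if_distrib[of "\<lambda>z. z\<^sup>2"] cong: if_cong)
    have "M *\<^sub>v ?x = d i \<cdot>\<^sub>v ?x" using e(1) Md by simp
    then show ?thesis using le[OF e(2)] xx by simp
  qed
  have "l \<le> t\<^sup>2" if "eigenvalue (transpose_mat M * M) l" for l
  proof -
    have MM: "transpose_mat M * M = V * diag_m (\<lambda>i. d i * d i) n * transpose_mat V"
      unfolding Mc(2) by (simp add: Md conj_diag_mult[OF V])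
    obtain x where "eigenvector (transpose_mat M * M) x l" using \<open>eigenvalue _ l\<close> by (auto simp: eigenvalue_def)
    then have x: "x \<in> carrier_vec n" "x \<noteq> 0\<^sub>v n" "(transpose_mat M * M) *\<^sub>v x = l \<cdot>\<^sub>v x"
      using Mc by (simp_all add: eigenvector_def del: assoc_mult_mat_vec)
    have "l * (x \<bullet> x) = x \<bullet> ((transpose_mat M * M) *\<^sub>v x)" using x by simp
    also have "\<dots> = (\<Sum>i<n. d i * d i * ((transpose_mat V *\<^sub>v x) $ i)\<^sup>2)" unfolding MM conj_diag_form[OF V x(1)] ..
    also have "\<dots> \<le> (\<Sum>i<n. t\<^sup>2 * ((transpose_mat V *\<^sub>v x) $ i)\<^sup>2)"
      using dle d t by (intro sum_mono mult_right_mono) (auto simp: power2_eq_square intro: mult_mono)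
    also have "\<dots> = t\<^sup>2 * (x \<bullet> x)" by (simp add: sum_distrib_left[symmetric] orth_norm[OF V x(1)])
    finally show ?thesis
      using scalar_prod_self_nonneg[of x] scalar_prod_self_eq_0[OF x(1)] x(2) by (simp add: mult_le_cancel_right)
  qed
  then have "Max (insert 0 {l. eigenvalue (transpose_mat M * M) l}) \<le> t\<^sup>2"
    using finite_eigenvalues[of "transpose_mat M * M" n] Mc by (subst Max_le_iff) auto
  then have "spec_norm M \<le> sqrt (t\<^sup>2)" unfolding spec_norm_def by (rule real_sqrt_le_mono)
  then show ?thesis using t by simp
qed

lemma spec_norm_form:
  assumes M: "psd_mat n M" and x: "x \<in> carrier_vec n"
  shows "x \<bullet> (M *\<^sub>v x) \<le> spec_norm M * (x \<bullet> x)"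
proof -
  obtain V d where V: "orth n V" and Md: "M = V * diag_m d n * transpose_mat V" and d: "\<And>i. i < n \<Longrightarrow> 0 \<le> d i"
    using psd_spectral[OF M] by blast
  note Mc = psd_matD(1,2)[OF M]
  have MM: "transpose_mat M * M = V * diag_m (\<lambda>i. d i * d i) n * transpose_mat V"
    unfolding Mc(2) by (simp add: Md conj_diag_mult[OF V])
  have "d i \<le> spec_norm M" if i: "i < n" for i
  proof -
    have "eigenvalue (transpose_mat M * M) (d i * d i)"
      unfolding MM eigenvalue_def eigenvector_def
      using conj_diag_eigen(1)[OF V i, of "\<lambda>i. d i * d i"] conj_diag_eigen(2,3)[OF V i] orthD(1)[OF V] by (intro exI[of _ "V *\<^sub>v unit_vec n i"]) auto
    then have "d i * d i \<le> Max (insert 0 {l. eigenvalue (transpose_mat M * M) l})"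
      using finite_eigenvalues[of "transpose_mat M * M" n] Mc by (intro Max_ge) auto
    then have "sqrt (d i * d i) \<le> spec_norm M" unfolding spec_norm_def by (rule real_sqrt_le_mono)
    then show ?thesis using d[OF i] by simp
  qed
  then have "(\<Sum>i<n. d i * ((transpose_mat V *\<^sub>v x) $ i)\<^sup>2) \<le> (\<Sum>i<n. spec_norm M * ((transpose_mat V *\<^sub>v x) $ i)\<^sup>2)"
    by (intro sum_mono mult_right_mono) auto
  then show ?thesis
    using conj_diag_form[OF V x, of d] by (simp add: Md[symmetric] sum_distrib_left[symmetric] orth_norm[OF V x])
qed

lemma spec_norm_nonneg: "0 \<le> spec_norm M" if "M \<in> carrier_mat m n"
  unfolding spec_norm_def
  using finite_eigenvalues[of "transpose_mat M * M" n] that mult_carrier_mat[of "transpose_mat M" n m M n] by (intro real_sqrt_ge_zero Max_ge) auto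

lemma order_prod_linear:
  fixes a :: "nat \<Rightarrow> real"
  shows "Polynomial.order l (\<Prod>i<n. [:- a i, 1:]) = card {i. i < n \<and> a i = l}"
proof (induction n)
  case (Suc n)
  have ne: "(\<Prod>i<n. [:- a i, 1:]) * [:- a n, 1:] \<noteq> 0" by (intro no_zero_divisors) (auto simp: prod_zero_iff)
  have "{i. i < Suc n \<and> a i = l} = {i. i < n \<and> a i = l} \<union> (if a n = l then {n} else {})"
    by (auto simp: less_Suc_eq)
  then have "card {i. i < Suc n \<and> a i = l} = card {i. i < n \<and> a i = l} + (if a n = l then 1 else 0)"
    by (simp add: card_insert_if)
  moreover have "Polynomial.order l [:- a n, 1:] = (if a n = l then 1 else 0)"
    using order_power_n_n[of l 1] by (auto simp: order_0I)
  ultimately show ?case using Suc order_mult[OF ne] by simp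
qed simp

text \<open>The characteristic polynomial of M^T M has the roots d_i^2, so the norm is the sum of
  the d_i, and this is the trace of M.\<close>

lemma nuc_norm_psd:
  assumes M: "psd_mat n M"
  shows "nuc_norm M = (\<Sum>i<n. M $$ (i, i))"
proof -
  obtain V d where V: "orth n V" and Md: "M = V * diag_m d n * transpose_mat V" and d: "\<And>i. i < n \<Longrightarrow> 0 \<le> d i"
    using psd_spectral[OF M] by blast
  note Mc = psd_matD(1,2)[OF M] and c = orthD(1,2)[OF V]
  define D where "D = diag_m (\<lambda>i. d i * d i) n"
  have Dc: "D \<in> carrier_mat n n" by (simp add: D_def)
  have MM: "transpose_mat M * M = V * D * transpose_mat V"
    unfolding Mc(2) by (simp add: Md conj_diag_mult[OF V] D_def)
  have MMc: "transpose_mat M * M \<in> carrier_mat n n" using Mc by simp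
  have "similar_mat_wit (transpose_mat M * M) D V (transpose_mat V)"
    unfolding similar_mat_wit_def Let_def using c Dc MM MMc orthD[OF V] by auto
  then have "char_poly (transpose_mat M * M) = char_poly D"
    by (intro char_poly_similar) (auto simp: similar_mat_def)
  also have "char_poly D = (\<Prod>a\<leftarrow>diag_mat D. [:- a, 1:])"
    by (rule char_poly_upper_triangular[OF Dc]) (auto simp: D_def diag_m_def upper_triangular_def)
  also have "\<dots> = (\<Prod>i<n. [:- (d i * d i), 1:])"
  proof -
    have "diag_mat D = map (\<lambda>i. d i * d i) [0..<n]"
      by (auto simp: diag_mat_def D_def diag_m_def)
    then show ?thesis by (simp add: prod.distinct_set_conv_list[symmetric] comp_def atLeast0LessThan)
  qed
  finally have cp: "char_poly (transpose_mat M * M) = (\<Prod>i<n. [:- (d i * d i), 1:])" .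
  have ev: "{l. eigenvalue (transpose_mat M * M) l} = (\<lambda>i. d i * d i) ` {..<n}"
    unfolding eigenvalue_root_char_poly[OF MMc] cp by (auto simp: poly_prod)
  have "nuc_norm M = (\<Sum>l\<in>(\<lambda>i. d i * d i) ` {..<n}. real (card {i. i < n \<and> d i * d i = l}) * sqrt l)"
    unfolding nuc_norm_def ev cp order_prod_linear ..
  \<comment> \<open>A sum over distinct eigenvalues weighted by multiplicity becomes a sum over
    indices.\<close>
  also have "\<dots> = (\<Sum>l\<in>(\<lambda>i. d i * d i) ` {..<n}. \<Sum>i\<in>{i\<in>{..<n}. d i * d i = l}. sqrt (d i * d i))"
    by (intro sum.cong) auto
  also have "\<dots> = (\<Sum>i<n. sqrt (d i * d i))" by (rule sum.image_gen[symmetric]) simp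
  also have "\<dots> = (\<Sum>i<n. d i)" using d by simp
  finally have nuc: "nuc_norm M = (\<Sum>i<n. d i)" .
  have "(\<Sum>i<n. M $$ (i, i)) = (\<Sum>i<n. \<Sum>l<n. d l * (V $$ (i, l))\<^sup>2)"
  proof (intro sum.cong refl)
    fix i assume "i \<in> {..<n}"
    then have i: "i < n" by simp
    have "M $$ (i, i) = unit_vec n i \<bullet> (M *\<^sub>v unit_vec n i)"
      using i Mc by (simp add: scalar_prod_left_unit scalar_prod_right_unit)
    also have "\<dots> = (\<Sum>l<n. d l * ((transpose_mat V *\<^sub>v unit_vec n i) $ l)\<^sup>2)"
      unfolding Md conj_diag_form[OF V unit_vec_carrier] ..
    also have "\<dots> = (\<Sum>l<n. d l * (V $$ (i, l))\<^sup>2)"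
      using i c by (intro sum.cong) (auto simp: scalar_prod_right_unit)
    finally show "M $$ (i, i) = (\<Sum>l<n. d l * (V $$ (i, l))\<^sup>2)" .
  qed
  also have "\<dots> = (\<Sum>l<n. d l * (\<Sum>i<n. (V $$ (i, l))\<^sup>2))"
    by (subst sum.swap) (simp add: sum_distrib_left)
  also have "\<dots> = (\<Sum>l<n. d l)"
  proof (intro sum.cong refl)
    fix l assume "l \<in> {..<n}"
    then have l: "l < n" by simp
    have "(transpose_mat V * V) $$ (l, l) = (\<Sum>i<n. (V $$ (i, l))\<^sup>2)"
      unfolding index_mult_mat_sum[OF c(2,1) l l] using c l by (simp add: power2_eq_square)
    then show "d l * (\<Sum>i<n. (V $$ (i, l))\<^sup>2) = d l" using orthD(3)[OF V] l by simp
  qed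
  finally show ?thesis by (simp add: nuc)
qed

section \<open>Gaussian integration by parts\<close>

lemma integrable_std_normal_poly: "integrable std_normal_distribution (\<lambda>y. (1 + \<bar>y\<bar>) ^ d)"
proof -
  have "(\<lambda>y. std_normal_density y * (1 + \<bar>y\<bar>) ^ d)
      = (\<lambda>y. \<Sum>k\<le>d. real (d choose k) * (std_normal_density y * \<bar>y\<bar> ^ (d - k)))"
    by (rule ext) (simp add: binomial_ring sum_distrib_left mult_ac)
  moreover have "integrable lborel (\<lambda>y. \<Sum>k\<le>d. real (d choose k) * (std_normal_density y * \<bar>y\<bar> ^ (d - k)))"
    by (intro Bochner_Integration.integrable_sum integrable_mult_right integrable_std_normal_moment_abs)
  ultimately show ?thesis by (simp add: integrable_density)
qed

text \<open>Makes the boundary terms vanish in \<open>stein_one_dim\<close>.\<close>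

lemma std_normal_poly_tendsto:
  fixes g :: "real \<Rightarrow> real"
  assumes "\<And>y. \<bar>g y\<bar> \<le> C * (1 + \<bar>y\<bar>) ^ d"
  shows "((\<lambda>y. std_normal_density y * g y) \<longlongrightarrow> 0) at_top"
    and "((\<lambda>y. std_normal_density y * g y) \<longlongrightarrow> 0) at_bot"
proof -
  have bound: "norm (std_normal_density y * g y) \<le> C * (exp (- y\<^sup>2 / 2) * (1 + \<bar>y\<bar>) ^ d)" for y
  proof -
    have "sqrt (2 * pi) \<ge> 1" using pi_gt3 by (simp add: real_le_rsqrt)
    then have "std_normal_density y \<le> exp (- y\<^sup>2 / 2)"
      by (simp add: std_normal_density_def field_simps)
    then have "\<bar>std_normal_density y\<bar> * \<bar>g y\<bar> \<le> exp (- y\<^sup>2 / 2) * (C * (1 + \<bar>y\<bar>) ^ d)"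
      by (intro mult_mono assms) auto
    then show ?thesis by (simp add: abs_mult mult_ac)
  qed
  have "((\<lambda>y::real. C * (exp (- y\<^sup>2 / 2) * (1 + \<bar>y\<bar>) ^ d)) \<longlongrightarrow> 0) at_top"
    by real_asymp
  then show "((\<lambda>y. std_normal_density y * g y) \<longlongrightarrow> 0) at_top"
    by (rule Lim_null_comparison[rotated]) (use bound in auto)
  have "((\<lambda>y::real. C * (exp (- y\<^sup>2 / 2) * (1 + \<bar>y\<bar>) ^ d)) \<longlongrightarrow> 0) at_bot"
    by real_asymp
  then show "((\<lambda>y. std_normal_density y * g y) \<longlongrightarrow> 0) at_bot"
    by (rule Lim_null_comparison[rotated]) (use bound in auto)
qed

text \<open>The standard normal density n satisfies n'(y) = - y n(y), so n g has derivative n g' - y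
  n g, whose integral over the line is the difference of the limits of n g at infinity, namely
  0.\<close>

lemma stein_one_dim:
  fixes g g' :: "real \<Rightarrow> real"
  assumes der: "\<And>y. (g has_real_derivative g' y) (at y)"
    and cont: "continuous_on UNIV g'"
    and g: "\<And>y. \<bar>g y\<bar> \<le> C * (1 + \<bar>y\<bar>) ^ d" and g': "\<And>y. \<bar>g' y\<bar> \<le> C' * (1 + \<bar>y\<bar>) ^ d'"
  shows "(\<integral>y. y * g y \<partial>std_normal_distribution) = (\<integral>y. g' y \<partial>std_normal_distribution)"
proof -
  let ?n = std_normal_density
  have contg: "continuous_on UNIV g"
    by (intro continuous_at_imp_continuous_on ballI DERIV_isCont[OF der])
  have mg[measurable]: "g \<in> borel_measurable borel" "g' \<in> borel_measurable borel"
    using contg cont by (simp_all add: borel_measurable_continuous_onI)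
  have i1: "integrable lborel (\<lambda>y. ?n y * (y * g y))"
  proof -
    have "integrable std_normal_distribution (\<lambda>y. y * g y)"
    proof (rule Bochner_Integration.integrable_bound)
      show "integrable std_normal_distribution (\<lambda>y. C * (1 + \<bar>y\<bar>) ^ Suc d)"
        by (intro integrable_mult_right integrable_std_normal_poly)
      show "AE y in std_normal_distribution. norm (y * g y) \<le> norm (C * (1 + \<bar>y\<bar>) ^ Suc d)"
      proof (rule AE_I2)
        fix y
        have "\<bar>y\<bar> * \<bar>g y\<bar> \<le> (1 + \<bar>y\<bar>) * (C * (1 + \<bar>y\<bar>) ^ d)" by (intro mult_mono g) auto
        then show "norm (y * g y) \<le> norm (C * (1 + \<bar>y\<bar>) ^ Suc d)"
          by (intro order_trans[OF _ abs_ge_self, of "norm (y * g y)", unfolded real_norm_def[symmetric]])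
             (simp add: abs_mult mult_ac)
      qed
    qed simp
    then show ?thesis by (simp add: integrable_density)
  qed
  have i2: "integrable lborel (\<lambda>y. ?n y * g' y)"
  proof -
    have "integrable std_normal_distribution g'"
    proof (rule Bochner_Integration.integrable_bound)
      show "integrable std_normal_distribution (\<lambda>y. C' * (1 + \<bar>y\<bar>) ^ d')"
        by (intro integrable_mult_right integrable_std_normal_poly)
      show "AE y in std_normal_distribution. norm (g' y) \<le> norm (C' * (1 + \<bar>y\<bar>) ^ d')"
        using g' by (auto intro!: AE_I2 order_trans[OF g'])
    qed simp
    then show ?thesis by (simp add: integrable_density)
  qed
  let ?F = "\<lambda>y. ?n y * g y" and ?f = "\<lambda>y. ?n y * g' y - ?n y * (y * g y)"
  have "(LBINT y=-\<infinity>..\<infinity>. ?f y) = 0 - 0"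
  proof (rule interval_integral_FTC_integrable[where F = ?F])
    fix x :: real
    have "(?n has_real_derivative - x * ?n x) (at x)"
      unfolding std_normal_density_def by (auto intro!: derivative_eq_intros simp: field_simps)
    then have "(?F has_real_derivative ?f x) (at x)"
      by (auto intro!: derivative_eq_intros der simp: algebra_simps)
    then show "(?F has_vector_derivative ?f x) (at x)"
      by (simp add: has_real_derivative_iff_has_vector_derivative)
    show "isCont ?f x"
      using contg cont unfolding std_normal_density_def
      by (intro continuous_intros) (auto simp: continuous_on_eq_continuous_at)
  next
    show "set_integrable lborel (einterval (-\<infinity>) \<infinity>) ?f"
      unfolding set_integrable_def using i1 i2 by (simp add: einterval_def)
  qed (use std_normal_poly_tendsto[OF g] in \<open>simp_all add: ereal_tendsto_simps\<close>)
  then have "(\<integral>y. ?f y \<partial>lborel) = 0"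
    by (simp add: interval_lebesgue_integral_def set_lebesgue_integral_def einterval_def)
  then show ?thesis using i1 i2 by (simp add: integral_density)
qed

section \<open>Gaussian product measures and functions of polynomial growth\<close>

definition gauss_on :: "'i set \<Rightarrow> ('i \<Rightarrow> real) measure" where
  "gauss_on I = PiM I (\<lambda>_. std_normal_distribution)"

interpretation std_normal_product: product_prob_space "\<lambda>_. std_normal_distribution" I for I :: "'i set"
proof -
  interpret prob_space std_normal_distribution by (rule prob_space_normal_density) simp
  show "product_prob_space (\<lambda>_. std_normal_distribution)" by unfold_locales
qed

lemma prob_space_gauss_on: "prob_space (gauss_on I)"
  unfolding gauss_on_def by (rule std_normal_product.prob_space_axioms)

lemma sets_gauss_on [measurable_cong]: "sets (gauss_on I) = sets (PiM I (\<lambda>_. borel))"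
  unfolding gauss_on_def by (intro sets_PiM_cong) auto

lemma measurable_gauss_on_coord: "i \<in> I \<Longrightarrow> (\<lambda>x. x i) \<in> borel_measurable (gauss_on I)"
  by measurable

text \<open>A class closed under sums and products whose members are integrable and admit
  integration by parts. The bound is a product over coordinates so that its integral factorizes.
  Continuity is asked for only along coordinate lines, where \<open>stein_one_dim\<close> is applied
  with all other coordinates frozen.\<close>

definition tame :: "'i set \<Rightarrow> (('i \<Rightarrow> real) \<Rightarrow> real) \<Rightarrow> bool" where
  "tame I f \<longleftrightarrow> f \<in> borel_measurable (gauss_on I) \<and>
     (\<exists>C d. \<forall>x. \<bar>f x\<bar> \<le> C * (\<Prod>i\<in>I. (1 + \<bar>x i\<bar>) ^ d)) \<and>
     (\<forall>x. \<forall>i\<in>I. continuous_on UNIV (\<lambda>s. f (x(i := s))))"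

lemma tame_measurable: "tame I f \<Longrightarrow> f \<in> borel_measurable (gauss_on I)"
  by (simp add: tame_def)

lemma tame_boundE:
  assumes "tame I f"
  obtains C d where "\<And>x. \<bar>f x\<bar> \<le> C * (\<Prod>i\<in>I. (1 + \<bar>x i\<bar>) ^ d)" "0 \<le> C"
proof -
  obtain C d where *: "\<And>x. \<bar>f x\<bar> \<le> C * (\<Prod>i\<in>I. (1 + \<bar>x i\<bar>) ^ d)"
    using assms unfolding tame_def by auto
  have "0 \<le> C" using *[of "\<lambda>_. 0"] by simp
  with * show ?thesis using that by blast
qed

lemma tame_bounded:
  assumes "f \<in> borel_measurable (gauss_on I)" "\<And>x. \<bar>f x\<bar> \<le> C"
    and "\<And>x i. i \<in> I \<Longrightarrow> continuous_on UNIV (\<lambda>s. f (x(i := s)))"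
  shows "tame I f"
proof -
  have "\<forall>x. \<bar>f x\<bar> \<le> C * (\<Prod>i\<in>I. (1 + \<bar>x i\<bar>) ^ 0)" using assms(2) by simp
  with assms(1,3) show ?thesis unfolding tame_def by blast
qed

lemma tame_const: "tame I (\<lambda>x. c)"
  by (rule tame_bounded[where C = "\<bar>c\<bar>"]) auto

lemma tame_coord:
  assumes "finite I" "i \<in> I" shows "tame I (\<lambda>x. x i)"
  unfolding tame_def
proof (intro conjI allI ballI exI)
  fix x :: "'a \<Rightarrow> real"
  have "1 \<le> (\<Prod>j\<in>I - {i}. (1 + \<bar>x j\<bar>) ^ 1)" by (intro prod_ge_1) auto
  then have "(1 + \<bar>x i\<bar>) * 1 \<le> (1 + \<bar>x i\<bar>) * (\<Prod>j\<in>I - {i}. (1 + \<bar>x j\<bar>) ^ 1)"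
    by (intro mult_left_mono) auto
  also have "\<dots> = (\<Prod>j\<in>I. (1 + \<bar>x j\<bar>) ^ 1)" using assms by (simp add: prod.remove)
  finally show "\<bar>x i\<bar> \<le> 1 * (\<Prod>j\<in>I. (1 + \<bar>x j\<bar>) ^ 1)" by simp
next
  fix x :: "'a \<Rightarrow> real" and j
  show "continuous_on UNIV (\<lambda>s. (x(j := s)) i)" by (cases "i = j") auto
qed (use assms in \<open>simp add: measurable_gauss_on_coord\<close>)

lemma tame_add:
  assumes "tame I f" "tame I g" shows "tame I (\<lambda>x. f x + g x)"
proof -
  obtain C d where f: "\<And>x. \<bar>f x\<bar> \<le> C * (\<Prod>i\<in>I. (1 + \<bar>x i\<bar>) ^ d)" "0 \<le> C"
    using tame_boundE[OF assms(1)] by blast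
  obtain C' d' where g: "\<And>x. \<bar>g x\<bar> \<le> C' * (\<Prod>i\<in>I. (1 + \<bar>x i\<bar>) ^ d')" "0 \<le> C'"
    using tame_boundE[OF assms(2)] by blast
  have "\<bar>f x + g x\<bar> \<le> (C + C') * (\<Prod>i\<in>I. (1 + \<bar>x i\<bar>) ^ max d d')" for x
  proof -
    have "\<bar>f x\<bar> \<le> C * (\<Prod>i\<in>I. (1 + \<bar>x i\<bar>) ^ max d d')"
      by (rule order_trans[OF f(1)]) (intro mult_left_mono prod_mono conjI power_increasing f; simp)
    moreover have "\<bar>g x\<bar> \<le> C' * (\<Prod>i\<in>I. (1 + \<bar>x i\<bar>) ^ max d d')"
      by (rule order_trans[OF g(1)]) (intro mult_left_mono prod_mono conjI power_increasing g; simp)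
    ultimately show ?thesis by (simp add: algebra_simps)
  qed
  moreover have "\<forall>x. \<forall>i\<in>I. continuous_on UNIV (\<lambda>s. f (x(i := s)) + g (x(i := s)))"
    using assms unfolding tame_def by (auto intro!: continuous_on_add)
  ultimately show ?thesis using assms unfolding tame_def by (auto intro!: borel_measurable_add)
qed

lemma tame_mult:
  assumes "tame I f" "tame I g" shows "tame I (\<lambda>x. f x * g x)"
proof -
  obtain C d where f: "\<And>x. \<bar>f x\<bar> \<le> C * (\<Prod>i\<in>I. (1 + \<bar>x i\<bar>) ^ d)" "0 \<le> C"
    using tame_boundE[OF assms(1)] by blast
  obtain C' d' where g: "\<And>x. \<bar>g x\<bar> \<le> C' * (\<Prod>i\<in>I. (1 + \<bar>x i\<bar>) ^ d')" "0 \<le> C'"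
    using tame_boundE[OF assms(2)] by blast
  have "\<bar>f x * g x\<bar> \<le> (C * C') * (\<Prod>i\<in>I. (1 + \<bar>x i\<bar>) ^ (d + d'))" for x
  proof -
    have "\<bar>f x\<bar> * \<bar>g x\<bar> \<le> (C * (\<Prod>i\<in>I. (1 + \<bar>x i\<bar>) ^ d)) * (C' * (\<Prod>i\<in>I. (1 + \<bar>x i\<bar>) ^ d'))"
      by (intro mult_mono f g mult_nonneg_nonneg prod_nonneg) auto
    then show ?thesis by (simp add: abs_mult power_add prod.distrib mult_ac)
  qed
  moreover have "\<forall>x. \<forall>i\<in>I. continuous_on UNIV (\<lambda>s. f (x(i := s)) * g (x(i := s)))"
    using assms unfolding tame_def by (auto intro!: continuous_on_mult)
  ultimately show ?thesis using assms unfolding tame_def by (auto intro!: borel_measurable_times)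
qed

lemma tame_uminus: "tame I f \<Longrightarrow> tame I (\<lambda>x. - f x)"
  using tame_mult[OF tame_const[of I "-1"], of f] by simp

lemma tame_diff: "tame I f \<Longrightarrow> tame I g \<Longrightarrow> tame I (\<lambda>x. f x - g x)"
  using tame_add[OF _ tame_uminus, of I f g] by simp

lemma tame_power: "tame I f \<Longrightarrow> tame I (\<lambda>x. f x ^ m)"
  by (induction m) (auto intro: tame_const tame_mult)

lemma tame_sum: "(\<And>j. j \<in> J \<Longrightarrow> tame I (f j)) \<Longrightarrow> tame I (\<lambda>x. \<Sum>j\<in>J. f j x)"
  by (induction J rule: infinite_finite_induct) (auto intro: tame_const tame_add)

lemmas tame_intros = tame_const tame_add tame_mult tame_uminus tame_diff tame_power tame_sum

lemma tame_integrable: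
  assumes "finite I" "tame I f" shows "integrable (gauss_on I) f"
proof -
  obtain C d where f: "\<And>x. \<bar>f x\<bar> \<le> C * (\<Prod>i\<in>I. (1 + \<bar>x i\<bar>) ^ d)" "0 \<le> C"
    using tame_boundE[OF assms(2)] by blast
  show ?thesis
  proof (rule Bochner_Integration.integrable_bound)
    show "integrable (gauss_on I) (\<lambda>x. C * (\<Prod>i\<in>I. (1 + \<bar>x i\<bar>) ^ d))"
      unfolding gauss_on_def
      by (intro integrable_mult_right std_normal_product.product_integrable_prod assms
          integrable_std_normal_poly)
    show "AE x in gauss_on I. norm (f x) \<le> norm (C * (\<Prod>i\<in>I. (1 + \<bar>x i\<bar>) ^ d))"
      using f by (auto intro!: AE_I2 intro: order_trans[OF f(1)])
  qed (use assms in \<open>simp add: tame_measurable\<close>)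
qed

text \<open>Fubini isolates the coordinate i. With the others frozen, their factors of the growth
  bounds become part of the constants of \<open>stein_one_dim\<close>.\<close>

theorem gauss_integration_by_parts:
  assumes fin: "finite I" and i: "i \<in> I" and f: "tame I f" and f': "tame I f'"
    and der: "\<And>x. ((\<lambda>s. f (x(i := s))) has_real_derivative f' x) (at (x i))"
  shows "(\<integral>x. x i * f x \<partial>gauss_on I) = (\<integral>x. f' x \<partial>gauss_on I)"
proof -
  define J where "J = I - {i}"
  have J: "finite J" "i \<notin> J" "insert i J = I" using fin i by (auto simp: J_def)
  obtain C d where fb: "\<And>x. \<bar>f x\<bar> \<le> C * (\<Prod>i\<in>I. (1 + \<bar>x i\<bar>) ^ d)"
    using tame_boundE[OF f] by blast
  obtain C' d' where fb': "\<And>x. \<bar>f' x\<bar> \<le> C' * (\<Prod>i\<in>I. (1 + \<bar>x i\<bar>) ^ d')"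
    using tame_boundE[OF f'] by blast
  have split: "(\<Prod>j\<in>I. (1 + \<bar>(x(i := y)) j\<bar>) ^ e) = (\<Prod>j\<in>J. (1 + \<bar>x j\<bar>) ^ e) * (1 + \<bar>y\<bar>) ^ e"
    for x :: "'a \<Rightarrow> real" and y e
  proof -
    have "(\<Prod>j\<in>J. (1 + \<bar>(x(i := y)) j\<bar>) ^ e) = (\<Prod>j\<in>J. (1 + \<bar>x j\<bar>) ^ e)"
      using J by (intro prod.cong) auto
    then show ?thesis unfolding J(3)[symmetric] using J(1,2) by (simp add: mult_ac)
  qed
  have inner: "(\<integral>y. (x(i := y)) i * f (x(i := y)) \<partial>std_normal_distribution)
      = (\<integral>y. f' (x(i := y)) \<partial>std_normal_distribution)" for x
  proof -
    have "(\<integral>y. y * f (x(i := y)) \<partial>std_normal_distribution) = (\<integral>y. f' (x(i := y)) \<partial>std_normal_distribution)"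
    proof (rule stein_one_dim)
      show "((\<lambda>y. f (x(i := y))) has_real_derivative f' (x(i := y))) (at y)" for y
        using der[of "x(i := y)"] by simp
      show "continuous_on UNIV (\<lambda>y. f' (x(i := y)))" using f' i by (auto simp: tame_def)
      show "\<bar>f (x(i := y))\<bar> \<le> (C * (\<Prod>j\<in>J. (1 + \<bar>x j\<bar>) ^ d)) * (1 + \<bar>y\<bar>) ^ d" for y
        using fb[of "x(i := y)", unfolded split] by (simp only: mult_ac)
      show "\<bar>f' (x(i := y))\<bar> \<le> (C' * (\<Prod>j\<in>J. (1 + \<bar>x j\<bar>) ^ d')) * (1 + \<bar>y\<bar>) ^ d'" for y
        using fb'[of "x(i := y)", unfolded split] by (simp only: mult_ac)
    qed
    then show ?thesis by simp
  qed
  have int: "integrable (gauss_on I) (\<lambda>x. x i * f x)" "integrable (gauss_on I) f'"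
    using fin i f f' by (auto intro!: tame_integrable tame_mult tame_coord)
  have "(\<integral>x. x i * f x \<partial>gauss_on I)
      = (\<integral>x. \<integral>y. (x(i := y)) i * f (x(i := y)) \<partial>std_normal_distribution \<partial>PiM J (\<lambda>_. std_normal_distribution))"
    using std_normal_product.product_integral_insert[OF J(1,2), of "\<lambda>x. x i * f x"] int(1)
    by (simp add: gauss_on_def J(3))
  also have "\<dots> = (\<integral>x. \<integral>y. f' (x(i := y)) \<partial>std_normal_distribution \<partial>PiM J (\<lambda>_. std_normal_distribution))"
    by (simp only: inner)
  also have "\<dots> = (\<integral>x. f' x \<partial>gauss_on I)"
    using std_normal_product.product_integral_insert[OF J(1,2), of f'] int(2)
    by (simp add: gauss_on_def J(3))
  finally show ?thesis .
qed

section \<open>Moments of Gaussian linear and quadratic forms\<close>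

lemma has_derivative_coord:
  "((\<lambda>s. (x(i := s)) j) has_real_derivative (if j = i then 1 else 0)) (at t)"
  by (cases "j = i") auto

text \<open>Integration by parts removes two powers of the linear form and yields (2q + 1) |c|^2, so
  the moments come from a recursion rather than from the law of a linear combination.\<close>

lemma gauss_linear_moment:
  fixes c :: "'i \<Rightarrow> real"
  assumes "finite I"
  shows "(\<integral>x. (\<Sum>i\<in>I. c i * x i) ^ (2 * q) \<partial>gauss_on I) = (\<Prod>i<q. 2 * real i + 1) * (\<Sum>i\<in>I. (c i)\<^sup>2) ^ q"
proof (induction q)
  case 0
  then show ?case using prob_space.prob_space[OF prob_space_gauss_on, of I] by simp
next
  case (Suc q)
  let ?T = "\<lambda>x. \<Sum>i\<in>I. c i * x i"
  have tT: "tame I ?T" using assms by (intro tame_intros tame_coord)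
  have ibp: "(\<integral>x. x i * ?T x ^ Suc (2 * q) \<partial>gauss_on I) = (\<integral>x. (2 * real q + 1) * c i * ?T x ^ (2 * q) \<partial>gauss_on I)"
    if i: "i \<in> I" for i
  proof (rule gauss_integration_by_parts)
    fix x :: "'i \<Rightarrow> real"
    have "((\<lambda>s. ?T (x(i := s))) has_real_derivative (\<Sum>j\<in>I. c j * (if j = i then 1 else 0))) (at (x i))"
      by (intro DERIV_sum DERIV_cmult has_derivative_coord)
    then have "((\<lambda>s. ?T (x(i := s))) has_real_derivative c i) (at (x i))"
      using i assms by (simp add: if_distrib cong: if_cong)
    from DERIV_power[OF this, of "Suc (2 * q)"]
    show "((\<lambda>s. ?T (x(i := s)) ^ Suc (2 * q)) has_real_derivative (2 * real q + 1) * c i * ?T x ^ (2 * q)) (at (x i))"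
      by (rule DERIV_cong) (simp add: fun_upd_triv algebra_simps)
  qed (use assms i in \<open>auto intro!: tame_intros tT\<close>)
  have "(\<integral>x. ?T x ^ (2 * Suc q) \<partial>gauss_on I) = (\<integral>x. (\<Sum>i\<in>I. c i * (x i * ?T x ^ Suc (2 * q))) \<partial>gauss_on I)"
    by (simp add: sum_distrib_right mult_ac)
  also have "\<dots> = (\<Sum>i\<in>I. c i * (\<integral>x. x i * ?T x ^ Suc (2 * q) \<partial>gauss_on I))"
    by (subst Bochner_Integration.integral_sum)
       (auto intro!: tame_integrable tame_intros tame_coord tT assms simp del: power_Suc)
  also have "\<dots> = (\<Sum>i\<in>I. (c i)\<^sup>2 * ((2 * real q + 1) * (\<integral>x. ?T x ^ (2 * q) \<partial>gauss_on I)))"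
    by (intro sum.cong refl, subst ibp) (simp_all add: power2_eq_square)
  also have "\<dots> = (\<Sum>i\<in>I. (c i)\<^sup>2) * (2 * real q + 1) * (\<integral>x. ?T x ^ (2 * q) \<partial>gauss_on I)"
    by (simp add: sum_distrib_right[symmetric] mult_ac)
  finally show ?case unfolding Suc.IH by (simp add: mult_ac)
qed

text \<open>Write Q = x.Px. Integrating E Q^(q+1) by parts gives tr P E Q^q + 2q E |Px|^2 Q^(q-1).
  Here c bounds the trace and b the operator norm, the latter in the form |Px|^2 \<le> b Q that fits
  the second term.\<close>

lemma gauss_quadratic_moment:
  fixes P :: "'i \<Rightarrow> 'i \<Rightarrow> real"
  assumes fin: "finite I"
    and sym: "\<And>i j. i \<in> I \<Longrightarrow> j \<in> I \<Longrightarrow> P i j = P j i"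
    and nonneg: "\<And>x. 0 \<le> (\<Sum>i\<in>I. \<Sum>j\<in>I. P i j * x i * x j)"
    and tr: "(\<Sum>i\<in>I. P i i) \<le> c" and c: "0 \<le> c" and b: "0 \<le> b"
    and norm: "\<And>x. (\<Sum>i\<in>I. (\<Sum>j\<in>I. P i j * x j)\<^sup>2) \<le> b * (\<Sum>i\<in>I. \<Sum>j\<in>I. P i j * x i * x j)"
  shows "(\<integral>x. (\<Sum>i\<in>I. \<Sum>j\<in>I. P i j * x i * x j) ^ q \<partial>gauss_on I) \<le> (\<Prod>i<q. c + 2 * real i * b)"
proof (induction q)
  case 0
  then show ?case using prob_space.prob_space[OF prob_space_gauss_on, of I] by simp
next
  case (Suc q)
  let ?L = "\<lambda>i x. \<Sum>j\<in>I. P i j * x j"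
  define Q where "Q = (\<lambda>x. \<Sum>i\<in>I. \<Sum>j\<in>I. P i j * x i * x j)"
  have Q0: "0 \<le> Q x" for x using nonneg by (simp add: Q_def)
  have tL: "tame I (?L i)" for i using fin by (intro tame_intros tame_coord)
  have tQ: "tame I Q" unfolding Q_def using fin by (intro tame_intros tame_coord)
  have QL: "Q x = (\<Sum>i\<in>I. x i * ?L i x)" for x
    by (simp add: Q_def sum_distrib_left mult_ac)
  have dL: "((\<lambda>s. ?L k (x(i := s))) has_real_derivative P k i) (at (x i))" if "i \<in> I" for i k x
  proof -
    have "((\<lambda>s. ?L k (x(i := s))) has_real_derivative (\<Sum>j\<in>I. P k j * (if j = i then 1 else 0))) (at (x i))"
      by (intro DERIV_sum DERIV_cmult has_derivative_coord)
    then show ?thesis using that fin by (simp add: if_distrib cong: if_cong)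
  qed
  have dQ: "((\<lambda>s. Q (x(i := s))) has_real_derivative 2 * ?L i x) (at (x i))" if i: "i \<in> I" for i x
  proof -
    have "((\<lambda>s. \<Sum>k\<in>I. (x(i := s)) k * ?L k (x(i := s))) has_real_derivative
        (\<Sum>k\<in>I. (if k = i then 1 else 0) * ?L k (x(i := x i)) + P k i * (x(i := x i)) k)) (at (x i))"
      by (intro DERIV_sum DERIV_mult has_derivative_coord dL i)
    moreover have "(\<Sum>k\<in>I. (if k = i then 1 else 0) * ?L k x) = ?L i x"
      using i fin by (simp add: if_distrib[of "\<lambda>z. z * _"] cong: if_cong)
    moreover have "(\<Sum>k\<in>I. P k i * x k) = ?L i x"
      using i sym by (intro sum.cong) auto
    ultimately show ?thesis by (simp add: QL sum.distrib fun_upd_triv del: fun_upd_apply)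
  qed
  have ibp: "(\<integral>x. x i * (?L i x * Q x ^ q) \<partial>gauss_on I)
      = (\<integral>x. P i i * Q x ^ q + 2 * real q * (?L i x)\<^sup>2 * Q x ^ (q - 1) \<partial>gauss_on I)"
    if i: "i \<in> I" for i
  proof (rule gauss_integration_by_parts)
    fix x :: "'i \<Rightarrow> real"
    show "((\<lambda>s. ?L i (x(i := s)) * Q (x(i := s)) ^ q) has_real_derivative
        P i i * Q x ^ q + 2 * real q * (?L i x)\<^sup>2 * Q x ^ (q - 1)) (at (x i))"
      by (rule DERIV_cong[OF DERIV_mult[OF dL[OF i] DERIV_power[OF dQ[OF i]]]])
         (simp add: power2_eq_square mult_ac fun_upd_triv del: fun_upd_apply)
  qed (use fin i in \<open>auto intro!: tame_intros tL tQ\<close>)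
  have "(\<integral>x. Q x ^ Suc q \<partial>gauss_on I) = (\<integral>x. (\<Sum>i\<in>I. x i * (?L i x * Q x ^ q)) \<partial>gauss_on I)"
    by (intro Bochner_Integration.integral_cong refl)
       (simp add: QL[of x for x] sum_distrib_right mult_ac flip: QL)
  also have "\<dots> = (\<Sum>i\<in>I. \<integral>x. P i i * Q x ^ q + 2 * real q * (?L i x)\<^sup>2 * Q x ^ (q - 1) \<partial>gauss_on I)"
    by (subst Bochner_Integration.integral_sum)
       (auto intro!: tame_integrable tame_intros tame_coord tL tQ fin sum.cong simp: ibp)
  also have "\<dots> = (\<integral>x. (\<Sum>i\<in>I. P i i * Q x ^ q + 2 * real q * (?L i x)\<^sup>2 * Q x ^ (q - 1)) \<partial>gauss_on I)"
    by (subst Bochner_Integration.integral_sum)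
       (auto intro!: tame_integrable tame_intros tame_coord tL tQ fin)
  also have "\<dots> \<le> (\<integral>x. (c + 2 * real q * b) * Q x ^ q \<partial>gauss_on I)"
  proof (rule integral_mono)
    fix x
    have "(\<Sum>i\<in>I. P i i * Q x ^ q + 2 * real q * (?L i x)\<^sup>2 * Q x ^ (q - 1))
        = (\<Sum>i\<in>I. P i i) * Q x ^ q + 2 * real q * ((\<Sum>i\<in>I. (?L i x)\<^sup>2) * Q x ^ (q - 1))"
      by (simp add: sum.distrib sum_distrib_left sum_distrib_right mult_ac)
    also have "\<dots> \<le> c * Q x ^ q + 2 * real q * (b * Q x * Q x ^ (q - 1))"
      using norm[of x] Q0[of x] tr by (intro add_mono mult_right_mono mult_left_mono) (auto simp: Q_def)
    \<comment> \<open>At q = 0 the truncated exponent q - 1 is harmless because of the factor 2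
      q.\<close>
    also have "\<dots> = (c + 2 * real q * b) * Q x ^ q"
      by (cases q) (auto simp: algebra_simps)
    finally show "(\<Sum>i\<in>I. P i i * Q x ^ q + 2 * real q * (?L i x)\<^sup>2 * Q x ^ (q - 1)) \<le> (c + 2 * real q * b) * Q x ^ q" .
  qed (auto intro!: tame_integrable tame_intros tame_coord tL tQ fin)
  also have "\<dots> = (c + 2 * real q * b) * (\<integral>x. Q x ^ q \<partial>gauss_on I)" by simp
  also have "\<dots> \<le> (c + 2 * real q * b) * (\<Prod>i<q. c + 2 * real i * b)"
    using Suc b c by (intro mult_left_mono) (auto simp: Q_def)
  finally show ?case by (simp add: Q_def mult_ac)
qed

section \<open>Measurability and continuity of determinants and adjugates\<close>

lemma det_measurable:
  fixes A :: "'a \<Rightarrow> real mat"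
  assumes "\<And>x. A x \<in> carrier_mat m m"
    and "\<And>i j. i < m \<Longrightarrow> j < m \<Longrightarrow> (\<lambda>x. A x $$ (i, j)) \<in> borel_measurable M"
  shows "(\<lambda>x. det (A x)) \<in> borel_measurable M"
proof -
  have "(\<lambda>x. \<Sum>p | p permutes {0..<m}. signof p * (\<Prod>i = 0..<m. A x $$ (i, p i))) \<in> borel_measurable M"
    using assms(2) by (intro borel_measurable_sum borel_measurable_times borel_measurable_prod
        borel_measurable_const) (auto simp: permutes_in_image dest: permutes_in_image)
  then show ?thesis using assms(1) by (simp add: det_def carrier_matD[OF assms(1)])
qed

lemma det_continuous:
  fixes A :: "'a :: topological_space \<Rightarrow> real mat"
  assumes "\<And>x. A x \<in> carrier_mat m m"
    and "\<And>i j. i < m \<Longrightarrow> j < m \<Longrightarrow> continuous_on S (\<lambda>x. A x $$ (i, j))"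
  shows "continuous_on S (\<lambda>x. det (A x))"
proof -
  have "continuous_on S (\<lambda>x. \<Sum>p | p permutes {0..<m}. signof p * (\<Prod>i = 0..<m. A x $$ (i, p i)))"
    by (intro continuous_intros assms(2)) (auto dest: permutes_in_image)
  then show ?thesis using assms(1) by (simp add: det_def carrier_matD[OF assms(1)])
qed

lemma adj_mat_measurable:
  fixes A :: "'a \<Rightarrow> real mat"
  assumes A: "\<And>x. A x \<in> carrier_mat m m"
    and "\<And>i j. i < m \<Longrightarrow> j < m \<Longrightarrow> (\<lambda>x. A x $$ (i, j)) \<in> borel_measurable M"
    and "i < m" "j < m"
  shows "(\<lambda>x. adj_mat (A x) $$ (i, j)) \<in> borel_measurable M"
proof -
  have "(\<lambda>x. (-1) ^ (j + i) * det (mat_delete (A x) j i)) \<in> borel_measurable M"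
    using assms by (intro borel_measurable_times borel_measurable_const det_measurable[of _ "m - 1"])
      (auto simp: mat_delete_def carrier_matD[OF A] simp del: fun_upd_apply)
  then show ?thesis using assms(3,4) by (simp add: adj_mat_def cofactor_def carrier_matD[OF A])
qed

lemma adj_mat_continuous:
  fixes A :: "'a :: topological_space \<Rightarrow> real mat"
  assumes A: "\<And>x. A x \<in> carrier_mat m m"
    and "\<And>i j. i < m \<Longrightarrow> j < m \<Longrightarrow> continuous_on S (\<lambda>x. A x $$ (i, j))"
    and "i < m" "j < m"
  shows "continuous_on S (\<lambda>x. adj_mat (A x) $$ (i, j))"
proof -
  have "continuous_on S (\<lambda>x. (-1) ^ (j + i) * det (mat_delete (A x) j i))"
    using assms by (intro continuous_on_mult continuous_on_const det_continuous[of _ "m - 1"])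
      (auto simp: mat_delete_def carrier_matD[OF A])
  then show ?thesis using assms(3,4) by (simp add: adj_mat_def cofactor_def carrier_matD[OF A])
qed

section \<open>Moments of regularized inverse Gram matrices\<close>

text \<open>\<open>C\<close> stands for \<open>U\<^sub>1\<^sup>T K\<^sup>1\<^sup>/\<^sup>2\<close>, so that \<open>w x = C G\<close> is the block \<open>\<Omega>\<^sub>1\<close>
  and \<open>J\<close> the inverse of \<open>H = C C\<^sup>T\<close>. Regularizing \<open>\<Omega>\<^sub>1 \<Omega>\<^sub>1\<^sup>T\<close> by \<open>e H\<close> keeps the
  inverse \<open>R\<close> bounded, so that every function below has polynomial growth.\<close>
locale ridge =
  fixes n N k :: nat and C J :: "nat \<Rightarrow> nat \<Rightarrow> real" and e \<kappa> :: real
  assumes e: "0 < e" and kappa: "0 < \<kappa>"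
    and J: "\<And>a c. a < k \<Longrightarrow> c < k \<Longrightarrow>
      (\<Sum>b<k. (\<Sum>l<n. C a l * C b l) * J b c) = (if a = c then 1 else 0)"
    and coercive: "\<And>v. (\<Sum>a<k. (v a)\<^sup>2) \<le> \<kappa> * (\<Sum>l<n. (\<Sum>a<k. v a * C a l)\<^sup>2)"
begin

abbreviation "I \<equiv> {..<n} \<times> {..<N}"

definition H :: "nat \<Rightarrow> nat \<Rightarrow> real" where
  "H a b = (\<Sum>l<n. C a l * C b l)"

definition w :: "(nat \<times> nat \<Rightarrow> real) \<Rightarrow> nat \<Rightarrow> nat \<Rightarrow> real" where
  "w x a j = (\<Sum>l<n. C a l * x (l, j))"

definition W :: "(nat \<times> nat \<Rightarrow> real) \<Rightarrow> nat \<Rightarrow> nat \<Rightarrow> real" where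
  "W x a b = (\<Sum>j<N. w x a j * w x b j) + e * H a b"

text \<open>The inverse of W as adjugate over determinant: in this form measurability and continuity
  in the entries are immediate.\<close>

definition R :: "(nat \<times> nat \<Rightarrow> real) \<Rightarrow> nat \<Rightarrow> nat \<Rightarrow> real" where
  "R x a b = adj_mat (mat k k (\<lambda>(a, b). W x a b)) $$ (a, b) / det (mat k k (\<lambda>(a, b). W x a b))"

lemma H_sym: "H a b = H b a" by (simp add: H_def mult.commute)
lemma W_sym: "W x a b = W x b a" by (simp add: W_def H_sym[of a b] mult.commute)

lemma W_form:
  "(\<Sum>a<k. \<Sum>b<k. u a * v b * W x a b)
    = (\<Sum>j<N. (\<Sum>a<k. u a * w x a j) * (\<Sum>b<k. v b * w x b j)) + e * (\<Sum>a<k. \<Sum>b<k. u a * v b * H a b)"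
proof -
  have "(\<Sum>a<k. \<Sum>b<k. u a * v b * (\<Sum>j<N. w x a j * w x b j))
      = (\<Sum>a<k. \<Sum>b<k. \<Sum>j<N. (u a * w x a j) * (v b * w x b j))"
    by (simp add: sum_distrib_left mult_ac)
  also have "\<dots> = (\<Sum>a<k. \<Sum>j<N. \<Sum>b<k. (u a * w x a j) * (v b * w x b j))"
    by (intro sum.cong refl sum.swap)
  also have "\<dots> = (\<Sum>j<N. \<Sum>a<k. \<Sum>b<k. (u a * w x a j) * (v b * w x b j))"
    by (rule sum.swap)
  also have "\<dots> = (\<Sum>j<N. (\<Sum>a<k. u a * w x a j) * (\<Sum>b<k. v b * w x b j))"
    by (simp add: sum_product)
  finally show ?thesis
    by (simp add: W_def distrib_left sum.distrib sum_distrib_left mult_ac)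
qed

lemma H_form: "(\<Sum>a<k. \<Sum>b<k. v a * v b * H a b) = (\<Sum>l<n. (\<Sum>a<k. v a * C a l)\<^sup>2)"
proof -
  have "(\<Sum>a<k. \<Sum>b<k. v a * v b * H a b) = (\<Sum>a<k. \<Sum>b<k. \<Sum>l<n. (v a * C a l) * (v b * C b l))"
    by (simp add: H_def sum_distrib_left mult_ac)
  also have "\<dots> = (\<Sum>a<k. \<Sum>l<n. \<Sum>b<k. (v a * C a l) * (v b * C b l))"
    by (intro sum.cong refl sum.swap)
  also have "\<dots> = (\<Sum>l<n. \<Sum>a<k. \<Sum>b<k. (v a * C a l) * (v b * C b l))" by (rule sum.swap)
  finally show ?thesis by (simp add: sum_product power2_eq_square)
qed

text \<open>Omega_1 Omega_1^T is positive semidefinite, so the form of W is at least e times that of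
  H, and \<open>coercive\<close> bounds the latter below by |v|^2 / \<kappa>. It makes W invertible
  and, through \<open>R_form\<close>, keeps R bounded.\<close>

lemma W_coercive: "e / \<kappa> * (\<Sum>a<k. (v a)\<^sup>2) \<le> (\<Sum>a<k. \<Sum>b<k. v a * v b * W x a b)"
proof -
  have "e / \<kappa> * (\<Sum>a<k. (v a)\<^sup>2) \<le> e / \<kappa> * (\<kappa> * (\<Sum>l<n. (\<Sum>a<k. v a * C a l)\<^sup>2))"
    using e kappa by (intro mult_left_mono coercive) auto
  also have "\<dots> \<le> (\<Sum>j<N. (\<Sum>a<k. v a * w x a j) * (\<Sum>b<k. v b * w x b j)) + e * (\<Sum>l<n. (\<Sum>a<k. v a * C a l)\<^sup>2)"
    using kappa by (simp add: sum_nonneg)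
  finally show ?thesis by (simp only: W_form H_form)
qed

lemma det_W: "det (mat k k (\<lambda>(a, b). W x a b)) \<noteq> 0"
proof
  let ?W = "mat k k (\<lambda>(a, b). W x a b)"
  assume "det ?W = 0"
  then obtain v where v: "v \<in> carrier_vec k" "v \<noteq> 0\<^sub>v k" "?W *\<^sub>v v = 0\<^sub>v k"
    using det_0_iff_vec_prod_zero[of ?W k] by auto
  have 0: "(\<Sum>b<k. W x a b * v $ b) = 0" if "a < k" for a
  proof -
    have "(?W *\<^sub>v v) $ a = (\<Sum>b<k. W x a b * v $ b)"
      using that v(1) by (simp add: scalar_prod_def atLeast0LessThan)
    then show ?thesis using that v(3) by simp
  qed
  have "(\<Sum>a<k. \<Sum>b<k. v $ a * v $ b * W x a b) = (\<Sum>a<k. v $ a * (\<Sum>b<k. W x a b * v $ b))"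
    by (simp add: sum_distrib_left mult_ac)
  also have "\<dots> = 0" using 0 by simp
  finally have "e / \<kappa> * (\<Sum>a<k. (v $ a)\<^sup>2) \<le> 0" using W_coercive[of "\<lambda>a. v $ a" x] by simp
  then have "(\<Sum>a<k. (v $ a)\<^sup>2) \<le> 0" using e kappa by (simp add: mult_le_0_iff divide_le_0_iff)
  then have "(\<Sum>a<k. (v $ a)\<^sup>2) = 0" by (intro antisym sum_nonneg) auto
  then have "\<forall>a<k. v $ a = 0" by (simp add: sum_nonneg_eq_0_iff)
  then show False using v(1,2) by (auto intro!: eq_vecI)
qed

lemma R_inverse:
  assumes "a < k" "c < k"
  shows "(\<Sum>b<k. R x a b * W x b c) = (if a = c then 1 else 0)"
    and "(\<Sum>b<k. W x a b * R x b c) = (if a = c then 1 else 0)"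
proof -
  let ?W = "mat k k (\<lambda>(a, b). W x a b)"
  have W: "?W \<in> carrier_mat k k" by simp
  note adj = adj_mat[OF W]
  have "(adj_mat ?W * ?W) $$ (a, c) = (\<Sum>b<k. adj_mat ?W $$ (a, b) * W x b c)"
    using assms adj(1) by (simp add: scalar_prod_def atLeast0LessThan)
  then have "(\<Sum>b<k. adj_mat ?W $$ (a, b) * W x b c) = det ?W * (if a = c then 1 else 0)"
    using assms by (simp add: adj(3))
  then show "(\<Sum>b<k. R x a b * W x b c) = (if a = c then 1 else 0)"
    using det_W[of x] by (simp add: R_def sum_divide_distrib[symmetric])
  have "(?W * adj_mat ?W) $$ (a, c) = (\<Sum>b<k. W x a b * adj_mat ?W $$ (b, c))"
    using assms adj(1) by (simp add: scalar_prod_def atLeast0LessThan)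
  then have "(\<Sum>b<k. W x a b * adj_mat ?W $$ (b, c)) = det ?W * (if a = c then 1 else 0)"
    using assms by (simp add: adj(2))
  then show "(\<Sum>b<k. W x a b * R x b c) = (if a = c then 1 else 0)"
    using det_W[of x] by (simp add: R_def sum_divide_distrib[symmetric])
qed

lemma R_W_vec:
  assumes "a < k" shows "(\<Sum>b<k. R x a b * (\<Sum>c<k. W x b c * v c)) = v a"
proof -
  have "(\<Sum>b<k. R x a b * (\<Sum>c<k. W x b c * v c)) = (\<Sum>b<k. \<Sum>c<k. R x a b * W x b c * v c)"
    by (simp add: sum_distrib_left mult_ac)
  also have "\<dots> = (\<Sum>c<k. \<Sum>b<k. R x a b * W x b c * v c)" by (rule sum.swap)
  also have "\<dots> = (\<Sum>c<k. (if a = c then 1 else 0) * v c)"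
    using assms by (intro sum.cong refl) (simp add: sum_distrib_right[symmetric] R_inverse)
  finally show ?thesis using assms by (simp add: if_distrib[of "\<lambda>z. z * _"] cong: if_cong)
qed

lemma W_R_vec:
  assumes "a < k" shows "(\<Sum>b<k. W x a b * (\<Sum>c<k. R x b c * v c)) = v a"
proof -
  have "(\<Sum>b<k. W x a b * (\<Sum>c<k. R x b c * v c)) = (\<Sum>b<k. \<Sum>c<k. W x a b * R x b c * v c)"
    by (simp add: sum_distrib_left mult_ac)
  also have "\<dots> = (\<Sum>c<k. \<Sum>b<k. W x a b * R x b c * v c)" by (rule sum.swap)
  also have "\<dots> = (\<Sum>c<k. (if a = c then 1 else 0) * v c)"
    using assms by (intro sum.cong refl) (simp add: sum_distrib_right[symmetric] R_inverse)
  finally show ?thesis using assms by (simp add: if_distrib[of "\<lambda>z. z * _"] cong: if_cong)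
qed

lemma R_sym:
  assumes "a < k" "c < k" shows "R x a c = R x c a"
proof -
  have "R x c a = (\<Sum>b<k. R x a b * (\<Sum>d<k. W x b d * R x c d))"
    using R_W_vec[OF assms(1), of x "\<lambda>d. R x c d"] by simp
  also have "\<dots> = (\<Sum>b<k. R x a b * (\<Sum>d<k. R x c d * W x d b))"
    by (simp add: W_sym[of x _ "_"] mult.commute cong: sum.cong)
  also have "\<dots> = (\<Sum>b<k. R x a b * (if c = b then 1 else 0))"
    using assms by (intro sum.cong refl) (simp add: R_inverse)
  finally show ?thesis using assms by (simp add: if_distrib cong: if_cong)
qed

text \<open>This is R = R W R. It transfers the coercivity of W into the bound (e / \<kappa>) |Rv|^2
  \<le> v^T R v of \<open>R_coercive\<close>.\<close>

lemma R_form: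
  "(\<Sum>a<k. \<Sum>b<k. u a * R x a b * v b)
    = (\<Sum>a<k. \<Sum>b<k. (\<Sum>c<k. R x a c * u c) * (\<Sum>c<k. R x b c * v c) * W x a b)"
proof -
  have "(\<Sum>a<k. \<Sum>b<k. (\<Sum>c<k. R x a c * u c) * (\<Sum>c<k. R x b c * v c) * W x a b)
     = (\<Sum>a<k. (\<Sum>c<k. R x a c * u c) * (\<Sum>b<k. W x a b * (\<Sum>c<k. R x b c * v c)))"
    by (simp add: sum_distrib_left mult_ac)
  also have "\<dots> = (\<Sum>a<k. (\<Sum>c<k. R x a c * u c) * v a)"
    by (intro sum.cong refl) (simp add: W_R_vec)
  also have "\<dots> = (\<Sum>a<k. \<Sum>c<k. u c * R x c a * v a)"
    unfolding sum_distrib_right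
  proof (intro sum.cong refl)
    fix a c assume "a \<in> {..<k}" "c \<in> {..<k}"
    then have "R x a c = R x c a" by (simp add: R_sym)
    then show "R x a c * u c * v a = u c * R x c a * v a" by simp
  qed
  also have "\<dots> = (\<Sum>a<k. \<Sum>b<k. u a * R x a b * v b)" by (rule sum.swap)
  finally show ?thesis ..
qed

lemma R_coercive:
  "e / \<kappa> * (\<Sum>a<k. (\<Sum>b<k. R x a b * v b)\<^sup>2) \<le> (\<Sum>a<k. \<Sum>b<k. v a * R x a b * v b)"
  unfolding R_form[of v x v] by (rule W_coercive)

lemma R_col:
  assumes "c < k" shows "e / \<kappa> * (\<Sum>a<k. (R x a c)\<^sup>2) \<le> R x c c"
proof -
  have "(\<Sum>b<k. R x a b * (if b = c then 1 else 0)) = R x a c" for a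
    using assms by (simp add: if_distrib cong: if_cong)
  moreover have "(\<Sum>a<k. \<Sum>b<k. (if a = c then 1 else 0) * R x a b * (if b = c then 1 else 0)) = R x c c"
    using assms by (simp add: if_distrib[of "\<lambda>z. z * _"] if_distrib[of "\<lambda>z. _ * z"] cong: if_cong)
  ultimately show ?thesis using R_coercive[of x "\<lambda>b. if b = c then 1 else 0"] by simp
qed

text \<open>On the diagonal \<open>R_col\<close> gives (e / \<kappa>) R_cc^2 \<le> R_cc, hence R_cc
  \<le> \<kappa> / e. The same inequality then controls the rest of the column.\<close>

lemma R_bounded:
  assumes "a < k" "c < k" shows "\<bar>R x a c\<bar> \<le> \<kappa> / e"
proof -
  have le: "e / \<kappa> * (R x a c)\<^sup>2 \<le> R x c c" if "a < k" for a
  proof -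
    have "(R x a c)\<^sup>2 \<le> (\<Sum>a<k. (R x a c)\<^sup>2)" using that by (intro member_le_sum) auto
    then have "e / \<kappa> * (R x a c)\<^sup>2 \<le> e / \<kappa> * (\<Sum>a<k. (R x a c)\<^sup>2)"
      using e kappa by (intro mult_left_mono) auto
    with R_col[OF assms(2), of x] show ?thesis by linarith
  qed
  have "R x c c \<le> \<kappa> / e"
  proof (rule ccontr)
    assume "\<not> R x c c \<le> \<kappa> / e"
    then have "\<kappa> < e * R x c c" using e by (simp add: field_simps)
    moreover have "0 < R x c c" using \<open>\<not> _\<close> e kappa by (smt (verit) divide_pos_pos)
    ultimately have "\<kappa> * R x c c < e * (R x c c)\<^sup>2" by (simp add: power2_eq_square)
    then show False using le[OF assms(2)] kappa by (simp add: field_simps)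
  qed
  then have "e / \<kappa> * (R x a c)\<^sup>2 \<le> \<kappa> / e" using le[OF assms(1)] by linarith
  then have "\<kappa> / e * (e / \<kappa> * (R x a c)\<^sup>2) \<le> \<kappa> / e * (\<kappa> / e)"
    using e kappa by (intro mult_left_mono) auto
  then have "\<bar>R x a c\<bar>\<^sup>2 \<le> (\<kappa> / e)\<^sup>2" using e kappa by (simp add: power2_eq_square)
  then show ?thesis by (rule power2_le_imp_le) (use e kappa in simp)
qed

lemma tame_w: "j < N \<Longrightarrow> tame I (\<lambda>x. w x a j)"
  unfolding w_def by (intro tame_intros tame_coord) auto

lemma tame_W: "tame I (\<lambda>x. W x a b)"
  unfolding W_def by (intro tame_intros tame_w) auto

lemma tame_R:
  assumes "a < k" "b < k" shows "tame I (\<lambda>x. R x a b)"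
proof (rule tame_bounded)
  have m: "(\<lambda>x. W x a b) \<in> borel_measurable (gauss_on I)" for a b
    by (rule tame_measurable[OF tame_W])
  show "(\<lambda>x. R x a b) \<in> borel_measurable (gauss_on I)"
    unfolding R_def using assms
    by (intro borel_measurable_divide adj_mat_measurable[of _ k] det_measurable[of _ k]) (auto intro: m)
  show "\<bar>R x a b\<bar> \<le> \<kappa> / e" for x by (rule R_bounded[OF assms])
  fix x i assume "i \<in> I"
  then have c: "continuous_on UNIV (\<lambda>s. W (x(i := s)) a b)" for a b
    using tame_W by (auto simp: tame_def)
  show "continuous_on UNIV (\<lambda>s. R (x(i := s)) a b)"
    unfolding R_def using assms det_W
    by (intro continuous_on_divide adj_mat_continuous[of _ k] det_continuous[of _ k]) (auto intro: c)
qed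

text \<open>The matrix R Omega_1, the transpose of the regularized right inverse of Omega_1. The
  next definition is R C.\<close>

definition \<omega> :: "(nat \<times> nat \<Rightarrow> real) \<Rightarrow> nat \<Rightarrow> nat \<Rightarrow> real" where
  "\<omega> x a j = (\<Sum>c<k. R x a c * w x c j)"

definition \<rho> :: "(nat \<times> nat \<Rightarrow> real) \<Rightarrow> nat \<Rightarrow> nat \<Rightarrow> real" where
  "\<rho> x a l = (\<Sum>c<k. R x a c * C c l)"

lemma tame_\<omega>: "a < k \<Longrightarrow> j < N \<Longrightarrow> tame I (\<lambda>x. \<omega> x a j)"
  unfolding \<omega>_def by (intro tame_intros tame_w tame_R) auto

lemma tame_\<rho>: "a < k \<Longrightarrow> tame I (\<lambda>x. \<rho> x a l)"
  unfolding \<rho>_def by (intro tame_intros tame_R) auto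

lemma w_upd:
  assumes "l < n" shows "w (x((l, j) := s)) a i = w x a i + (if i = j then (s - x (l, j)) * C a l else 0)"
proof (cases "i = j")
  case True
  have "w (x((l, j) := s)) a i = (\<Sum>m<n. C a m * x (m, i) + (if m = l then (s - x (l, j)) * C a l else 0))"
    unfolding w_def by (intro sum.cong) (auto simp: True algebra_simps)
  then show ?thesis using assms True by (simp add: sum.distrib w_def)
qed (auto simp: w_def)

lemma w_deriv:
  assumes "l < n"
  shows "((\<lambda>s. w (x((l, j) := s)) a i) has_real_derivative (if i = j then C a l else 0)) (at (x (l, j)))"
  unfolding w_upd[OF assms] by (cases "i = j") (auto intro!: derivative_eq_intros)

lemma W_upd:
  assumes "l < n" "j < N"
  shows "W (x((l, j) := s)) a b - W x a b = (s - x (l, j)) *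
     (C a l * w x b j + w x a j * C b l + (s - x (l, j)) * (C a l * C b l))"
proof -
  have "W (x((l, j) := s)) a b - W x a b
      = (\<Sum>i<N. w (x((l, j) := s)) a i * w (x((l, j) := s)) b i - w x a i * w x b i)"
    by (simp add: W_def sum_subtractf)
  also have "\<dots> = (\<Sum>i<N. if i = j then (s - x (l, j)) *
     (C a l * w x b j + w x a j * C b l + (s - x (l, j)) * (C a l * C b l)) else 0)"
    unfolding w_upd[OF assms(1)] by (intro sum.cong) (auto simp: algebra_simps)
  finally show ?thesis using assms(2) by simp
qed

text \<open>The resolvent identity R_y - R_x = - R_y (W_y - W_x) R_x. It reduces the derivative of R
  to its continuity, so that the adjugate never has to be differentiated.\<close>

lemma R_resolvent:
  assumes "a < k" "b < k"
  shows "R y a b - R x a b = - (\<Sum>c<k. \<Sum>d<k. R y a c * (W y c d - W x c d) * R x d b)"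
proof -
  have "(\<Sum>c<k. \<Sum>d<k. R y a c * (W y c d - W x c d) * R x d b)
      = (\<Sum>c<k. R y a c * (\<Sum>d<k. W y c d * R x d b)) - (\<Sum>c<k. R y a c * (\<Sum>d<k. W x c d * R x d b))"
    by (simp add: sum_subtractf[symmetric] sum_distrib_left algebra_simps)
  also have "\<dots> = R x a b - (\<Sum>c<k. R y a c * (if c = b then 1 else 0))"
    using assms by (simp add: R_W_vec[of a y "\<lambda>d. R x d b"] R_inverse)
  finally show ?thesis using assms by (simp add: if_distrib cong: if_cong)
qed

text \<open>The rule dR = - R (dW) R, where moving the entry (l, j) changes W to first order by the
  symmetrized product of column l of C and column j of Omega_1.\<close>

lemma R_deriv:
  assumes l: "l < n" and j: "j < N" and a: "a < k" and b: "b < k"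
  shows "((\<lambda>s. R (x((l, j) := s)) a b) has_real_derivative
    - (\<rho> x a l * \<omega> x b j + \<omega> x a j * \<rho> x b l)) (at (x (l, j)))"
proof -
  define t where "t = x (l, j)"
  \<comment> \<open>The Caratheodory slope: the resolvent identity divided by s - t. It is
    continuous because R is, by \<open>tame_R\<close>.\<close>
  define h where "h = (\<lambda>s. - (\<Sum>c<k. \<Sum>d<k. R (x((l, j) := s)) a c *
     (C c l * w x d j + w x c j * C d l + (s - t) * (C c l * C d l)) * R x d b))"
  have eq: "R (x((l, j) := s)) a b - R (x((l, j) := t)) a b = h s * (s - t)" for s
  proof -
    have "- (\<Sum>c<k. \<Sum>d<k. R (x((l, j) := s)) a c * (W (x((l, j) := s)) c d - W x c d) * R x d b) = h s * (s - t)"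
      unfolding W_upd[OF l j] h_def t_def minus_mult_left[symmetric] sum_distrib_right
      by (intro arg_cong[of _ _ uminus] sum.cong refl) (simp only: mult_ac)
    then have "R (x((l, j) := s)) a b - R x a b = h s * (s - t)"
      by (simp only: R_resolvent[OF a b, of "x((l, j) := s)" x])
    then show ?thesis by (simp add: t_def)
  qed
  have cont: "isCont h t"
  proof -
    have "continuous_on UNIV (\<lambda>s. R (x((l, j) := s)) a c)" if "c < k" for c
      using tame_R[OF a that] l j by (auto simp: tame_def)
    then have "continuous_on UNIV h" unfolding h_def by (intro continuous_intros) auto
    then show ?thesis by (simp add: continuous_on_eq_continuous_at)
  qed
  have val: "h t = - (\<rho> x a l * \<omega> x b j + \<omega> x a j * \<rho> x b l)"
  proof -
    have "(\<Sum>c<k. \<Sum>d<k. R x a c * (C c l * w x d j + w x c j * C d l) * R x d b)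
       = (\<Sum>c<k. \<Sum>d<k. (R x a c * C c l) * (R x b d * w x d j)) + (\<Sum>c<k. \<Sum>d<k. (R x a c * w x c j) * (R x b d * C d l))"
      unfolding sum.distrib[symmetric]
    proof (intro sum.cong refl)
      fix c d assume "d \<in> {..<k}"
      then have "R x d b = R x b d" using b by (simp add: R_sym)
      then show "R x a c * (C c l * w x d j + w x c j * C d l) * R x d b
          = (R x a c * C c l) * (R x b d * w x d j) + (R x a c * w x c j) * (R x b d * C d l)"
        by (simp add: algebra_simps)
    qed
    then show ?thesis by (simp add: h_def t_def \<rho>_def \<omega>_def sum_product)
  qed
  show ?thesis unfolding t_def[symmetric] by (rule CARAT_DERIV[THEN iffD2]) (use eq cont val in blast)
qed

end

section \<open>Moments of v^T R v and of bilinear forms in the Gaussian matrix\<close>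

lemma gauss_integration_by_parts_direction:
  fixes x :: "'i \<Rightarrow> real"
  assumes fin: "finite I" and L: "finite L" "\<And>l. l \<in> L \<Longrightarrow> \<iota> l \<in> I"
    and f: "tame I f" and D: "\<And>l. l \<in> L \<Longrightarrow> tame I (D l)"
    and der: "\<And>l x. l \<in> L \<Longrightarrow> ((\<lambda>s. f (x(\<iota> l := s))) has_real_derivative D l x) (at (x (\<iota> l)))"
  shows "(\<integral>x. (\<Sum>l\<in>L. y l * x (\<iota> l)) * f x \<partial>gauss_on I) = (\<integral>x. (\<Sum>l\<in>L. y l * D l x) \<partial>gauss_on I)"
proof -
  have t: "tame I (\<lambda>x. x (\<iota> l) * f x)" if "l \<in> L" for l
    using that L f fin by (intro tame_mult tame_coord)
  have "(\<integral>x. (\<Sum>l\<in>L. y l * x (\<iota> l)) * f x \<partial>gauss_on I)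
      = (\<integral>x. (\<Sum>l\<in>L. y l * (x (\<iota> l) * f x)) \<partial>gauss_on I)"
    by (simp only: sum_distrib_right mult.assoc)
  also have "\<dots> = (\<Sum>l\<in>L. y l * (\<integral>x. x (\<iota> l) * f x \<partial>gauss_on I))"
    using fin t by (subst Bochner_Integration.integral_sum) (auto intro!: tame_integrable)
  also have "\<dots> = (\<Sum>l\<in>L. y l * (\<integral>x. D l x \<partial>gauss_on I))"
    using assms by (intro sum.cong refl arg_cong2[of _ _ _ _ "(*)"] gauss_integration_by_parts) auto
  also have "\<dots> = (\<integral>x. (\<Sum>l\<in>L. y l * D l x) \<partial>gauss_on I)"
    using fin D by (subst Bochner_Integration.integral_sum) (auto intro!: tame_integrable)
  finally show ?thesis .
qed

context ridge
begin

text \<open>In matrix notation \<open>Y v\<close> is v^T R v, \<open>\<alpha> v\<close> is Omega_1^T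
  R v, the regularized right inverse applied to v, and \<open>\<pi> v\<close> is C^T R v.\<close>

definition Y :: "(nat \<Rightarrow> real) \<Rightarrow> (nat \<times> nat \<Rightarrow> real) \<Rightarrow> real" where
  "Y v x = (\<Sum>a<k. \<Sum>b<k. v a * R x a b * v b)"

definition \<alpha> :: "(nat \<Rightarrow> real) \<Rightarrow> (nat \<times> nat \<Rightarrow> real) \<Rightarrow> nat \<Rightarrow> real" where
  "\<alpha> v x j = (\<Sum>a<k. v a * \<omega> x a j)"

definition \<pi> :: "(nat \<Rightarrow> real) \<Rightarrow> (nat \<times> nat \<Rightarrow> real) \<Rightarrow> nat \<Rightarrow> real" where
  "\<pi> v x l = (\<Sum>a<k. v a * \<rho> x a l)"

text \<open>Omega_1^T R Omega_1, a regularized version of the projection onto the row space of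
  Omega_1.\<close>

definition \<eta> :: "(nat \<times> nat \<Rightarrow> real) \<Rightarrow> nat \<Rightarrow> nat \<Rightarrow> real" where
  "\<eta> x i j = (\<Sum>c<k. \<omega> x c j * w x c i)"

definition \<tau> :: "(nat \<times> nat \<Rightarrow> real) \<Rightarrow> nat \<Rightarrow> nat \<Rightarrow> real" where
  "\<tau> x l i = (\<Sum>c<k. \<rho> x c l * w x c i)"

text \<open>The derivative of \<alpha>_i in the entry (l, j), by the product rule: the first term
  moves \<open>w\<close>, the other two move \<open>R\<close>.\<close>

definition d\<alpha> :: "(nat \<Rightarrow> real) \<Rightarrow> (nat \<times> nat \<Rightarrow> real) \<Rightarrow> nat \<Rightarrow> nat \<Rightarrow> nat \<Rightarrow> real" where
  "d\<alpha> v x l j i = (if i = j then \<pi> v x l else 0) - \<pi> v x l * \<eta> x i j - \<alpha> v x j * \<tau> x l i"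

lemma tame_Y: "tame I (Y v)" unfolding Y_def by (intro tame_intros tame_R) auto
lemma tame_\<alpha>: "j < N \<Longrightarrow> tame I (\<lambda>x. \<alpha> v x j)" unfolding \<alpha>_def by (intro tame_intros tame_\<omega>) auto
lemma tame_\<pi>: "tame I (\<lambda>x. \<pi> v x l)" unfolding \<pi>_def by (intro tame_intros tame_\<rho>) auto
lemma tame_\<eta>: "i < N \<Longrightarrow> j < N \<Longrightarrow> tame I (\<lambda>x. \<eta> x i j)" unfolding \<eta>_def by (intro tame_intros tame_\<omega> tame_w) auto
lemma tame_\<tau>: "i < N \<Longrightarrow> tame I (\<lambda>x. \<tau> x l i)" unfolding \<tau>_def by (intro tame_intros tame_\<rho> tame_w) auto

lemma tame_d\<alpha>: "i < N \<Longrightarrow> j < N \<Longrightarrow> tame I (\<lambda>x. d\<alpha> v x l j i)"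
  unfolding d\<alpha>_def by (cases "i = j") (auto intro!: tame_intros tame_\<alpha> tame_\<pi> tame_\<eta> tame_\<tau>)

lemma Y_deriv:
  assumes l: "l < n" and j: "j < N"
  shows "((\<lambda>s. Y v (x((l, j) := s))) has_real_derivative - 2 * \<pi> v x l * \<alpha> v x j) (at (x (l, j)))"
proof -
  have "((\<lambda>s. Y v (x((l, j) := s))) has_real_derivative
     (\<Sum>a<k. \<Sum>b<k. v a * (- (\<rho> x a l * \<omega> x b j + \<omega> x a j * \<rho> x b l)) * v b)) (at (x (l, j)))"
    unfolding Y_def
  proof (rule DERIV_sum, rule DERIV_sum)
    fix a b assume "a \<in> {..<k}" "b \<in> {..<k}"
    then have "((\<lambda>s. R (x((l, j) := s)) a b) has_real_derivative - (\<rho> x a l * \<omega> x b j + \<omega> x a j * \<rho> x b l)) (at (x (l, j)))"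
      using l j by (intro R_deriv) auto
    from DERIV_cmult_right[OF DERIV_cmult[OF this, of "v a"], of "v b"]
    show "((\<lambda>s. v a * R (x((l, j) := s)) a b * v b) has_real_derivative
        v a * (- (\<rho> x a l * \<omega> x b j + \<omega> x a j * \<rho> x b l)) * v b) (at (x (l, j)))" .
  qed
  moreover have "(\<Sum>a<k. \<Sum>b<k. v a * (- (\<rho> x a l * \<omega> x b j + \<omega> x a j * \<rho> x b l)) * v b)
     = - ((\<Sum>a<k. \<Sum>b<k. (v a * \<rho> x a l) * (v b * \<omega> x b j)) + (\<Sum>a<k. \<Sum>b<k. (v a * \<omega> x a j) * (v b * \<rho> x b l)))"
    unfolding sum.distrib[symmetric] sum_negf[symmetric] by (intro sum.cong refl) (simp add: algebra_simps)
  moreover have "\<dots> = - 2 * \<pi> v x l * \<alpha> v x j"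
    unfolding sum_product[symmetric] by (simp add: \<pi>_def \<alpha>_def)
  ultimately show ?thesis by simp
qed

lemma \<alpha>_deriv:
  assumes l: "l < n" and j: "j < N"
  shows "((\<lambda>s. \<alpha> v (x((l, j) := s)) i) has_real_derivative d\<alpha> v x l j i) (at (x (l, j)))"
proof -
  let ?c = "\<lambda>c. if i = j then C c l else 0"
  have "((\<lambda>s. \<alpha> v (x((l, j) := s)) i) has_real_derivative
     (\<Sum>a<k. v a * (\<Sum>c<k. - (\<rho> x a l * \<omega> x c j + \<omega> x a j * \<rho> x c l) * w (x((l, j) := x (l, j))) c i
        + ?c c * R (x((l, j) := x (l, j))) a c))) (at (x (l, j)))"
    unfolding \<alpha>_def \<omega>_def[of "x((l, j) := s)" for s]
  proof (rule DERIV_sum, rule DERIV_cmult, rule DERIV_sum)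
    fix a c assume "a \<in> {..<k}" "c \<in> {..<k}"
    then have "((\<lambda>s. R (x((l, j) := s)) a c) has_real_derivative - (\<rho> x a l * \<omega> x c j + \<omega> x a j * \<rho> x c l)) (at (x (l, j)))"
      using l j by (intro R_deriv) auto
    from DERIV_mult[OF this w_deriv[OF l, of x j c i]]
    show "((\<lambda>s. R (x((l, j) := s)) a c * w (x((l, j) := s)) c i) has_real_derivative
       - (\<rho> x a l * \<omega> x c j + \<omega> x a j * \<rho> x c l) * w (x((l, j) := x (l, j))) c i
        + ?c c * R (x((l, j) := x (l, j))) a c) (at (x (l, j)))" .
  qed
  moreover have "(\<Sum>a<k. v a * (\<Sum>c<k. - (\<rho> x a l * \<omega> x c j + \<omega> x a j * \<rho> x c l) * w x c i + ?c c * R x a c))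
     = (\<Sum>a<k. v a * (\<Sum>c<k. R x a c * ?c c))
       - (\<Sum>a<k. \<Sum>c<k. (v a * \<rho> x a l) * (\<omega> x c j * w x c i)) - (\<Sum>a<k. \<Sum>c<k. (v a * \<omega> x a j) * (\<rho> x c l * w x c i))"
    unfolding sum_subtractf[symmetric] sum_distrib_left by (intro sum.cong refl) (simp add: algebra_simps)
  moreover have "\<dots> = d\<alpha> v x l j i"
    unfolding sum_product[symmetric] by (simp add: d\<alpha>_def \<pi>_def \<alpha>_def \<rho>_def \<eta>_def \<tau>_def)
  ultimately show ?thesis by (simp only: fun_upd_triv)
qed

lemma H_J:
  assumes "a < k" shows "(\<Sum>b<k. H a b * (\<Sum>c<k. J b c * v c)) = v a"
proof -
  have "(\<Sum>b<k. H a b * (\<Sum>c<k. J b c * v c)) = (\<Sum>b<k. \<Sum>c<k. H a b * J b c * v c)"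
    by (simp add: sum_distrib_left mult_ac)
  also have "\<dots> = (\<Sum>c<k. \<Sum>b<k. H a b * J b c * v c)" by (rule sum.swap)
  also have "\<dots> = (\<Sum>c<k. (if a = c then 1 else 0) * v c)"
    using assms J by (intro sum.cong refl) (simp add: sum_distrib_right[symmetric] H_def)
  finally show ?thesis using assms by (simp add: if_distrib[of "\<lambda>z. z * _"] cong: if_cong)
qed

lemma Y_eq: "Y v x = (\<Sum>a<k. v a * (\<Sum>b<k. R x a b * v b))"
  by (simp add: Y_def sum_distrib_left mult_ac)

lemma Y_nonneg: "0 \<le> Y v x"
proof -
  have "0 \<le> e / \<kappa> * (\<Sum>a<k. (\<Sum>b<k. R x a b * v b)\<^sup>2)" using e kappa by (simp add: sum_nonneg)
  then show ?thesis unfolding Y_def using R_coercive by (rule order_trans)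
qed

lemma \<alpha>_eq: "\<alpha> v x j = (\<Sum>a<k. (\<Sum>b<k. R x a b * v b) * w x a j)"
proof -
  have "\<alpha> v x j = (\<Sum>a<k. \<Sum>c<k. v a * R x a c * w x c j)"
    by (simp add: \<alpha>_def \<omega>_def sum_distrib_left mult_ac)
  also have "\<dots> = (\<Sum>c<k. \<Sum>a<k. v a * R x a c * w x c j)" by (rule sum.swap)
  also have "\<dots> = (\<Sum>a<k. (\<Sum>b<k. R x a b * v b) * w x a j)"
    unfolding sum_distrib_right
  proof (intro sum.cong refl)
    fix c a assume "a \<in> {..<k}" "c \<in> {..<k}"
    then have "R x a c = R x c a" by (simp add: R_sym)
    then show "v a * R x a c * w x c j = R x c a * v a * w x c j" by simp
  qed
  finally show ?thesis .
qed

text \<open>|Omega_1^T R v|^2 = (Rv)^T (W - e H) (Rv), which falls short of v^T R v by e (Rv)^T H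
  (Rv).\<close>

lemma sum_\<alpha>_sq_le: "(\<Sum>j<N. (\<alpha> v x j)\<^sup>2) \<le> Y v x"
proof -
  let ?a = "\<lambda>a. \<Sum>b<k. R x a b * v b"
  have "Y v x = (\<Sum>j<N. (\<alpha> v x j)\<^sup>2) + e * (\<Sum>a<k. \<Sum>b<k. ?a a * ?a b * H a b)"
    unfolding Y_def R_form W_form by (simp add: \<alpha>_eq power2_eq_square)
  then show ?thesis using e by (simp add: H_form sum_nonneg)
qed

text \<open>tr (R Omega_1 Omega_1^T) = tr (R W) - e tr (R H) = k - e tr (R H), and tr (R H) is the
  sum of the values of \<open>Y\<close> at the columns of C.\<close>

lemma sum_\<eta>_le: "(\<Sum>j<N. \<eta> x j j) \<le> real k"
proof -
  have eq: "(\<Sum>j<N. \<eta> x j j) = (\<Sum>c<k. \<Sum>a<k. R x c a * (\<Sum>j<N. w x a j * w x c j))"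
  proof -
    have "(\<Sum>j<N. \<eta> x j j) = (\<Sum>j<N. \<Sum>c<k. \<Sum>a<k. R x c a * w x a j * w x c j)"
      by (simp add: \<eta>_def \<omega>_def sum_distrib_right)
    also have "\<dots> = (\<Sum>c<k. \<Sum>j<N. \<Sum>a<k. R x c a * w x a j * w x c j)" by (rule sum.swap)
    also have "\<dots> = (\<Sum>c<k. \<Sum>a<k. \<Sum>j<N. R x c a * w x a j * w x c j)" by (intro sum.cong refl sum.swap)
    finally show ?thesis by (simp add: sum_distrib_left mult_ac)
  qed
  have "(\<Sum>c<k. \<Sum>a<k. R x c a * W x a c) = real k"
    by (simp add: R_inverse)
  moreover have "(\<Sum>c<k. \<Sum>a<k. R x c a * W x a c) = (\<Sum>j<N. \<eta> x j j) + e * (\<Sum>c<k. \<Sum>a<k. R x c a * H a c)"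
    unfolding eq by (simp add: W_def distrib_left sum.distrib sum_distrib_left mult_ac)
  moreover have "0 \<le> (\<Sum>c<k. \<Sum>a<k. R x c a * H a c)"
  proof -
    have "(\<Sum>c<k. \<Sum>a<k. R x c a * H a c) = (\<Sum>c<k. \<Sum>a<k. \<Sum>l<n. C c l * R x c a * C a l)"
      by (simp add: H_def sum_distrib_left mult_ac)
    also have "\<dots> = (\<Sum>c<k. \<Sum>l<n. \<Sum>a<k. C c l * R x c a * C a l)" by (intro sum.cong refl sum.swap)
    also have "\<dots> = (\<Sum>l<n. Y (\<lambda>c. C c l) x)" unfolding Y_def by (rule sum.swap)
    finally show ?thesis by (simp add: Y_nonneg sum_nonneg)
  qed
  then have "0 \<le> e * (\<Sum>c<k. \<Sum>a<k. R x c a * H a c)" using e by simp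
  ultimately show ?thesis by linarith
qed

definition J_form :: "(nat \<Rightarrow> real) \<Rightarrow> real" where
  "J_form v = (\<Sum>b<k. v b * (\<Sum>c<k. J b c * v c))"

text \<open>Integration by parts along \<open>C\<^sup>T J v\<close> in each column: this direction moves \<open>w\<close> by exactly \<open>v\<close>,
  and the derivative of \<open>R\<close> produces the trace \<open>\<le> k\<close> that is lost from \<open>N\<close>.\<close>
lemma Y_moment_step:
  "(real N - real k - (2 * real q + 1)) * (\<integral>x. Y v x ^ Suc q \<partial>gauss_on I) \<le> J_form v * (\<integral>x. Y v x ^ q \<partial>gauss_on I)"
proof -
  define u where "u = (\<lambda>b. \<Sum>c<k. J b c * v c)"
  define c where "c = (\<lambda>l. \<Sum>b<k. C b l * u b)"
  define r where "r = (\<lambda>x a. \<Sum>b<k. R x a b * v b)"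
  have Cc: "(\<Sum>l<n. C a l * c l) = v a" if "a < k" for a
  proof -
    have "(\<Sum>l<n. C a l * c l) = (\<Sum>l<n. \<Sum>b<k. C a l * C b l * u b)"
      by (simp add: c_def sum_distrib_left mult_ac)
    also have "\<dots> = (\<Sum>b<k. \<Sum>l<n. C a l * C b l * u b)" by (rule sum.swap)
    also have "\<dots> = v a"
      using H_J[OF that, of v] by (simp add: sum_distrib_right[symmetric] H_def u_def)
    finally show ?thesis .
  qed
  have \<rho>c: "(\<Sum>l<n. c l * \<rho> x a l) = r x a" for x a
  proof -
    have "(\<Sum>l<n. c l * \<rho> x a l) = (\<Sum>l<n. \<Sum>b<k. R x a b * (C b l * c l))"
      by (simp add: \<rho>_def sum_distrib_left mult_ac)
    also have "\<dots> = (\<Sum>b<k. \<Sum>l<n. R x a b * (C b l * c l))" by (rule sum.swap)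
    finally show ?thesis by (simp add: sum_distrib_left[symmetric] Cc r_def)
  qed
  have \<pi>c: "(\<Sum>l<n. c l * \<pi> v x l) = Y v x" for x
  proof -
    have "(\<Sum>l<n. c l * \<pi> v x l) = (\<Sum>l<n. \<Sum>a<k. v a * (c l * \<rho> x a l))"
      by (simp add: \<pi>_def sum_distrib_left mult_ac)
    also have "\<dots> = (\<Sum>a<k. \<Sum>l<n. v a * (c l * \<rho> x a l))" by (rule sum.swap)
    finally show ?thesis by (simp add: sum_distrib_left[symmetric] \<rho>c Y_eq r_def)
  qed
  have \<tau>c: "(\<Sum>l<n. c l * \<tau> x l j) = \<alpha> v x j" for x j
  proof -
    have "(\<Sum>l<n. c l * \<tau> x l j) = (\<Sum>l<n. \<Sum>a<k. (c l * \<rho> x a l) * w x a j)"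
      by (simp add: \<tau>_def sum_distrib_left mult_ac)
    also have "\<dots> = (\<Sum>a<k. \<Sum>l<n. (c l * \<rho> x a l) * w x a j)" by (rule sum.swap)
    finally show ?thesis by (simp add: sum_distrib_right[symmetric] \<rho>c \<alpha>_eq r_def)
  qed
  have cx: "(\<Sum>l<n. c l * x (l, j)) = (\<Sum>b<k. u b * w x b j)" for x j
  proof -
    have "(\<Sum>l<n. c l * x (l, j)) = (\<Sum>l<n. \<Sum>b<k. u b * (C b l * x (l, j)))"
      by (simp add: c_def sum_distrib_right sum_distrib_left mult_ac)
    also have "\<dots> = (\<Sum>b<k. \<Sum>l<n. u b * (C b l * x (l, j)))" by (rule sum.swap)
    finally show ?thesis by (simp add: sum_distrib_left[symmetric] w_def)
  qed
  define f where "f = (\<lambda>j x. \<alpha> v x j * Y v x ^ q)"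
  define D where "D = (\<lambda>j l x. d\<alpha> v x l j j * Y v x ^ q + (real q * (Y v x ^ (q - 1) * (- 2 * \<pi> v x l * \<alpha> v x j))) * \<alpha> v x j)"
  have tf: "tame I (f j)" if "j < N" for j
    unfolding f_def using that by (intro tame_intros tame_\<alpha> tame_Y)
  have tD: "tame I (D j l)" if "j < N" for j l
    unfolding D_def using that by (intro tame_intros tame_\<alpha> tame_Y tame_\<pi> tame_d\<alpha>)
  have tx: "tame I (\<lambda>x. (\<Sum>l<n. c l * x (l, j)))" if "j < N" for j
    using that by (intro tame_intros tame_coord) auto
  have ibp: "(\<integral>x. (\<Sum>l<n. c l * x (l, j)) * f j x \<partial>gauss_on I) = (\<integral>x. (\<Sum>l<n. c l * D j l x) \<partial>gauss_on I)"
    if j: "j < N" for j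
  proof (rule gauss_integration_by_parts_direction[where \<iota> = "\<lambda>l. (l, j)"])
    fix l x assume l: "l \<in> {..<n}"
    then have l: "l < n" by simp
    show "((\<lambda>s. f j (x((l, j) := s))) has_real_derivative D j l x) (at (x (l, j)))"
      unfolding f_def D_def
      by (rule DERIV_cong[OF DERIV_mult[OF \<alpha>_deriv[OF l j] DERIV_power[OF Y_deriv[OF l j]]]])
         (simp add: fun_upd_triv mult_ac del: fun_upd_apply)
  qed (use j tf tD in auto)
  \<comment> \<open>Of the coefficient 2q + 1, the part 2q comes from differentiating the power of
    \<open>Y\<close>, the 1 from the derivative of \<open>R\<close> inside
    \<open>\<alpha>\<close>.\<close>
  have Dsum: "(\<Sum>l<n. c l * D j l x) = (1 - \<eta> x j j) * Y v x ^ Suc q - (2 * real q + 1) * (\<alpha> v x j)\<^sup>2 * Y v x ^ q" for j x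
  proof -
    have "(\<Sum>l<n. c l * D j l x) = (\<Sum>l<n. c l * \<pi> v x l) * ((1 - \<eta> x j j) * Y v x ^ q
          - 2 * real q * (Y v x ^ (q - 1) * (\<alpha> v x j)\<^sup>2))
        - (\<Sum>l<n. c l * \<tau> x l j) * (\<alpha> v x j * Y v x ^ q)"
      unfolding D_def d\<alpha>_def sum_distrib_right sum_subtractf[symmetric]
      by (intro sum.cong refl) (simp add: algebra_simps power2_eq_square)
    then show ?thesis unfolding \<pi>c \<tau>c by (cases q) (simp_all add: algebra_simps power2_eq_square)
  qed
  \<comment> \<open>By W R = 1 the left-hand side without the power of \<open>Y\<close> equals
    \<open>J_form v\<close> - e \<open>Y v\<close>: the ridge has the favourable sign.\<close>
  have lhs: "(\<Sum>j<N. (\<Sum>l<n. c l * x (l, j)) * f j x) \<le> J_form v * Y v x ^ q" for x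
  proof -
    have "(\<Sum>j<N. (\<Sum>l<n. c l * x (l, j)) * \<alpha> v x j) = (\<Sum>a<k. \<Sum>b<k. u a * r x b * W x a b) - e * (\<Sum>a<k. \<Sum>b<k. u a * r x b * H a b)"
      unfolding W_form cx by (simp add: \<alpha>_eq r_def)
    also have "(\<Sum>a<k. \<Sum>b<k. u a * r x b * W x a b) = (\<Sum>a<k. u a * (\<Sum>b<k. W x a b * r x b))"
      by (simp add: sum_distrib_left mult_ac)
    also have "\<dots> = J_form v"
      by (simp add: r_def W_R_vec J_form_def u_def mult.commute[of "v _"])
    also have "(\<Sum>a<k. \<Sum>b<k. u a * r x b * H a b) = Y v x"
    proof -
      have "(\<Sum>a<k. \<Sum>b<k. u a * r x b * H a b) = (\<Sum>b<k. \<Sum>a<k. u a * r x b * H a b)" by (rule sum.swap)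
      also have "\<dots> = (\<Sum>b<k. r x b * (\<Sum>a<k. H b a * u a))"
        by (simp add: sum_distrib_left mult_ac H_sym)
      also have "\<dots> = (\<Sum>b<k. r x b * v b)" by (intro sum.cong refl) (simp add: u_def H_J)
      finally show ?thesis by (simp add: Y_eq r_def mult.commute)
    qed
    finally have "(\<Sum>j<N. (\<Sum>l<n. c l * x (l, j)) * \<alpha> v x j) \<le> J_form v"
      using e Y_nonneg[of v x] by simp
    then have "(\<Sum>j<N. (\<Sum>l<n. c l * x (l, j)) * \<alpha> v x j) * Y v x ^ q \<le> J_form v * Y v x ^ q"
      by (intro mult_right_mono) (simp_all add: Y_nonneg)
    then show ?thesis by (simp only: f_def sum_distrib_right mult.assoc)
  qed
  have rhs: "(real N - real k - (2 * real q + 1)) * Y v x ^ Suc q \<le> (\<Sum>j<N. \<Sum>l<n. c l * D j l x)" for x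
  proof -
    have "(\<Sum>j<N. \<Sum>l<n. c l * D j l x) = (real N - (\<Sum>j<N. \<eta> x j j)) * Y v x ^ Suc q
        - (2 * real q + 1) * (\<Sum>j<N. (\<alpha> v x j)\<^sup>2) * Y v x ^ q"
      unfolding Dsum by (simp add: sum_subtractf sum_distrib_left sum_distrib_right algebra_simps)
    moreover have "(real N - real k) * Y v x ^ Suc q \<le> (real N - (\<Sum>j<N. \<eta> x j j)) * Y v x ^ Suc q"
      using sum_\<eta>_le[of x] Y_nonneg[of v x] by (intro mult_right_mono) auto
    moreover have "(2 * real q + 1) * (\<Sum>j<N. (\<alpha> v x j)\<^sup>2) * Y v x ^ q \<le> (2 * real q + 1) * Y v x * Y v x ^ q"
      using sum_\<alpha>_sq_le[of v x] Y_nonneg[of v x] by (intro mult_right_mono mult_left_mono) auto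
    ultimately show ?thesis by (simp add: algebra_simps)
  qed
  have "(real N - real k - (2 * real q + 1)) * (\<integral>x. Y v x ^ Suc q \<partial>gauss_on I)
      = (\<integral>x. (real N - real k - (2 * real q + 1)) * Y v x ^ Suc q \<partial>gauss_on I)" by simp
  also have "\<dots> \<le> (\<integral>x. (\<Sum>j<N. \<Sum>l<n. c l * D j l x) \<partial>gauss_on I)"
    by (intro integral_mono rhs tame_integrable tame_intros tame_Y tD) auto
  also have "\<dots> = (\<Sum>j<N. \<integral>x. (\<Sum>l<n. c l * x (l, j)) * f j x \<partial>gauss_on I)"
    by (subst Bochner_Integration.integral_sum) (auto intro!: tame_integrable tame_intros tD simp: ibp)
  also have "\<dots> = (\<integral>x. (\<Sum>j<N. (\<Sum>l<n. c l * x (l, j)) * f j x) \<partial>gauss_on I)"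
    by (subst Bochner_Integration.integral_sum) (auto intro!: tame_integrable tame_mult tx tf)
  also have "\<dots> \<le> (\<integral>x. J_form v * Y v x ^ q \<partial>gauss_on I)"
    by (intro integral_mono lhs tame_integrable tame_intros tame_Y tf tame_mult[OF tx tf]) auto
  finally show ?thesis by simp
qed

lemma J_form_nonneg: "0 \<le> J_form v"
proof -
  let ?u = "\<lambda>b. \<Sum>c<k. J b c * v c"
  have "J_form v = (\<Sum>a<k. ?u a * (\<Sum>b<k. H a b * ?u b))"
    unfolding J_form_def by (intro sum.cong refl) (simp add: H_J)
  also have "\<dots> = (\<Sum>a<k. \<Sum>b<k. ?u a * ?u b * H a b)" by (simp add: sum_distrib_left mult_ac)
  finally show ?thesis by (simp add: H_form sum_nonneg)
qed

text \<open>With N = k + p the factor of \<open>Y_moment_step\<close> is p - 1 - 2q. At e = 0 the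
  ratio \<open>J_form v / Y v\<close> would be chi-square with p + 1 degrees of freedom, and the
  product is its exact negative moment, so the ridge loses nothing here.\<close>

lemma Y_moment:
  assumes N: "N = k + p" and q: "2 * q \<le> p"
  shows "(\<integral>x. Y v x ^ q \<partial>gauss_on I) \<le> J_form v ^ q / (\<Prod>i<q. real p - 1 - 2 * real i)"
  using q
proof (induction q)
  case 0
  then show ?case using prob_space.prob_space[OF prob_space_gauss_on, of I] by simp
next
  case (Suc q)
  have "real (2 * Suc q) \<le> real p" using Suc.prems by (simp only: of_nat_le_iff)
  then have pos: "0 < real p - 1 - 2 * real q" by simp
  have "(real p - 1 - 2 * real q) * (\<integral>x. Y v x ^ Suc q \<partial>gauss_on I) \<le> J_form v * (\<integral>x. Y v x ^ q \<partial>gauss_on I)"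
    using Y_moment_step[of q v] by (simp add: N algebra_simps)
  also have "\<dots> \<le> J_form v * (J_form v ^ q / (\<Prod>i<q. real p - 1 - 2 * real i))"
    using Suc by (intro mult_left_mono J_form_nonneg) auto
  finally have "(\<integral>x. Y v x ^ Suc q \<partial>gauss_on I)
      \<le> J_form v * (J_form v ^ q / (\<Prod>i<q. real p - 1 - 2 * real i)) / (real p - 1 - 2 * real q)"
    by (simp only: pos_le_divide_eq[OF pos] mult.commute[of _ "real p - 1 - 2 * real q"])
  then show ?case by (simp add: mult_ac)
qed

text \<open>A direction \<open>y\<close> with \<open>C y = 0\<close> leaves \<open>w\<close> fixed. This replaces the independence of \<open>y\<^sup>T G\<close> and \<open>C G\<close>.\<close>
lemma bilinear_moment_step:
  fixes y v :: "nat \<Rightarrow> real"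
  assumes y: "\<And>a. a < k \<Longrightarrow> (\<Sum>l<n. C a l * y l) = 0"
  defines "T \<equiv> \<lambda>x. \<Sum>j<N. (\<Sum>l<n. y l * x (l, j)) * \<alpha> v x j"
    and "\<beta> \<equiv> \<lambda>x. \<Sum>j<N. (\<alpha> v x j)\<^sup>2"
  shows "(\<integral>x. T x ^ Suc s * \<beta> x ^ r \<partial>gauss_on I)
     = real s * (\<Sum>l<n. (y l)\<^sup>2) * (\<integral>x. T x ^ (s - 1) * \<beta> x ^ Suc r \<partial>gauss_on I)"
proof -
  define z :: "(nat \<times> nat \<Rightarrow> real) \<Rightarrow> nat \<Rightarrow> real" where "z = (\<lambda>x j. \<Sum>l<n. y l * x (l, j))"
  have y\<rho>: "(\<Sum>l<n. y l * \<rho> x a l) = 0" for x a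
  proof -
    have "(\<Sum>l<n. y l * \<rho> x a l) = (\<Sum>l<n. \<Sum>b<k. R x a b * (C b l * y l))"
      by (simp add: \<rho>_def sum_distrib_left mult_ac)
    also have "\<dots> = (\<Sum>b<k. \<Sum>l<n. R x a b * (C b l * y l))" by (rule sum.swap)
    finally show ?thesis by (simp add: sum_distrib_left[symmetric] y)
  qed
  have y\<pi>: "(\<Sum>l<n. y l * \<pi> v x l) = 0" for x
  proof -
    have "(\<Sum>l<n. y l * \<pi> v x l) = (\<Sum>l<n. \<Sum>a<k. v a * (y l * \<rho> x a l))"
      by (simp add: \<pi>_def sum_distrib_left mult_ac)
    also have "\<dots> = (\<Sum>a<k. \<Sum>l<n. v a * (y l * \<rho> x a l))" by (rule sum.swap)
    finally show ?thesis by (simp add: sum_distrib_left[symmetric] y\<rho>)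
  qed
  have y\<tau>: "(\<Sum>l<n. y l * \<tau> x l j) = 0" for x j
  proof -
    have "(\<Sum>l<n. y l * \<tau> x l j) = (\<Sum>l<n. \<Sum>a<k. (y l * \<rho> x a l) * w x a j)"
      by (simp add: \<tau>_def sum_distrib_left mult_ac)
    also have "\<dots> = (\<Sum>a<k. \<Sum>l<n. (y l * \<rho> x a l) * w x a j)" by (rule sum.swap)
    finally show ?thesis by (simp add: sum_distrib_right[symmetric] y\<rho>)
  qed
  \<comment> \<open>To first order \<open>w\<close>, \<open>R\<close> and hence
    \<open>\<alpha>\<close> stand still along y. Only the explicit factor y^T G of \<open>T\<close>
    moves, at the rate |y|^2 \<alpha>_j in column j.\<close>
  have yd\<alpha>: "(\<Sum>l<n. y l * d\<alpha> v x l j i) = 0" for x i j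
  proof -
    have "(\<Sum>l<n. y l * d\<alpha> v x l j i) = (\<Sum>l<n. y l * \<pi> v x l) * ((if i = j then 1 else 0) - \<eta> x i j)
        - \<alpha> v x j * (\<Sum>l<n. y l * \<tau> x l i)"
      unfolding d\<alpha>_def sum_distrib_left sum_distrib_right sum_subtractf[symmetric]
      by (intro sum.cong refl) (simp add: algebra_simps)
    then show ?thesis by (simp add: y\<pi> y\<tau>)
  qed
  define d\<beta> where "d\<beta> = (\<lambda>j l x. \<Sum>i<N. 2 * \<alpha> v x i * d\<alpha> v x l j i)"
  define dT where "dT = (\<lambda>j l x. y l * \<alpha> v x j + (\<Sum>i<N. z x i * d\<alpha> v x l j i))"
  have tz: "tame I (\<lambda>x. z x j)" if "j < N" for j
    unfolding z_def using that by (intro tame_intros tame_coord) auto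
  have T_eq: "T = (\<lambda>x. \<Sum>j<N. z x j * \<alpha> v x j)" by (simp add: T_def z_def)
  have tT: "tame I T" unfolding T_eq by (intro tame_intros tame_\<alpha> tz) auto
  have t\<beta>: "tame I \<beta>" unfolding \<beta>_def by (intro tame_intros tame_\<alpha>) auto
  have td\<beta>: "tame I (d\<beta> j l)" if "j < N" for j l
    unfolding d\<beta>_def using that by (intro tame_intros tame_\<alpha> tame_d\<alpha>) auto
  have tdT: "tame I (dT j l)" if "j < N" for j l
    unfolding dT_def using that by (intro tame_intros tame_\<alpha> tame_d\<alpha> tz) auto
  have d\<beta>: "((\<lambda>s. \<beta> (x((l, j) := s))) has_real_derivative d\<beta> j l x) (at (x (l, j)))" if "l < n" "j < N" for j l x
  proof -
    have "((\<lambda>s. \<beta> (x((l, j) := s))) has_real_derivative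
       (\<Sum>i<N. real 2 * (d\<alpha> v x l j i * \<alpha> v (x((l, j) := x (l, j))) i ^ (2 - Suc 0)))) (at (x (l, j)))"
      unfolding \<beta>_def by (intro DERIV_sum DERIV_power \<alpha>_deriv that)
    then show ?thesis by (simp add: d\<beta>_def fun_upd_triv mult_ac del: fun_upd_apply)
  qed
  have dz: "((\<lambda>s. z (x((l, j) := s)) i) has_real_derivative (if i = j then y l else 0)) (at (x (l, j)))" if "l < n" for i j l x
  proof -
    have "((\<lambda>s. z (x((l, j) := s)) i) has_real_derivative (\<Sum>m<n. y m * (if (m, i) = (l, j) then 1 else 0))) (at (x (l, j)))"
      unfolding z_def by (intro DERIV_sum DERIV_cmult has_derivative_coord)
    moreover have "(\<Sum>m<n. y m * (if (m, i) = (l, j) then 1 else 0)) = (\<Sum>m<n. if m = l then (if i = j then y l else 0) else 0)"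
      by (intro sum.cong) auto
    ultimately show ?thesis using that by simp
  qed
  have dT: "((\<lambda>s. T (x((l, j) := s))) has_real_derivative dT j l x) (at (x (l, j)))" if l: "l < n" and j: "j < N" for j l x
  proof -
    have "((\<lambda>s. \<Sum>i<N. z (x((l, j) := s)) i * \<alpha> v (x((l, j) := s)) i) has_real_derivative
       (\<Sum>i<N. (if i = j then y l else 0) * \<alpha> v (x((l, j) := x (l, j))) i + d\<alpha> v x l j i * z (x((l, j) := x (l, j))) i)) (at (x (l, j)))"
      by (intro DERIV_sum DERIV_mult \<alpha>_deriv dz that)
    moreover have "(\<Sum>i<N. (if i = j then y l else 0) * \<alpha> v x i + d\<alpha> v x l j i * z x i) = dT j l x"
      using j by (simp add: dT_def sum.distrib if_distrib[of "\<lambda>z. z * _"] mult.commute cong: if_cong)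
    ultimately show ?thesis by (simp only: T_eq fun_upd_triv)
  qed
  define f where "f = (\<lambda>j x. \<alpha> v x j * (T x ^ s * \<beta> x ^ r))"
  define D where "D = (\<lambda>j l x. d\<alpha> v x l j j * (T x ^ s * \<beta> x ^ r)
     + (real s * (dT j l x * T x ^ (s - 1)) * \<beta> x ^ r + real r * (d\<beta> j l x * \<beta> x ^ (r - 1)) * T x ^ s) * \<alpha> v x j)"
  have tf: "tame I (f j)" if "j < N" for j
    unfolding f_def using that by (intro tame_intros tame_\<alpha> tT t\<beta>)
  have tD: "tame I (D j l)" if "j < N" for j l
    unfolding D_def using that by (intro tame_intros tame_\<alpha> tT t\<beta> tdT td\<beta> tame_d\<alpha>)
  have ibp: "(\<integral>x. z x j * f j x \<partial>gauss_on I) = (\<integral>x. (\<Sum>l<n. y l * D j l x) \<partial>gauss_on I)"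
    if j: "j < N" for j
    unfolding z_def
  proof (rule gauss_integration_by_parts_direction[where \<iota> = "\<lambda>l. (l, j)"])
    fix l x assume l: "l \<in> {..<n}"
    then have l: "l < n" by simp
    show "((\<lambda>s. f j (x((l, j) := s))) has_real_derivative D j l x) (at (x (l, j)))"
      unfolding f_def D_def
      by (rule DERIV_cong[OF DERIV_mult[OF \<alpha>_deriv[OF l j]
            DERIV_mult[OF DERIV_power[OF dT[OF l j]] DERIV_power[OF d\<beta>[OF l j]]]]])
         (simp add: fun_upd_triv del: fun_upd_apply)
  qed (use j tf tD in auto)
  have yd\<beta>: "(\<Sum>l<n. y l * d\<beta> j l x) = 0" for j x
  proof -
    have "(\<Sum>l<n. y l * d\<beta> j l x) = (\<Sum>l<n. \<Sum>i<N. (2 * \<alpha> v x i) * (y l * d\<alpha> v x l j i))"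
      by (simp add: d\<beta>_def sum_distrib_left mult_ac)
    also have "\<dots> = (\<Sum>i<N. \<Sum>l<n. (2 * \<alpha> v x i) * (y l * d\<alpha> v x l j i))" by (rule sum.swap)
    finally show ?thesis by (simp only: sum_distrib_left[symmetric] yd\<alpha>) simp
  qed
  have ydT: "(\<Sum>l<n. y l * dT j l x) = (\<Sum>l<n. (y l)\<^sup>2) * \<alpha> v x j" for j x
  proof -
    have "(\<Sum>l<n. y l * dT j l x) = (\<Sum>l<n. (y l)\<^sup>2) * \<alpha> v x j + (\<Sum>l<n. \<Sum>i<N. z x i * (y l * d\<alpha> v x l j i))"
      by (simp add: dT_def sum_distrib_left sum_distrib_right distrib_left sum.distrib power2_eq_square mult_ac)
    also have "(\<Sum>l<n. \<Sum>i<N. z x i * (y l * d\<alpha> v x l j i)) = (\<Sum>i<N. \<Sum>l<n. z x i * (y l * d\<alpha> v x l j i))"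
      by (rule sum.swap)
    finally show ?thesis by (simp only: sum_distrib_left[symmetric] yd\<alpha>) simp
  qed
  have Dsum: "(\<Sum>l<n. y l * D j l x) = real s * (\<Sum>l<n. (y l)\<^sup>2) * (\<alpha> v x j)\<^sup>2 * (T x ^ (s - 1) * \<beta> x ^ r)" for j x
  proof -
    have "(\<Sum>l<n. y l * D j l x) = (\<Sum>l<n. y l * d\<alpha> v x l j j) * (T x ^ s * \<beta> x ^ r)
       + (\<Sum>l<n. y l * dT j l x) * (real s * T x ^ (s - 1) * \<beta> x ^ r * \<alpha> v x j)
       + (\<Sum>l<n. y l * d\<beta> j l x) * (real r * \<beta> x ^ (r - 1) * T x ^ s * \<alpha> v x j)"
      unfolding D_def sum_distrib_right sum.distrib[symmetric] by (intro sum.cong refl) (simp add: algebra_simps)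
    then show ?thesis unfolding yd\<alpha> yd\<beta> ydT by (simp add: power2_eq_square mult_ac)
  qed
  have "(\<integral>x. T x ^ Suc s * \<beta> x ^ r \<partial>gauss_on I) = (\<integral>x. (\<Sum>j<N. z x j * f j x) \<partial>gauss_on I)"
  proof (intro Bochner_Integration.integral_cong refl)
    fix x
    have "T x ^ Suc s * \<beta> x ^ r = (\<Sum>j<N. z x j * \<alpha> v x j) * (T x ^ s * \<beta> x ^ r)"
      unfolding power_Suc mult.assoc by (simp only: T_eq)
    then show "T x ^ Suc s * \<beta> x ^ r = (\<Sum>j<N. z x j * f j x)"
      by (simp only: f_def sum_distrib_right mult.assoc)
  qed
  also have "\<dots> = (\<Sum>j<N. \<integral>x. (\<Sum>l<n. y l * D j l x) \<partial>gauss_on I)"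
    by (subst Bochner_Integration.integral_sum) (auto intro!: tame_integrable tame_mult tz tf sum.cong ibp)
  also have "\<dots> = (\<integral>x. (\<Sum>j<N. \<Sum>l<n. y l * D j l x) \<partial>gauss_on I)"
    by (subst Bochner_Integration.integral_sum) (auto intro!: tame_integrable tame_intros tD)
  also have "\<dots> = (\<integral>x. real s * (\<Sum>l<n. (y l)\<^sup>2) * (T x ^ (s - 1) * \<beta> x ^ Suc r) \<partial>gauss_on I)"
  proof (intro Bochner_Integration.integral_cong refl)
    fix x
    define A where "A = (\<Sum>l<n. (y l)\<^sup>2)"
    have \<beta>: "(\<Sum>j<N. (\<alpha> v x j)\<^sup>2) = \<beta> x" by (simp add: \<beta>_def)
    show "(\<Sum>j<N. \<Sum>l<n. y l * D j l x) = real s * (\<Sum>l<n. (y l)\<^sup>2) * (T x ^ (s - 1) * \<beta> x ^ Suc r)"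
      unfolding Dsum A_def[symmetric] sum_distrib_left[symmetric] sum_distrib_right[symmetric] \<beta>
      by (simp add: mult_ac)
  qed
  finally show ?thesis by simp
qed

text \<open>y^T G applied to the regularized right inverse of Omega_1 at v, where x holds the
  entries of G.\<close>

definition bilinear :: "(nat \<Rightarrow> real) \<Rightarrow> (nat \<Rightarrow> real) \<Rightarrow> (nat \<times> nat \<Rightarrow> real) \<Rightarrow> real" where
  "bilinear y v x = (\<Sum>j<N. (\<Sum>l<n. y l * x (l, j)) * \<alpha> v x j)"

lemma tame_bilinear: "tame I (bilinear y v)"
  unfolding bilinear_def by (intro tame_sum tame_mult tame_const tame_coord tame_\<alpha>) auto

lemma bilinear_mean:
  assumes "\<And>a. a < k \<Longrightarrow> (\<Sum>l<n. C a l * y l) = 0"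
  shows "(\<integral>x. bilinear y v x \<partial>gauss_on I) = 0"
  using bilinear_moment_step[OF assms, of v 0 0] by (simp add: bilinear_def)

text \<open>These are the moments of a centred Gaussian with conditional variance |y|^2
  |\<alpha>|^2. Each use of \<open>bilinear_moment_step\<close> trades two powers of the form for
  one power of |\<alpha>|^2, which \<open>Y\<close> bounds at the end.\<close>

lemma bilinear_moment:
  assumes y: "\<And>a. a < k \<Longrightarrow> (\<Sum>l<n. C a l * y l) = 0"
  shows "(\<integral>x. bilinear y v x ^ (2 * q) \<partial>gauss_on I)
     \<le> (\<Prod>i<q. 2 * real i + 1) * (\<Sum>l<n. (y l)\<^sup>2) ^ q * (\<integral>x. Y v x ^ q \<partial>gauss_on I)"
proof -
  let ?\<beta> = "\<lambda>x. \<Sum>j<N. (\<alpha> v x j)\<^sup>2"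
  have "(\<integral>x. bilinear y v x ^ (2 * q) * ?\<beta> x ^ r \<partial>gauss_on I)
     = (\<Prod>i<q. 2 * real i + 1) * (\<Sum>l<n. (y l)\<^sup>2) ^ q * (\<integral>x. ?\<beta> x ^ (q + r) \<partial>gauss_on I)" for r
  proof (induction q arbitrary: r)
    case (Suc q)
    show ?case
      using bilinear_moment_step[OF y, of v "2 * q + 1" r] Suc.IH[of "Suc r"]
      by (simp add: bilinear_def mult_ac)
  qed simp
  from this[of 0] have "(\<integral>x. bilinear y v x ^ (2 * q) \<partial>gauss_on I)
     = (\<Prod>i<q. 2 * real i + 1) * (\<Sum>l<n. (y l)\<^sup>2) ^ q * (\<integral>x. ?\<beta> x ^ q \<partial>gauss_on I)" by simp
  also have "\<dots> \<le> (\<Prod>i<q. 2 * real i + 1) * (\<Sum>l<n. (y l)\<^sup>2) ^ q * (\<integral>x. Y v x ^ q \<partial>gauss_on I)"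
  proof (intro mult_left_mono integral_mono power_mono sum_\<alpha>_sq_le tame_integrable)
    show "tame I (\<lambda>x. ?\<beta> x ^ q)" by (intro tame_power tame_sum tame_\<alpha>) auto
    show "tame I (\<lambda>x. Y v x ^ q)" by (intro tame_power tame_Y)
  qed (auto simp: sum_nonneg prod_nonneg)
  finally show ?thesis .
qed

end

text \<open>The tangent of s^q at s = t, by Bernoulli. It passes from a q-th moment to a first
  moment by an expression that is linear in s^q, and at s = t it is an equality, so no constant is
  lost.\<close>

lemma young_power:
  fixes s t :: real
  assumes "0 \<le> s" "0 < t" "0 < q"
  shows "s \<le> t * (real q - 1) / real q + s ^ q / (real q * t ^ (q - 1))"
proof -
  have "1 + real q * (s / t - 1) \<le> (1 + (s / t - 1)) ^ q"
    using assms by (intro Bernoulli_inequality) simp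
  then have "t * (1 + real q * (s / t - 1)) \<le> t * (s / t) ^ q"
    using assms by (intro mult_left_mono) auto
  also have "t * (s / t) ^ q = s ^ q / t ^ (q - 1)"
    using assms by (cases q) (auto simp: power_divide field_simps)
  also have "t * (1 + real q * (s / t - 1)) = t + real q * (s - t)"
    using assms by (simp add: field_simps)
  finally have "(t + real q * (s - t)) / real q \<le> s ^ q / t ^ (q - 1) / real q"
    by (rule divide_right_mono) simp
  then show ?thesis using assms by (simp add: field_simps)
qed

section \<open>From moments of bilinear forms to second moments and operator bounds\<close>

context ridge
begin

definition \<beta> :: "(nat \<Rightarrow> real) \<Rightarrow> nat \<Rightarrow> (nat \<times> nat \<Rightarrow> real) \<Rightarrow> real" where
  "\<beta> y a x = (\<Sum>j<N. (\<Sum>l<n. y l * x (l, j)) * \<omega> x a j)"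

lemma bilinear_eq_\<beta>: "bilinear y v x = (\<Sum>a<k. v a * \<beta> y a x)"
proof -
  have "bilinear y v x = (\<Sum>j<N. \<Sum>a<k. v a * ((\<Sum>l<n. y l * x (l, j)) * \<omega> x a j))"
    by (simp add: bilinear_def \<alpha>_def sum_distrib_left mult_ac)
  also have "\<dots> = (\<Sum>a<k. \<Sum>j<N. v a * ((\<Sum>l<n. y l * x (l, j)) * \<omega> x a j))" by (rule sum.swap)
  finally show ?thesis by (simp add: \<beta>_def sum_distrib_left)
qed

lemma \<beta>_sum: "\<beta> (\<lambda>l. \<Sum>b<r. h b * S b l) a x = (\<Sum>b<r. h b * \<beta> (S b) a x)"
proof -
  have "(\<Sum>l<n. (\<Sum>b<r. h b * S b l) * x (l, j)) = (\<Sum>b<r. h b * (\<Sum>l<n. S b l * x (l, j)))" for j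
  proof -
    have "(\<Sum>l<n. (\<Sum>b<r. h b * S b l) * x (l, j)) = (\<Sum>l<n. \<Sum>b<r. h b * (S b l * x (l, j)))"
      by (simp only: sum_distrib_right mult.assoc)
    also have "\<dots> = (\<Sum>b<r. \<Sum>l<n. h b * (S b l * x (l, j)))" by (rule sum.swap)
    finally show ?thesis by (simp add: sum_distrib_left)
  qed
  then have "\<beta> (\<lambda>l. \<Sum>b<r. h b * S b l) a x = (\<Sum>j<N. (\<Sum>b<r. h b * (\<Sum>l<n. S b l * x (l, j))) * \<omega> x a j)"
    by (simp only: \<beta>_def)
  also have "\<dots> = (\<Sum>j<N. \<Sum>b<r. h b * ((\<Sum>l<n. S b l * x (l, j)) * \<omega> x a j))"
    by (simp only: sum_distrib_right[of _ "{..<r}"] mult.assoc)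
  also have "\<dots> = (\<Sum>b<r. \<Sum>j<N. h b * ((\<Sum>l<n. S b l * x (l, j)) * \<omega> x a j))" by (rule sum.swap)
  finally show ?thesis by (simp add: \<beta>_def sum_distrib_left)
qed

lemma tame_\<beta>: "a < k \<Longrightarrow> tame I (\<beta> y a)"
  unfolding \<beta>_def by (intro tame_sum tame_mult tame_const tame_coord tame_\<omega>) auto

lemma bilinear_sum: "bilinear (\<lambda>l. \<Sum>b<r. h b * S b l) v x = (\<Sum>b<r. h b * bilinear (S b) v x)"
proof -
  have "bilinear (\<lambda>l. \<Sum>b<r. h b * S b l) v x = (\<Sum>a<k. \<Sum>b<r. h b * (v a * \<beta> (S b) a x))"
    by (simp add: bilinear_eq_\<beta> \<beta>_sum sum_distrib_left mult_ac)
  also have "\<dots> = (\<Sum>b<r. \<Sum>a<k. h b * (v a * \<beta> (S b) a x))" by (rule sum.swap)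
  finally show ?thesis by (simp add: bilinear_eq_\<beta> sum_distrib_left)
qed

text \<open>The cross term vanishes by \<open>bilinear_mean\<close>, so the deterministic part is
  added without loss. This is the entrywise form of the nuclear bound.\<close>

lemma bilinear_second_moment:
  assumes y: "\<And>a. a < k \<Longrightarrow> (\<Sum>l<n. C a l * y l) = 0" and N: "N = k + p" and p: "2 \<le> p"
  shows "(\<integral>x. (c + bilinear y v x)\<^sup>2 \<partial>gauss_on I) \<le> c\<^sup>2 + (\<Sum>l<n. (y l)\<^sup>2) * (J_form v / (real p - 1))"
proof -
  have "(\<integral>x. (c + bilinear y v x)\<^sup>2 \<partial>gauss_on I) = (\<integral>x. c\<^sup>2 + (2 * c * bilinear y v x + bilinear y v x ^ (2 * 1)) \<partial>gauss_on I)"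
    by (intro Bochner_Integration.integral_cong) (auto simp: power2_eq_square algebra_simps)
  also have "\<dots> = c\<^sup>2 + (2 * c * (\<integral>x. bilinear y v x \<partial>gauss_on I) + (\<integral>x. bilinear y v x ^ (2 * 1) \<partial>gauss_on I))"
    using prob_space.prob_space[OF prob_space_gauss_on, of I] tame_bilinear
    by (subst Bochner_Integration.integral_add, (intro tame_integrable tame_intros tame_bilinear; simp)+)
       (simp add: tame_integrable tame_bilinear tame_intros)
  also have "\<dots> \<le> c\<^sup>2 + ((\<Sum>l<n. (y l)\<^sup>2) * (\<integral>x. Y v x ^ 1 \<partial>gauss_on I))"
    using bilinear_moment[OF y, of v 1] by (simp add: bilinear_mean[OF y])
  also have "\<dots> \<le> c\<^sup>2 + (\<Sum>l<n. (y l)\<^sup>2) * (J_form v / (real p - 1))"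
    using Y_moment[OF N, of 1 v] p by (intro add_left_mono mult_left_mono sum_nonneg) auto
  finally show ?thesis .
qed

text \<open>The Frobenius norm of R is controlled by (\<kappa> / e) tr R. Thus |Ru|^2 costs only one
  factor 1 / e, whereas the defect of the right inverse carries e^2.\<close>

lemma R_apply_sq: "e * (\<Sum>a<k. (\<Sum>b<k. R x a b * u b)\<^sup>2) \<le> \<kappa> * (\<Sum>c<k. R x c c) * (\<Sum>b<k. (u b)\<^sup>2)"
proof -
  have "(\<Sum>a<k. (\<Sum>b<k. R x a b * u b)\<^sup>2) \<le> (\<Sum>a<k. (\<Sum>b<k. (R x a b)\<^sup>2) * (\<Sum>b<k. (u b)\<^sup>2))"
    by (intro sum_mono Cauchy_Schwarz_ineq_sum)
  also have "\<dots> = (\<Sum>a<k. \<Sum>b<k. (R x a b)\<^sup>2) * (\<Sum>b<k. (u b)\<^sup>2)" by (simp add: sum_distrib_right)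
  also have "(\<Sum>a<k. \<Sum>b<k. (R x a b)\<^sup>2) = (\<Sum>b<k. \<Sum>a<k. (R x a b)\<^sup>2)" by (rule sum.swap)
  also have "\<dots> \<le> (\<Sum>b<k. \<kappa> / e * R x b b)"
  proof (rule sum_mono)
    fix b assume "b \<in> {..<k}"
    then have "\<kappa> / e * (e / \<kappa> * (\<Sum>a<k. (R x a b)\<^sup>2)) \<le> \<kappa> / e * R x b b"
      using e kappa by (intro mult_left_mono R_col) auto
    then show "(\<Sum>a<k. (R x a b)\<^sup>2) \<le> \<kappa> / e * R x b b" using e kappa by simp
  qed
  also have "(\<Sum>b<k. \<kappa> / e * R x b b) = \<kappa> / e * (\<Sum>c<k. R x c c)" by (simp only: sum_distrib_left)
  finally have "(\<Sum>a<k. (\<Sum>b<k. R x a b * u b)\<^sup>2) \<le> \<kappa> / e * (\<Sum>c<k. R x c c) * (\<Sum>b<k. (u b)\<^sup>2)"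
    by (simp add: mult_right_mono sum_nonneg)
  then have "e * (\<Sum>a<k. (\<Sum>b<k. R x a b * u b)\<^sup>2) \<le> e * (\<kappa> / e * (\<Sum>c<k. R x c c) * (\<Sum>b<k. (u b)\<^sup>2))"
    using e by (intro mult_left_mono) auto
  then show ?thesis using e by simp
qed

lemma Y_unit:
  assumes "c < k" shows "Y (\<lambda>a. if a = c then 1 else 0) x = R x c c"
  using assms by (simp add: Y_def if_distrib[of "\<lambda>z. z * _"] if_distrib[of "\<lambda>z. _ * z"] cong: if_cong)

lemma J_form_unit:
  assumes "c < k" shows "J_form (\<lambda>a. if a = c then 1 else 0) = J c c"
  using assms by (simp add: J_form_def if_distrib[of "\<lambda>z. z * _"] if_distrib[of "\<lambda>z. _ * z"] cong: if_cong)

lemma R_diag_nonneg: "c < k \<Longrightarrow> 0 \<le> R x c c"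
  using Y_nonneg[of "\<lambda>a. if a = c then 1 else 0" x] by (simp add: Y_unit)

text \<open>The bound does not involve e; this is what allows the ridge to be removed.\<close>

lemma R_trace_mean:
  assumes N: "N = k + p" and p: "2 \<le> p"
  shows "(\<integral>x. (\<Sum>c<k. R x c c) \<partial>gauss_on I) \<le> (\<Sum>c<k. J c c) / (real p - 1)"
proof -
  have "(\<integral>x. (\<Sum>c<k. R x c c) \<partial>gauss_on I) = (\<Sum>c<k. \<integral>x. R x c c \<partial>gauss_on I)"
    by (intro Bochner_Integration.integral_sum tame_integrable tame_R) auto
  also have "\<dots> \<le> (\<Sum>c<k. J c c / (real p - 1))"
  proof (rule sum_mono)
    fix c assume "c \<in> {..<k}"
    then show "(\<integral>x. R x c c \<partial>gauss_on I) \<le> J c c / (real p - 1)"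
      using Y_moment[OF N, of 1 "\<lambda>a. if a = c then 1 else 0"] p by (simp add: Y_unit J_form_unit)
  qed
  finally show ?thesis by (simp add: sum_divide_distrib)
qed

text \<open>Omega_1 Omega_1^T R v = (W - e H) R v = v - e H R v: the defect of the regularized right
  inverse.\<close>

lemma w_\<alpha>:
  assumes "a < k"
  shows "(\<Sum>j<N. w x a j * \<alpha> v x j) = v a - e * (\<Sum>b<k. H a b * (\<Sum>c<k. R x b c * v c))"
proof -
  let ?r = "\<lambda>b. \<Sum>c<k. R x b c * v c"
  have "(\<Sum>j<N. w x a j * \<alpha> v x j) = (\<Sum>j<N. \<Sum>b<k. w x a j * w x b j * ?r b)"
    by (simp add: \<alpha>_eq sum_distrib_left mult_ac)
  also have "\<dots> = (\<Sum>b<k. \<Sum>j<N. w x a j * w x b j * ?r b)" by (rule sum.swap)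
  also have "\<dots> = (\<Sum>b<k. (W x a b - e * H a b) * ?r b)" by (simp add: W_def sum_distrib_right)
  also have "\<dots> = (\<Sum>b<k. W x a b * ?r b) - e * (\<Sum>b<k. H a b * ?r b)"
    by (simp only: left_diff_distrib sum_subtractf mult.assoc sum_distrib_left[symmetric])
  finally show ?thesis by (simp only: W_R_vec[OF assms])
qed

text \<open>For a matrix \<open>X\<close> and independent Gaussian \<open>h\<close>, \<open>g\<close>, the average of \<open>(h\<^sup>T X g)\<^sup>2\<^sup>q\<close>
  dominates \<open>\<mu>\<^sup>2 \<parallel>X\<parallel>\<^sup>2\<^sup>q\<close> with \<open>\<mu> = 1 * 3 * ... * (2q - 1)\<close>; the power is then removed by Young's inequality.\<close>
lemma operator_bound:
  fixes S :: "nat \<Rightarrow> nat \<Rightarrow> real" and r q p :: nat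
  assumes N: "N = k + p" and q: "0 < q" "2 * q \<le> p"
    and S: "\<And>a b. a < k \<Longrightarrow> b < r \<Longrightarrow> (\<Sum>l<n. C a l * S b l) = 0"
    and c2: "(\<Sum>b<r. \<Sum>l<n. (S b l)\<^sup>2) \<le> c2" and b2: "0 \<le> b2"
    and SS: "\<And>h. (\<Sum>b<r. (\<Sum>b'<r. (\<Sum>l<n. S b l * S b' l) * h b')\<^sup>2) \<le> b2 * (\<Sum>l<n. (\<Sum>b<r. h b * S b l)\<^sup>2)"
    and J_sym: "\<And>a b. a < k \<Longrightarrow> b < k \<Longrightarrow> J a b = J b a"
    and J_trace: "(\<Sum>a<k. J a a) \<le> real k * \<kappa>"
    and J_norm: "\<And>v. (\<Sum>a<k. (\<Sum>b<k. J a b * v b)\<^sup>2) \<le> \<kappa> * J_form v"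
    and t: "0 < t" "(\<Prod>i<q. c2 + 2 * real i * b2) * (\<Prod>i<q. real k + 2 * real i) * \<kappa> ^ q
        \<le> (\<Prod>i<q. 2 * real i + 1) * (\<Prod>i<q. real p - 1 - 2 * real i) * t ^ q"
  obtains \<Lambda> where "\<Lambda> \<in> borel_measurable (gauss_on I)" "\<And>x. 0 \<le> \<Lambda> x"
    "(\<integral>\<^sup>+x. ennreal (\<Lambda> x) \<partial>gauss_on I) \<le> ennreal t"
    "\<And>x u. (\<Sum>b<r. (bilinear (S b) u x)\<^sup>2) \<le> \<Lambda> x * (\<Sum>a<k. (u a)\<^sup>2)"
proof -
  let ?Gr = "gauss_on {..<r} :: (nat \<Rightarrow> real) measure" and ?Gk = "gauss_on {..<k} :: (nat \<Rightarrow> real) measure" and ?G = "gauss_on I"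
  interpret Gr: prob_space ?Gr by (rule prob_space_gauss_on)
  interpret Gk: prob_space ?Gk by (rule prob_space_gauss_on)
  interpret G: prob_space ?G by (rule prob_space_gauss_on)
  interpret Pr: pair_sigma_finite ?G ?Gr ..
  interpret Pk: pair_sigma_finite ?G ?Gk ..
  \<comment> \<open>\<mu> is the moment of order 2q of a standard normal variable. A and B bound the
    q-th moments of h^T S S^T h and g^T J g, and D is the denominator of
    \<open>Y_moment\<close>.\<close>
  define \<mu> where "\<mu> = (\<Prod>i<q. 2 * real i + 1)"
  define A where "A = (\<Prod>i<q. c2 + 2 * real i * b2)"
  define B where "B = (\<Prod>i<q. real k * \<kappa> + 2 * real i * \<kappa>)"
  define D where "D = (\<Prod>i<q. real p - 1 - 2 * real i)"
  have mu: "0 < \<mu>" by (simp add: \<mu>_def prod_pos)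
  have D: "0 < D" unfolding D_def using q by (intro prod_pos) auto
  have c2_nonneg: "0 \<le> c2" by (rule order_trans[OF _ c2]) (simp add: sum_nonneg)
  have A0: "0 \<le> A" "0 \<le> B" using c2_nonneg b2 kappa by (auto simp: A_def B_def intro!: prod_nonneg)
  have B_eq: "B = (\<Prod>i<q. real k + 2 * real i) * \<kappa> ^ q"
    by (simp add: B_def distrib_right[symmetric] prod.distrib)
  let ?y = "\<lambda>h l. \<Sum>b<r. h b * S b l"
  have y: "(\<Sum>l<n. C a l * ?y h l) = 0" if "a < k" for a h
  proof -
    have "(\<Sum>l<n. C a l * ?y h l) = (\<Sum>l<n. \<Sum>b<r. h b * (C a l * S b l))"
      by (simp add: sum_distrib_left mult_ac)
    also have "\<dots> = (\<Sum>b<r. \<Sum>l<n. h b * (C a l * S b l))" by (rule sum.swap)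
    finally show ?thesis using S that by (simp add: sum_distrib_left[symmetric])
  qed
  \<comment> \<open>The average of (h^T X g)^(2q) over g in closed form. \<open>Z\<close> averages
    it over h.\<close>
  define \<phi> where "\<phi> = (\<lambda>x h. \<mu> * (\<Sum>a<k. (\<beta> (?y h) a x)\<^sup>2) ^ q)"
  define Z where "Z = (\<lambda>x. \<integral>h. \<phi> x h \<partial>?Gr)"
  have phi_nonneg: "0 \<le> \<phi> x h" for x h using mu by (simp add: \<phi>_def sum_nonneg)
  have inner: "(\<integral>\<^sup>+g. ennreal (bilinear (?y h) g x ^ (2 * q)) \<partial>?Gk) = ennreal (\<phi> x h)" for x h
  proof -
    have "(\<integral>\<^sup>+g. ennreal (bilinear (?y h) g x ^ (2 * q)) \<partial>?Gk) = ennreal (\<integral>g. bilinear (?y h) g x ^ (2 * q) \<partial>?Gk)"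
      unfolding bilinear_eq_\<beta>
      by (intro nn_integral_eq_integral tame_integrable tame_power tame_sum tame_mult tame_const tame_coord) auto
    also have "(\<integral>g. bilinear (?y h) g x ^ (2 * q) \<partial>?Gk) = \<phi> x h"
      using gauss_linear_moment[of "{..<k}" "\<lambda>a. \<beta> (?y h) a x" q]
      by (simp add: bilinear_eq_\<beta> \<phi>_def \<mu>_def mult.commute[of "\<beta> _ _ _"])
    finally show ?thesis .
  qed
  have tame_phi: "tame {..<r} (\<phi> x)" for x
    unfolding \<phi>_def \<beta>_sum by (intro tame_intros tame_coord) auto
  have phi_meas: "(\<lambda>(x, h). ennreal (\<phi> x h)) \<in> borel_measurable (?G \<Otimes>\<^sub>M ?Gr)"
  proof -
    have m1: "(\<lambda>z. snd z b) \<in> borel_measurable (?G \<Otimes>\<^sub>M ?Gr)" if "b < r" for b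
      by (rule measurable_compose[OF measurable_snd measurable_gauss_on_coord]) (use that in simp)
    have m2: "(\<lambda>z. \<beta> (S b) a (fst z)) \<in> borel_measurable (?G \<Otimes>\<^sub>M ?Gr)" if "a < k" for a b
      by (rule measurable_compose[OF measurable_fst tame_measurable[OF tame_\<beta>[OF that]]])
    have "(\<lambda>z. ennreal (\<mu> * (\<Sum>a<k. (\<Sum>b<r. snd z b * \<beta> (S b) a (fst z))\<^sup>2) ^ q)) \<in> borel_measurable (?G \<Otimes>\<^sub>M ?Gr)"
      using m1 m2 by (intro measurable_compose[OF _ measurable_ennreal] borel_measurable_times borel_measurable_const
          borel_measurable_power borel_measurable_sum) auto
    then show ?thesis by (simp add: \<phi>_def \<beta>_sum case_prod_unfold)
  qed
  have Z_eq: "(\<integral>\<^sup>+h. ennreal (\<phi> x h) \<partial>?Gr) = ennreal (Z x)" for x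
    unfolding Z_def using phi_nonneg by (intro nn_integral_eq_integral tame_integrable tame_phi) auto
  have Z_nonneg: "0 \<le> Z x" for x unfolding Z_def using phi_nonneg by (intro integral_nonneg_AE) auto
  have Z_meas: "Z \<in> borel_measurable ?G"
  proof -
    have "(\<lambda>x. \<integral>\<^sup>+h. ennreal (\<phi> x h) \<partial>?Gr) \<in> borel_measurable ?G"
      using phi_meas by (intro Gr.borel_measurable_nn_integral) simp
    then have "(\<lambda>x. enn2real (ennreal (Z x))) \<in> borel_measurable ?G" unfolding Z_eq by measurable
    then show ?thesis using Z_nonneg by simp
  qed
  have Z_mean: "(\<integral>\<^sup>+x. ennreal (Z x) \<partial>?G) \<le> ennreal (\<mu> * (A * B / D))"
  proof -
    have "(\<integral>\<^sup>+x. ennreal (Z x) \<partial>?G) = (\<integral>\<^sup>+x. \<integral>\<^sup>+h. ennreal (\<phi> x h) \<partial>?Gr \<partial>?G)" by (simp add: Z_eq)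
    \<comment> \<open>The averages over h and, below, over g are pulled outside, because
      \<open>bilinear_moment\<close> evaluates the mean over x for fixed vectors.\<close>
    also have "\<dots> = (\<integral>\<^sup>+h. \<integral>\<^sup>+x. ennreal (\<phi> x h) \<partial>?G \<partial>?Gr)" by (rule Pr.Fubini'[symmetric, OF phi_meas])
    also have "\<dots> \<le> (\<integral>\<^sup>+h. ennreal (\<mu> * B / D * (\<Sum>l<n. (?y h l)\<^sup>2) ^ q) \<partial>?Gr)"
    proof (intro nn_integral_mono)
      fix h
      have m: "(\<lambda>(x, g). ennreal (bilinear (?y h) g x ^ (2 * q))) \<in> borel_measurable (?G \<Otimes>\<^sub>M ?Gk)"
      proof -
        have m1: "(\<lambda>z. snd z a) \<in> borel_measurable (?G \<Otimes>\<^sub>M ?Gk)" if "a < k" for a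
          by (rule measurable_compose[OF measurable_snd measurable_gauss_on_coord]) (use that in simp)
        have m2: "(\<lambda>z. \<beta> (?y h) a (fst z)) \<in> borel_measurable (?G \<Otimes>\<^sub>M ?Gk)" if "a < k" for a
          by (rule measurable_compose[OF measurable_fst tame_measurable[OF tame_\<beta>[OF that]]])
        have "(\<lambda>z. ennreal ((\<Sum>a<k. snd z a * \<beta> (?y h) a (fst z)) ^ (2 * q))) \<in> borel_measurable (?G \<Otimes>\<^sub>M ?Gk)"
          using m1 m2 by (intro measurable_compose[OF _ measurable_ennreal] borel_measurable_times
              borel_measurable_power borel_measurable_sum) auto
        then show ?thesis by (simp add: bilinear_eq_\<beta> case_prod_unfold)
      qed
      have "(\<integral>\<^sup>+x. ennreal (\<phi> x h) \<partial>?G) = (\<integral>\<^sup>+x. \<integral>\<^sup>+g. ennreal (bilinear (?y h) g x ^ (2 * q)) \<partial>?Gk \<partial>?G)"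
        by (simp add: inner)
      also have "\<dots> = (\<integral>\<^sup>+g. \<integral>\<^sup>+x. ennreal (bilinear (?y h) g x ^ (2 * q)) \<partial>?G \<partial>?Gk)"
        by (rule Pk.Fubini'[symmetric, OF m])
      also have "\<dots> \<le> (\<integral>\<^sup>+g. ennreal (\<mu> * (\<Sum>l<n. (?y h l)\<^sup>2) ^ q / D * J_form g ^ q) \<partial>?Gk)"
      proof (intro nn_integral_mono)
        fix g
        have "(\<integral>\<^sup>+x. ennreal (bilinear (?y h) g x ^ (2 * q)) \<partial>?G) = ennreal (\<integral>x. bilinear (?y h) g x ^ (2 * q) \<partial>?G)"
          by (intro nn_integral_eq_integral tame_integrable tame_power tame_bilinear) auto
        also have "\<dots> \<le> ennreal (\<mu> * (\<Sum>l<n. (?y h l)\<^sup>2) ^ q * (\<integral>x. Y g x ^ q \<partial>?G))"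
          unfolding \<mu>_def by (intro ennreal_leI bilinear_moment y)
        also have "\<dots> \<le> ennreal (\<mu> * (\<Sum>l<n. (?y h l)\<^sup>2) ^ q * (J_form g ^ q / D))"
          unfolding D_def using mu by (intro ennreal_leI mult_left_mono Y_moment N q) (auto simp: sum_nonneg)
        finally show "(\<integral>\<^sup>+x. ennreal (bilinear (?y h) g x ^ (2 * q)) \<partial>?G) \<le> ennreal (\<mu> * (\<Sum>l<n. (?y h l)\<^sup>2) ^ q / D * J_form g ^ q)"
          by simp
      qed
      also have "\<dots> = ennreal (\<mu> * (\<Sum>l<n. (?y h l)\<^sup>2) ^ q / D * (\<integral>g. J_form g ^ q \<partial>?Gk))"
      proof -
        have tJ: "tame {..<k} J_form"
          unfolding J_form_def by (intro tame_sum tame_mult tame_const tame_coord) auto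
        have "(\<integral>\<^sup>+g. ennreal (\<mu> * (\<Sum>l<n. (?y h l)\<^sup>2) ^ q / D * J_form g ^ q) \<partial>?Gk)
            = ennreal (\<integral>g. \<mu> * (\<Sum>l<n. (?y h l)\<^sup>2) ^ q / D * J_form g ^ q \<partial>?Gk)"
          using mu D by (intro nn_integral_eq_integral tame_integrable tame_mult tame_const tame_power tJ)
            (auto simp: sum_nonneg J_form_nonneg)
        then show ?thesis by simp
      qed
      also have "\<dots> \<le> ennreal (\<mu> * (\<Sum>l<n. (?y h l)\<^sup>2) ^ q / D * B)"
      proof (intro ennreal_leI mult_left_mono)
        have JQ: "J_form g = (\<Sum>a<k. \<Sum>b<k. J a b * g a * g b)" for g
          by (simp add: J_form_def sum_distrib_left mult_ac)
        show "(\<integral>g. J_form g ^ q \<partial>?Gk) \<le> B"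
          unfolding B_def JQ
          by (rule gauss_quadratic_moment) (use J_sym J_trace J_norm kappa J_form_nonneg in \<open>auto simp: JQ\<close>)
        show "0 \<le> \<mu> * (\<Sum>l<n. (?y h l)\<^sup>2) ^ q / D" using mu D by (simp add: sum_nonneg)
      qed
      finally show "(\<integral>\<^sup>+x. ennreal (\<phi> x h) \<partial>?G) \<le> ennreal (\<mu> * B / D * (\<Sum>l<n. (?y h l)\<^sup>2) ^ q)"
        by (simp add: mult_ac)
    qed
    also have "\<dots> \<le> ennreal (\<mu> * B / D * A)"
    proof -
      have yQ: "(\<Sum>l<n. (?y h l)\<^sup>2) = (\<Sum>b<r. \<Sum>b'<r. (\<Sum>l<n. S b l * S b' l) * h b * h b')" for h
      proof -
        have "(\<Sum>l<n. (?y h l)\<^sup>2) = (\<Sum>l<n. \<Sum>b<r. \<Sum>b'<r. (h b * S b l) * (h b' * S b' l))"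
          by (simp add: power2_eq_square sum_product)
        also have "\<dots> = (\<Sum>b<r. \<Sum>l<n. \<Sum>b'<r. (h b * S b l) * (h b' * S b' l))" by (rule sum.swap)
        also have "\<dots> = (\<Sum>b<r. \<Sum>b'<r. \<Sum>l<n. (h b * S b l) * (h b' * S b' l))" by (intro sum.cong refl sum.swap)
        finally show ?thesis by (simp add: sum_distrib_right sum_distrib_left mult_ac)
      qed
      have tQ: "tame {..<r} (\<lambda>h. (\<Sum>l<n. (?y h l)\<^sup>2) ^ q)" by (intro tame_intros tame_coord) auto
      have "(\<integral>h. (\<Sum>l<n. (?y h l)\<^sup>2) ^ q \<partial>?Gr) \<le> A"
        unfolding A_def yQ
      proof (rule gauss_quadratic_moment)
        show "(\<Sum>b<r. \<Sum>l<n. S b l * S b l) \<le> c2" using c2 by (simp add: power2_eq_square)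
        show "0 \<le> (\<Sum>b<r. \<Sum>b'<r. (\<Sum>l<n. S b l * S b' l) * h b * h b')" for h
          unfolding yQ[symmetric] by (simp add: sum_nonneg)
        show "(\<Sum>b<r. (\<Sum>b'<r. (\<Sum>l<n. S b l * S b' l) * h b')\<^sup>2) \<le> b2 * (\<Sum>b<r. \<Sum>b'<r. (\<Sum>l<n. S b l * S b' l) * h b * h b')" for h
          unfolding yQ[symmetric] by (rule SS)
      qed (use b2 c2_nonneg in \<open>auto simp: mult.commute\<close>)
      then have "\<mu> * B / D * (\<integral>h. (\<Sum>l<n. (?y h l)\<^sup>2) ^ q \<partial>?Gr) \<le> \<mu> * B / D * A"
        using mu D A0 by (intro mult_left_mono) auto
      moreover have "(\<integral>\<^sup>+h. ennreal (\<mu> * B / D * (\<Sum>l<n. (?y h l)\<^sup>2) ^ q) \<partial>?Gr)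
          = ennreal (\<integral>h. \<mu> * B / D * (\<Sum>l<n. (?y h l)\<^sup>2) ^ q \<partial>?Gr)"
        using mu D A0 by (intro nn_integral_eq_integral tame_integrable tame_mult[OF tame_const tQ]) (auto simp: sum_nonneg)
      ultimately show ?thesis by (simp add: ennreal_leI)
    qed
    finally show ?thesis by (simp add: mult_ac)
  qed
  \<comment> \<open>For fixed h, Cauchy-Schwarz bounds (h^T X u)^2 by |u|^2 |X^T h|^2. Averaging the
    left-hand side over h produces one factor \<mu>; the other stems from the average over g inside
    \<open>\<phi>\<close>.\<close>
  have Z_lower: "\<mu>\<^sup>2 * (\<Sum>b<r. (bilinear (S b) u x)\<^sup>2) ^ q \<le> (\<Sum>a<k. (u a)\<^sup>2) ^ q * Z x" for x u
  proof -
    have tl: "tame {..<r} (\<lambda>h. (\<Sum>b<r. bilinear (S b) u x * h b) ^ (2 * q))" by (intro tame_intros tame_coord) auto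
    have "\<mu> * (\<Sum>b<r. (bilinear (S b) u x)\<^sup>2) ^ q = (\<integral>h. (\<Sum>b<r. bilinear (S b) u x * h b) ^ (2 * q) \<partial>?Gr)"
      using gauss_linear_moment[of "{..<r}" "\<lambda>b. bilinear (S b) u x" q] by (simp add: \<mu>_def)
    then have "\<mu>\<^sup>2 * (\<Sum>b<r. (bilinear (S b) u x)\<^sup>2) ^ q = (\<integral>h. \<mu> * (\<Sum>b<r. bilinear (S b) u x * h b) ^ (2 * q) \<partial>?Gr)"
      by (simp add: power2_eq_square mult.assoc)
    also have "\<dots> \<le> (\<integral>h. (\<Sum>a<k. (u a)\<^sup>2) ^ q * \<phi> x h \<partial>?Gr)"
    proof (rule integral_mono)
      fix h
      have "(\<Sum>b<r. bilinear (S b) u x * h b)\<^sup>2 = (\<Sum>a<k. u a * \<beta> (?y h) a x)\<^sup>2"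
        by (simp add: bilinear_sum bilinear_eq_\<beta>[symmetric] mult.commute)
      also have "\<dots> \<le> (\<Sum>a<k. (u a)\<^sup>2) * (\<Sum>a<k. (\<beta> (?y h) a x)\<^sup>2)" by (rule Cauchy_Schwarz_ineq_sum)
      finally have "((\<Sum>b<r. bilinear (S b) u x * h b)\<^sup>2) ^ q \<le> ((\<Sum>a<k. (u a)\<^sup>2) * (\<Sum>a<k. (\<beta> (?y h) a x)\<^sup>2)) ^ q"
        by (intro power_mono) auto
      then have "\<mu> * ((\<Sum>b<r. bilinear (S b) u x * h b)\<^sup>2) ^ q \<le> \<mu> * ((\<Sum>a<k. (u a)\<^sup>2) * (\<Sum>a<k. (\<beta> (?y h) a x)\<^sup>2)) ^ q"
        using mu by (intro mult_left_mono) auto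
      then show "\<mu> * (\<Sum>b<r. bilinear (S b) u x * h b) ^ (2 * q) \<le> (\<Sum>a<k. (u a)\<^sup>2) ^ q * \<phi> x h"
        by (simp only: \<phi>_def power_mult power_mult_distrib mult.left_commute)
    qed (intro tame_integrable tame_mult[OF tame_const tl] tame_mult[OF tame_const tame_phi]; simp)+
    finally show ?thesis by (simp add: Z_def)
  qed
  \<comment> \<open>Young's inequality with s^q \<le> Z / \<mu>^2 makes \<open>\<Lambda>\<close>
    affine in \<open>Z\<close>, so its mean is at most t (q - 1) / q + t / q = t.\<close>
  define c where "c = 1 / (\<mu>\<^sup>2 * (real q * t ^ (q - 1)))"
  define \<Lambda> where "\<Lambda> = (\<lambda>x. t * (real q - 1) / real q + c * Z x)"
  have c: "0 \<le> c" using mu t by (simp add: c_def)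
  show ?thesis
  proof
    show "\<Lambda> \<in> borel_measurable ?G" unfolding \<Lambda>_def using Z_meas by measurable
    have L0: "0 \<le> t * (real q - 1) / real q" using t q by simp
    then show nonneg: "0 \<le> \<Lambda> x" for x using c Z_nonneg by (simp add: \<Lambda>_def)
    have "(\<integral>\<^sup>+x. ennreal (\<Lambda> x) \<partial>?G) = (\<integral>\<^sup>+x. ennreal (t * (real q - 1) / real q) + ennreal c * ennreal (Z x) \<partial>?G)"
      using L0 c Z_nonneg by (simp add: \<Lambda>_def ennreal_plus ennreal_mult)
    also have "\<dots> = ennreal (t * (real q - 1) / real q) + ennreal c * (\<integral>\<^sup>+x. ennreal (Z x) \<partial>?G)"
      using Z_meas by (subst nn_integral_add) (auto simp: nn_integral_cmult G.emeasure_space_1)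
    also have "\<dots> \<le> ennreal (t * (real q - 1) / real q) + ennreal c * ennreal (\<mu> * (A * B / D))"
      by (intro add_left_mono mult_left_mono Z_mean) auto
    also have "\<dots> = ennreal (t * (real q - 1) / real q + c * (\<mu> * (A * B / D)))"
    proof -
      have m0: "0 \<le> \<mu> * (A * B / D)" using mu D A0 by simp
      show ?thesis by (simp only: ennreal_plus[OF L0 mult_nonneg_nonneg[OF c m0]] ennreal_mult[OF c m0])
    qed
    also have "\<dots> \<le> ennreal t"
    proof (rule ennreal_leI)
      have "A * B \<le> \<mu> * D * t ^ q" using t(2) by (simp add: A_def B_eq \<mu>_def D_def mult_ac)
      then have "c * (\<mu> * (A * B / D)) \<le> c * (\<mu> * (\<mu> * t ^ q))"
        using c mu D by (intro mult_left_mono) (auto simp: pos_divide_le_eq mult_ac)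
      also have "\<dots> = t / real q"
      proof -
        define T where "T = t ^ (q - 1)"
        have "0 < T" "t ^ q = t * T" using t q by (auto simp: T_def simp flip: power_Suc)
        then show ?thesis using mu q unfolding c_def T_def[symmetric] by (simp add: power2_eq_square)
      qed
      finally have "t * (real q - 1) / real q + c * (\<mu> * (A * B / D)) \<le> t * (real q - 1) / real q + t / real q" by simp
      also have "\<dots> = t" using q by (simp add: field_simps)
      finally show "t * (real q - 1) / real q + c * (\<mu> * (A * B / D)) \<le> t" .
    qed
    finally show "(\<integral>\<^sup>+x. ennreal (\<Lambda> x) \<partial>?G) \<le> ennreal t" .
    show "(\<Sum>b<r. (bilinear (S b) u x)\<^sup>2) \<le> \<Lambda> x * (\<Sum>a<k. (u a)\<^sup>2)" for x u
    proof (cases "(\<Sum>a<k. (u a)\<^sup>2) = 0")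
      case True
      then have "\<forall>a<k. u a = 0" by (simp add: sum_nonneg_eq_0_iff)
      then have "bilinear (S b) u x = 0" for b by (simp add: bilinear_eq_\<beta>)
      then show ?thesis by (simp add: True)
    next
      case False
      define U where "U = (\<Sum>a<k. (u a)\<^sup>2)"
      have U: "0 < U" using False unfolding U_def by (simp add: sum_nonneg less_le)
      define s where "s = (\<Sum>b<r. (bilinear (S b) u x)\<^sup>2) / U"
      have s0: "0 \<le> s" using U by (simp add: s_def sum_nonneg)
      have "\<mu>\<^sup>2 * (s * U) ^ q \<le> U ^ q * Z x" using Z_lower[of u x] U by (simp add: s_def U_def)
      then have "s ^ q \<le> Z x / \<mu>\<^sup>2" using U mu by (simp add: power_mult_distrib field_simps)
      then have "s ^ q / (real q * t ^ (q - 1)) \<le> Z x / \<mu>\<^sup>2 / (real q * t ^ (q - 1))"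
        using t by (intro divide_right_mono) auto
      then have "s \<le> \<Lambda> x"
        using young_power[OF s0 t(1) q(1)] by (simp add: \<Lambda>_def c_def)
      then have "s * U \<le> \<Lambda> x * U" using U by (intro mult_right_mono) auto
      then show ?thesis using U by (simp add: s_def U_def)
    qed
  qed
qed

end

section \<open>The Nystrom residual\<close>

lemma gram_psd:
  fixes X :: "real mat"
  assumes X: "X \<in> carrier_mat m n" shows "psd_mat m (X * transpose_mat X)"
  unfolding psd_mat_def
proof (intro conjI ballI)
  show "X * transpose_mat X \<in> carrier_mat m m" using X by simp
  show "transpose_mat (X * transpose_mat X) = X * transpose_mat X"
    using X by (simp add: transpose_mult[of _ m n _ m])
  fix v :: "real vec" assume v: "v \<in> carrier_vec m"
  have "v \<bullet> ((X * transpose_mat X) *\<^sub>v v) = v \<bullet> (X *\<^sub>v (transpose_mat X *\<^sub>v v))"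
    using X v by (simp add: assoc_mult_mat_vec[of _ m n _ m])
  also have "\<dots> = (transpose_mat X *\<^sub>v v) \<bullet> (transpose_mat X *\<^sub>v v)"
    using X v by (intro transpose_vec_mult_scalar[symmetric]) auto
  finally show "0 \<le> v \<bullet> ((X * transpose_mat X) *\<^sub>v v)" by (simp add: scalar_prod_self_nonneg)
qed

lemma gram_form:
  fixes X :: "real mat"
  assumes X: "X \<in> carrier_mat m n" and v: "v \<in> carrier_vec m"
  shows "v \<bullet> ((X * transpose_mat X) *\<^sub>v v) = (\<Sum>l<n. (\<Sum>b<m. v $ b * X $$ (b, l))\<^sup>2)"
proof -
  have "v \<bullet> ((X * transpose_mat X) *\<^sub>v v) = v \<bullet> (X *\<^sub>v (transpose_mat X *\<^sub>v v))"
    using X v by (simp add: assoc_mult_mat_vec[of _ m n _ m])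
  also have "\<dots> = (transpose_mat X *\<^sub>v v) \<bullet> (transpose_mat X *\<^sub>v v)"
    using X v by (intro transpose_vec_mult_scalar[symmetric]) auto
  also have "\<dots> = (\<Sum>l<n. ((transpose_mat X *\<^sub>v v) $ l)\<^sup>2)"
    using X v mult_mat_vec_carrier[of "transpose_mat X" n m v]
    by (subst scalar_prod_sum[of _ n]) (auto simp: power2_eq_square)
  also have "\<dots> = (\<Sum>l<n. (\<Sum>b<m. v $ b * X $$ (b, l))\<^sup>2)"
  proof (intro sum.cong refl arg_cong[of _ _ "\<lambda>z. z\<^sup>2"])
    fix l assume "l \<in> {..<n}"
    then show "(transpose_mat X *\<^sub>v v) $ l = (\<Sum>b<m. v $ b * X $$ (b, l))"
      using X v by (subst index_mult_mat_vec_sum[of _ n m]) (auto simp: mult.commute)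
  qed
  finally show ?thesis .
qed

text \<open>With S the square root of P and y = S x, |Px|^2 is the form of P at y, and |y|^2 is the
  form of P at x.\<close>

lemma psd_apply_sq:
  assumes P: "psd_mat n P" and x: "x \<in> carrier_vec n"
  shows "(P *\<^sub>v x) \<bullet> (P *\<^sub>v x) \<le> spec_norm P * (x \<bullet> (P *\<^sub>v x))"
proof -
  define S where "S = psd_sqrt P"
  have S: "psd_mat n S" and SS: "S * S = P" using psd_sqrt[OF P] by (auto simp: S_def)
  note c = psd_matD(1,2)[OF S] psd_matD(1)[OF P]
  define y where "y = S *\<^sub>v x"
  have y: "y \<in> carrier_vec n" using c x by (simp add: y_def)
  have Px: "P *\<^sub>v x = S *\<^sub>v y" using c x unfolding SS[symmetric] y_def by (simp add: assoc_mult_mat_vec[of _ n n _ n])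
  have sym: "(S *\<^sub>v u) \<bullet> v = u \<bullet> (S *\<^sub>v v)" if "u \<in> carrier_vec n" "v \<in> carrier_vec n" for u v
    using transpose_vec_mult_scalar[OF c(1) that(2,1)] c(2) by simp
  have "(P *\<^sub>v x) \<bullet> (P *\<^sub>v x) = y \<bullet> (S *\<^sub>v (S *\<^sub>v y))"
    unfolding Px using c y by (intro sym) auto
  also have "\<dots> = y \<bullet> (P *\<^sub>v y)" using c y unfolding SS[symmetric] by (simp add: assoc_mult_mat_vec[of _ n n _ n])
  also have "\<dots> \<le> spec_norm P * (y \<bullet> y)" by (rule spec_norm_form[OF P y])
  also have "y \<bullet> y = x \<bullet> (P *\<^sub>v x)" unfolding Px using sym[OF x y] by (simp add: y_def)
  finally show ?thesis .
qed

text \<open>Avoids comparing the spectra of L L^T and L^T L. With v = L u, Cauchy-Schwarz gives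
  |v|^4 = (L^T v . u)^2 \<le> |L^T v|^2 |u|^2, and |L^T v|^2 is the form of L L^T at v.\<close>

lemma transpose_gram_form_le:
  fixes L :: "real mat"
  assumes L: "L \<in> carrier_mat m n" and u: "u \<in> carrier_vec n"
  shows "(L *\<^sub>v u) \<bullet> (L *\<^sub>v u) \<le> spec_norm (L * transpose_mat L) * (u \<bullet> u)"
proof -
  define v where "v = L *\<^sub>v u"
  define w where "w = transpose_mat L *\<^sub>v v"
  define s where "s = spec_norm (L * transpose_mat L)"
  have c: "v \<in> carrier_vec m" "w \<in> carrier_vec n" using L u by (auto simp: v_def w_def)
  have s: "0 \<le> s" unfolding s_def using L by (intro spec_norm_nonneg[of _ m m]) auto
  have vv: "v \<bullet> v = w \<bullet> u"
    using transpose_vec_mult_scalar[OF L u c(1)] by (simp add: v_def w_def)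
  have "w \<bullet> w = v \<bullet> ((L * transpose_mat L) *\<^sub>v v)"
  proof -
    have "w \<bullet> w = v \<bullet> (L *\<^sub>v w)" using transpose_vec_mult_scalar[OF L c(2,1)] by (simp add: w_def)
    then show ?thesis using L c by (simp add: w_def assoc_mult_mat_vec[of _ m n _ m])
  qed
  also have "\<dots> \<le> s * (v \<bullet> v)" unfolding s_def by (rule spec_norm_form[OF gram_psd[OF L] c(1)])
  finally have ww: "w \<bullet> w \<le> s * (v \<bullet> v)" .
  have "(v \<bullet> v)\<^sup>2 \<le> (w \<bullet> w) * (u \<bullet> u)"
    unfolding vv scalar_prod_sum[OF u] scalar_prod_sum[OF c(2)]
    using Cauchy_Schwarz_ineq_sum[of "\<lambda>i. w $ i" "\<lambda>i. u $ i" "{..<n}"] by (simp add: power2_eq_square)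
  also have "\<dots> \<le> s * (v \<bullet> v) * (u \<bullet> u)" by (intro mult_right_mono ww scalar_prod_self_nonneg)
  finally have "(v \<bullet> v) * (v \<bullet> v) \<le> (v \<bullet> v) * (s * (u \<bullet> u))" by (simp add: power2_eq_square mult_ac)
  moreover have "0 \<le> v \<bullet> v" "0 \<le> s * (u \<bullet> u)" using s by (simp_all add: scalar_prod_self_nonneg)
  ultimately have "v \<bullet> v \<le> s * (u \<bullet> u)" by (cases "v \<bullet> v = 0") (auto simp: mult_le_cancel_left)
  then show ?thesis by (simp add: v_def s_def)
qed

text \<open>Completing the square in z: the form of A at x - Om z is the form of the residual at x
  plus that of C = Om^T A Om at z - s, where s = pinv C Om^T A x. Taking z = s gives positivity,
  dropping the square gives the bound.\<close>

lemma nystrom_residual: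
  fixes A Om :: "real mat"
  assumes A: "psd_mat n A" and Om: "Om \<in> carrier_mat n m"
  shows "psd_mat n (A - nystrom A Om)"
    and "\<And>x z. x \<in> carrier_vec n \<Longrightarrow> z \<in> carrier_vec m \<Longrightarrow>
      x \<bullet> ((A - nystrom A Om) *\<^sub>v x) \<le> (x - Om *\<^sub>v z) \<bullet> (A *\<^sub>v (x - Om *\<^sub>v z))"
proof -
  note Ac = psd_matD(1,2)[OF A]
  define T where "T = transpose_mat Om"
  have T: "T \<in> carrier_mat m n" using Om by (simp add: T_def)
  define C where "C = T * A * Om"
  have C: "C \<in> carrier_mat m m" using T Ac Om by (simp add: C_def)
  have C_sym: "transpose_mat C = C"
  proof -
    have "transpose_mat C = transpose_mat Om * transpose_mat (T * A)"
      unfolding C_def using T Ac Om by (intro transpose_mult[of _ m n _ m]) auto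
    also have "transpose_mat (T * A) = A * Om"
      using T Ac Om by (simp add: transpose_mult[of _ m n _ n] T_def)
    finally show ?thesis using T Ac Om by (simp add: C_def T_def assoc_mult_mat[of _ m n _ n _ m])
  qed
  define P where "P = pinv C"
  note pinv = pinv_symmetric[OF C C_sym, folded P_def]
  have symA: "(A *\<^sub>v u) \<bullet> v = u \<bullet> (A *\<^sub>v v)" if "u \<in> carrier_vec n" "v \<in> carrier_vec n" for u v
    using transpose_vec_mult_scalar[OF Ac(1) that(2,1)] Ac(2) by simp
  have symC: "(C *\<^sub>v u) \<bullet> v = u \<bullet> (C *\<^sub>v v)" if "u \<in> carrier_vec m" "v \<in> carrier_vec m" for u v
    using transpose_vec_mult_scalar[OF C that(2,1)] C_sym by simp
  have symP: "(P *\<^sub>v u) \<bullet> v = u \<bullet> (P *\<^sub>v v)" if "u \<in> carrier_vec m" "v \<in> carrier_vec m" for u v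
    using transpose_vec_mult_scalar[OF pinv(1) that(2,1)] pinv(2) by simp
  have adj: "(T *\<^sub>v u) \<bullet> v = u \<bullet> (Om *\<^sub>v v)" if "u \<in> carrier_vec n" "v \<in> carrier_vec m" for u v
    using transpose_vec_mult_scalar[OF Om that(2,1)] by (simp add: T_def)
  have adj': "(Om *\<^sub>v v) \<bullet> u = v \<bullet> (T *\<^sub>v u)" if "u \<in> carrier_vec n" "v \<in> carrier_vec m" for u v
    using adj[OF that] that Om T by (simp add: comm_scalar_prod[of _ n] comm_scalar_prod[of _ m])
  have Cv: "C *\<^sub>v v = T *\<^sub>v (A *\<^sub>v (Om *\<^sub>v v))" if "v \<in> carrier_vec m" for v
    using that T Ac Om by (simp add: C_def assoc_mult_mat_vec[of _ m n _ m] assoc_mult_mat_vec[of _ m n _ n])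
  have C_form: "v \<bullet> (C *\<^sub>v v) = (Om *\<^sub>v v) \<bullet> (A *\<^sub>v (Om *\<^sub>v v))" if "v \<in> carrier_vec m" for v
    using that adj'[of "A *\<^sub>v (Om *\<^sub>v v)" v] Ac Om by (simp add: Cv)
  define E where "E = A - nystrom A Om"
  have nys: "nystrom A Om = A * Om * P * T * A" by (simp add: nystrom_def P_def C_def T_def)
  have Nc: "nystrom A Om \<in> carrier_mat n n" unfolding nys using Ac(1) Om pinv(1) T by (meson mult_carrier_mat)
  have E: "E \<in> carrier_mat n n" unfolding E_def using Nc by (rule minus_carrier_mat)
  have N_vec: "nystrom A Om *\<^sub>v x = A *\<^sub>v (Om *\<^sub>v (P *\<^sub>v (T *\<^sub>v (A *\<^sub>v x))))" if x: "x \<in> carrier_vec n" for x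
  proof -
    have "nystrom A Om *\<^sub>v x = (A * Om * P * T) *\<^sub>v (A *\<^sub>v x)"
      unfolding nys using Ac Om pinv(1) T x by (intro assoc_mult_mat_vec) auto
    also have "\<dots> = (A * Om * P) *\<^sub>v (T *\<^sub>v (A *\<^sub>v x))"
      using Ac Om pinv(1) T x by (intro assoc_mult_mat_vec) auto
    also have "\<dots> = (A * Om) *\<^sub>v (P *\<^sub>v (T *\<^sub>v (A *\<^sub>v x)))"
      using Ac Om pinv(1) T x by (intro assoc_mult_mat_vec) auto
    also have "\<dots> = A *\<^sub>v (Om *\<^sub>v (P *\<^sub>v (T *\<^sub>v (A *\<^sub>v x))))"
      using Ac Om pinv(1) T x by (intro assoc_mult_mat_vec) auto
    finally show ?thesis .
  qed
  have E_vec: "E *\<^sub>v x = A *\<^sub>v x - nystrom A Om *\<^sub>v x" if "x \<in> carrier_vec n" for x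
    unfolding E_def using Ac Nc that by (intro minus_mult_distrib_mat_vec) auto
  \<comment> \<open>C s = d holds for s = P d only if d lies in the range of C. The defect w
    satisfies C w = 0, so the form of A vanishes at Om w and A (Om w) = 0. Then w is orthogonal to d
    and to C (P d), hence to itself.\<close>
  have range: "C *\<^sub>v (P *\<^sub>v (T *\<^sub>v (A *\<^sub>v x))) = T *\<^sub>v (A *\<^sub>v x)" if x: "x \<in> carrier_vec n" for x
  proof -
    define d where "d = T *\<^sub>v (A *\<^sub>v x)"
    have d: "d \<in> carrier_vec m" using T Ac x by (simp add: d_def)
    define w where "w = d - C *\<^sub>v (P *\<^sub>v d)"
    have w: "w \<in> carrier_vec m" unfolding w_def using d C pinv(1) by (meson minus_carrier_vec mult_mat_vec_carrier)
    have CP: "C *\<^sub>v (P *\<^sub>v v) = P *\<^sub>v (C *\<^sub>v v)" if "v \<in> carrier_vec m" for v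
    proof -
      have "C * P = P * C" using pinv(5) C C_sym pinv(1,2) by (simp add: transpose_mult[of _ m m _ m])
      then show ?thesis
        using assoc_mult_mat_vec[OF C pinv(1) that] assoc_mult_mat_vec[OF pinv(1) C that] by metis
    qed
    have "C *\<^sub>v w = C *\<^sub>v d - C *\<^sub>v (C *\<^sub>v (P *\<^sub>v d))"
      unfolding w_def using C d pinv(1) by (intro mult_minus_distrib_mat_vec) auto
    also have "C *\<^sub>v (C *\<^sub>v (P *\<^sub>v d)) = (C * P * C) *\<^sub>v d"
      unfolding CP[OF d] using C d pinv(1) by (simp add: assoc_mult_mat_vec[of _ m m _ m])
    also have "(C * P * C) *\<^sub>v d = C *\<^sub>v d" by (simp add: pinv)
    finally have Cw: "C *\<^sub>v w = 0\<^sub>v m" using C d by simp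
    define y where "y = Om *\<^sub>v w"
    have y: "y \<in> carrier_vec n" using Om w by (simp add: y_def)
    have "y \<bullet> (A *\<^sub>v y) = 0" using C_form[OF w] w by (simp add: Cw y_def)
    then have "(A *\<^sub>v y) \<bullet> (A *\<^sub>v y) \<le> 0" using psd_apply_sq[OF A y] by simp
    then have "(A *\<^sub>v y) \<bullet> (A *\<^sub>v y) = 0" using scalar_prod_self_nonneg[of "A *\<^sub>v y"] by simp
    then have Ay: "A *\<^sub>v y = 0\<^sub>v n" using scalar_prod_self_eq_0[of "A *\<^sub>v y" n] Ac y by simp
    have "d \<bullet> w = (A *\<^sub>v x) \<bullet> y" unfolding d_def y_def using Ac x w by (intro adj) auto
    also have "\<dots> = x \<bullet> (A *\<^sub>v y)" by (rule symA[OF x y])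
    finally have dw: "d \<bullet> w = 0" using x by (simp add: Ay)
    have "(C *\<^sub>v (P *\<^sub>v d)) \<bullet> w = (P *\<^sub>v d) \<bullet> (C *\<^sub>v w)"
      using d w C pinv(1) by (intro symC) auto
    then have "(C *\<^sub>v (P *\<^sub>v d)) \<bullet> w = 0" using d pinv(1) by (simp add: Cw)
    moreover have "w \<bullet> w = d \<bullet> w - (C *\<^sub>v (P *\<^sub>v d)) \<bullet> w"
    proof -
      have "w \<bullet> w = (d - C *\<^sub>v (P *\<^sub>v d)) \<bullet> w" by (simp only: w_def)
      also have "\<dots> = d \<bullet> w - (C *\<^sub>v (P *\<^sub>v d)) \<bullet> w"
        using d w mult_mat_vec_carrier[OF C mult_mat_vec_carrier[OF pinv(1) d]]
        by (intro minus_scalar_prod_distrib[of _ m]) auto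
      finally show ?thesis .
    qed
    ultimately have "w = 0\<^sub>v m" using dw scalar_prod_self_eq_0[OF w] by simp
    have "C *\<^sub>v (P *\<^sub>v d) = d"
    proof (rule eq_vecI)
      fix i assume "i < dim_vec d"
      then have i: "i < m" using d by simp
      have "w $ i = d $ i - (C *\<^sub>v (P *\<^sub>v d)) $ i" using i d C by (simp add: w_def)
      then show "(C *\<^sub>v (P *\<^sub>v d)) $ i = d $ i" using \<open>w = 0\<^sub>v m\<close> i by simp
    qed (use C d in auto)
    then show ?thesis by (simp add: d_def)
  qed
  have key: "(x - Om *\<^sub>v z) \<bullet> (A *\<^sub>v (x - Om *\<^sub>v z))
      = x \<bullet> (E *\<^sub>v x) + (z - P *\<^sub>v (T *\<^sub>v (A *\<^sub>v x))) \<bullet> (C *\<^sub>v (z - P *\<^sub>v (T *\<^sub>v (A *\<^sub>v x))))"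
    if x: "x \<in> carrier_vec n" and z: "z \<in> carrier_vec m" for x z
  proof -
    define d where "d = T *\<^sub>v (A *\<^sub>v x)"
    define s where "s = P *\<^sub>v d"
    have d: "d \<in> carrier_vec m" "s \<in> carrier_vec m" using T Ac x pinv(1) by (auto simp: d_def s_def)
    have Cs: "C *\<^sub>v s = d" using range[OF x] by (simp add: d_def s_def)
    have xAz: "x \<bullet> (A *\<^sub>v (Om *\<^sub>v v)) = d \<bullet> v" if "v \<in> carrier_vec m" for v
      using adj[of "A *\<^sub>v x" v] symA[OF x, of "Om *\<^sub>v v"] that Ac Om x by (simp add: d_def)
    have 1: "(x - Om *\<^sub>v z) \<bullet> (A *\<^sub>v (x - Om *\<^sub>v z)) = x \<bullet> (A *\<^sub>v x) - 2 * (d \<bullet> z) + z \<bullet> (C *\<^sub>v z)"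
    proof -
      have o: "Om *\<^sub>v z \<in> carrier_vec n" using Om z by simp
      have "(Om *\<^sub>v z) \<bullet> (A *\<^sub>v x) = d \<bullet> z"
        using adj'[of "A *\<^sub>v x" z] x z Ac d by (simp add: d_def comm_scalar_prod[of _ m])
      then show ?thesis
        using x o Ac xAz[OF z] C_form[OF z]
        by (simp add: mult_minus_distrib_mat_vec[of _ n n] minus_scalar_prod_distrib[of _ n] scalar_prod_minus_distrib[of _ n])
    qed
    have 2: "(z - s) \<bullet> (C *\<^sub>v (z - s)) = z \<bullet> (C *\<^sub>v z) - 2 * (d \<bullet> z) + d \<bullet> s"
    proof -
      have "s \<bullet> (C *\<^sub>v z) = d \<bullet> z" using symC[OF d(2) z] by (simp add: Cs)
      then show ?thesis
        using z d C by (simp add: mult_minus_distrib_mat_vec[of _ m m] minus_scalar_prod_distrib[of _ m]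
            scalar_prod_minus_distrib[of _ m] Cs comm_scalar_prod[of _ m])
    qed
    have 3: "x \<bullet> (E *\<^sub>v x) = x \<bullet> (A *\<^sub>v x) - d \<bullet> s"
      using x d Ac Nc Om xAz[OF d(2)] N_vec[OF x] E_vec[OF x]
      by (simp add: scalar_prod_minus_distrib[of _ n] d_def s_def)
    show ?thesis using 1 2 3 by (simp add: d_def s_def)
  qed
  have C_nonneg: "0 \<le> v \<bullet> (C *\<^sub>v v)" if "v \<in> carrier_vec m" for v
    unfolding C_form[OF that] using Om that by (intro psd_matD(3)[OF A]) auto
  have E_sym: "transpose_mat E = E"
  proof -
    have "transpose_mat (nystrom A Om) = nystrom A Om"
    proof -
      have AT: "A * Om \<in> carrier_mat n m" "T * A \<in> carrier_mat m n" using Ac Om T by auto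
      have tA: "transpose_mat (A * Om) = T * A" using Ac Om by (simp add: transpose_mult[of _ n n _ m] T_def)
      then have tA': "transpose_mat (T * A) = A * Om" by (metis transpose_transpose)
      have eq: "nystrom A Om = (A * Om) * (P * (T * A))"
      proof -
        have AP: "A * Om * P \<in> carrier_mat n m" using AT(1) pinv(1) by (rule mult_carrier_mat)
        have "A * Om * P * T * A = (A * Om * P) * (T * A)" using AP T Ac(1) by (rule assoc_mult_mat)
        also have "\<dots> = (A * Om) * (P * (T * A))" using AT(1) pinv(1) AT(2) by (rule assoc_mult_mat)
        finally show ?thesis unfolding nys .
      qed
      have "transpose_mat (nystrom A Om) = transpose_mat (P * (T * A)) * transpose_mat (A * Om)"
        unfolding eq using AT pinv(1) by (intro transpose_mult[of _ n m _ n]) auto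
      also have "transpose_mat (P * (T * A)) = (A * Om) * P"
        using AT pinv(1,2) tA' by (simp add: transpose_mult[of _ m m _ n])
      finally show ?thesis unfolding eq tA using AT pinv(1) by (simp add: assoc_mult_mat[of _ n m _ m _ n])
    qed
    then show ?thesis unfolding E_def using Ac Nc by (simp add: transpose_minus[of _ n n])
  qed
  show "psd_mat n (A - nystrom A Om)"
    unfolding psd_mat_def E_def[symmetric]
  proof (intro conjI ballI E E_sym)
    fix x :: "real vec" assume x: "x \<in> carrier_vec n"
    define s where "s = P *\<^sub>v (T *\<^sub>v (A *\<^sub>v x))"
    have s: "s \<in> carrier_vec m" using T Ac x pinv(1) by (simp add: s_def)
    have "s - s = 0\<^sub>v m" using s by simp
    then have "x \<bullet> (E *\<^sub>v x) = (x - Om *\<^sub>v s) \<bullet> (A *\<^sub>v (x - Om *\<^sub>v s))"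
      using key[OF x s] C by (simp add: s_def[symmetric])
    then show "0 \<le> x \<bullet> (E *\<^sub>v x)" using psd_matD(3)[OF A, of "x - Om *\<^sub>v s"] x s Om by simp
  qed
  show "x \<bullet> ((A - nystrom A Om) *\<^sub>v x) \<le> (x - Om *\<^sub>v z) \<bullet> (A *\<^sub>v (x - Om *\<^sub>v z))"
    if "x \<in> carrier_vec n" "z \<in> carrier_vec m" for x z
    using key[OF that] C_nonneg[of "z - P *\<^sub>v (T *\<^sub>v (A *\<^sub>v x))"] that T Ac pinv(1) by (simp add: E_def[symmetric])
qed

section \<open>Expected error\<close>

text \<open>Used with a small weight to split off the ridge error, and with the weight 2 for the
  constants 3 and 3/2.\<close>

lemma sum_sq_add_le:
  fixes f g :: "'a \<Rightarrow> real"
  assumes "0 < \<eta>"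
  shows "(\<Sum>b\<in>B. (f b + g b)\<^sup>2) \<le> (1 + \<eta>) * (\<Sum>b\<in>B. (f b)\<^sup>2) + (1 + 1 / \<eta>) * (\<Sum>b\<in>B. (g b)\<^sup>2)"
proof -
  have "(f b + g b)\<^sup>2 \<le> (1 + \<eta>) * (f b)\<^sup>2 + (1 + 1 / \<eta>) * (g b)\<^sup>2" for b
  proof -
    have "0 \<le> (\<eta> * f b - g b)\<^sup>2 / \<eta>" using assms by simp
    also have "\<dots> = \<eta> * (f b)\<^sup>2 + (g b)\<^sup>2 / \<eta> - 2 * f b * g b"
      using assms by (simp add: power2_eq_square field_simps)
    finally show ?thesis by (simp add: power2_eq_square algebra_simps)
  qed
  then have "(\<Sum>b\<in>B. (f b + g b)\<^sup>2) \<le> (\<Sum>b\<in>B. (1 + \<eta>) * (f b)\<^sup>2 + (1 + 1 / \<eta>) * (g b)\<^sup>2)"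
    by (intro sum_mono)
  then show ?thesis by (simp only: sum.distrib sum_distrib_left)
qed

text \<open>The squared norm of a block row is at most the sum of the squared norms of its blocks.
  This keeps the coefficient 1 before the norm of \<Sigma>2, which (a + b)^2 \<le> 2 a^2 + 2 b^2
  would double.\<close>

lemma sum_sq_diff_le:
  fixes f g :: "'a \<Rightarrow> real"
  assumes f: "(\<Sum>b\<in>B. (f b)\<^sup>2) \<le> s * P" and g: "(\<Sum>b\<in>B. (g b)\<^sup>2) \<le> t * Q"
    and nonneg: "0 \<le> s" "0 \<le> t" "0 \<le> P" "0 \<le> Q"
  shows "(\<Sum>b\<in>B. (f b - g b)\<^sup>2) \<le> (s + t) * (P + Q)"
proof -
  define c where "c = (\<Sum>b\<in>B. f b * g b)"
  have "c\<^sup>2 \<le> (\<Sum>b\<in>B. (f b)\<^sup>2) * (\<Sum>b\<in>B. (g b)\<^sup>2)" unfolding c_def by (rule Cauchy_Schwarz_ineq_sum)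
  also have "\<dots> \<le> (s * P) * (t * Q)" using f g nonneg by (intro mult_mono) (auto simp: sum_nonneg)
  finally have cs: "c\<^sup>2 \<le> (s * P) * (t * Q)" .
  have "\<bar>2 * c\<bar>\<^sup>2 = 4 * c\<^sup>2" by (simp add: power2_eq_square)
  moreover have "4 * ((s * P) * (t * Q)) = (s * Q + t * P)\<^sup>2 - (s * Q - t * P)\<^sup>2"
    by (simp add: power2_eq_square algebra_simps)
  moreover have "0 \<le> (s * Q - t * P)\<^sup>2" by simp
  ultimately have le: "\<bar>2 * c\<bar>\<^sup>2 \<le> (s * Q + t * P)\<^sup>2" using cs by linarith
  have "0 \<le> s * Q + t * P" using nonneg by simp
  with le have "\<bar>2 * c\<bar> \<le> s * Q + t * P" by (rule power2_le_imp_le)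
  moreover have "(\<Sum>b\<in>B. (f b - g b)\<^sup>2) = (\<Sum>b\<in>B. (f b)\<^sup>2) - 2 * c + (\<Sum>b\<in>B. (g b)\<^sup>2)"
    unfolding c_def sum_distrib_left sum_subtractf[symmetric] sum.distrib[symmetric]
    by (intro sum.cong refl) (simp add: power2_eq_square algebra_simps)
  ultimately show ?thesis using f g by (simp add: algebra_simps)
qed

lemma sum_split_at:
  fixes f :: "nat \<Rightarrow> real"
  assumes "k \<le> n"
  shows "(\<Sum>i<n. f i) = (\<Sum>i<k. f i) + (\<Sum>b<n - k. f (b + k))"
proof -
  have "(\<Sum>i<n. f i) = (\<Sum>i<k. f i) + (\<Sum>i=k..<n. f i)"
    using assms by (metis atLeast0LessThan sum.atLeastLessThan_concat zero_le)
  also have "(\<Sum>i=k..<n. f i) = (\<Sum>b<n - k. f (b + k))"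
    using assms sum.shift_bounds_nat_ivl[of f 0 k "n - k"] by (simp add: atLeast0LessThan)
  finally show ?thesis .
qed

section \<open>The covariance in the eigenbasis of A and its Schur complement\<close>

locale nystrom_problem =
  fixes A K U :: "real mat" and \<sigma> :: "nat \<Rightarrow> real" and n k p :: nat
  assumes A_psd: "psd_mat n A" and k_pos: "0 < k" and k_le: "k \<le> n" and p_ge: "2 \<le> p"
    and K_psd: "psd_mat n K" and U_orth: "orth n U"
    and A_eig: "A = U * diag_m \<sigma> n * transpose_mat U"
    and sigma_nonneg: "\<And>i. i < n \<Longrightarrow> 0 \<le> \<sigma> i"
    and K11_inv: "invertible_mat (transpose_mat (block U n k 0 0) * K * block U n k 0 0)"
begin

definition "r = n - k"
definition "U1 = block U n k 0 0"
definition "U2 = block U n r 0 k"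
definition "Kh = psd_sqrt K"
definition "Cm = transpose_mat U * Kh"
definition "C1 = transpose_mat U1 * Kh"
definition "C2 = transpose_mat U2 * Kh"
definition "K11 = transpose_mat U1 * K * U1"
definition "K21 = transpose_mat U2 * K * U1"
definition "K22 = transpose_mat U2 * K * U2"
definition "Sh = diag_m (\<lambda>i. sqrt (\<sigma> (i + k))) r"
definition "Jm = minv K11"
text \<open>\<open>Lm\<close> holds the coefficients of the linear regression of the weighted block
  \<Sigma>2^(1/2) Omega_2 on Omega_1, and \<open>Sm\<close> G is the regression residual. Their Gram
  matrices are the matrices in \<delta> and \<beta>.\<close>

definition "Lm = Sh * (K21 * Jm)"
definition "Sm = Sh * C2 - Lm * C1"
definition "\<kappa> = spec_norm Jm"

lemma carriers:
  "U \<in> carrier_mat n n" "U1 \<in> carrier_mat n k" "U2 \<in> carrier_mat n r"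
  "transpose_mat U1 \<in> carrier_mat k n" "transpose_mat U2 \<in> carrier_mat r n"
  "K \<in> carrier_mat n n" "Kh \<in> carrier_mat n n" "Sh \<in> carrier_mat r r"
  "Cm \<in> carrier_mat n n" "C1 \<in> carrier_mat k n" "C2 \<in> carrier_mat r n"
  "K11 \<in> carrier_mat k k" "K21 \<in> carrier_mat r k" "K22 \<in> carrier_mat r r"
proof -
  show U: "U \<in> carrier_mat n n" using U_orth by (simp add: orth_def)
  show 1: "U1 \<in> carrier_mat n k" "U2 \<in> carrier_mat n r" by (simp_all add: U1_def U2_def block_def)
  then show 2: "transpose_mat U1 \<in> carrier_mat k n" "transpose_mat U2 \<in> carrier_mat r n" by simp_all
  show 3: "K \<in> carrier_mat n n" "Kh \<in> carrier_mat n n"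
    using psd_matD(1)[OF K_psd] psd_matD(1)[OF psd_sqrt(1)[OF K_psd]] by (simp_all add: Kh_def)
  show "Sh \<in> carrier_mat r r" by (simp add: Sh_def)
  show "Cm \<in> carrier_mat n n" "C1 \<in> carrier_mat k n" "C2 \<in> carrier_mat r n"
    using U 2 3 by (auto simp: Cm_def C1_def C2_def)
  show "K11 \<in> carrier_mat k k" "K21 \<in> carrier_mat r k" "K22 \<in> carrier_mat r r"
    using 1 2 3 by (auto simp: K11_def K21_def K22_def)
qed

lemma K_gram: "Kh * transpose_mat Kh = K" and Kh_sym: "transpose_mat Kh = Kh"
  using psd_matD(2)[OF psd_sqrt(1)[OF K_psd]] psd_sqrt(2)[OF K_psd] by (simp_all add: Kh_def)

lemma gram_blocks:
  assumes "X \<in> carrier_mat n m" "Y \<in> carrier_mat n m'"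
  shows "(transpose_mat X * Kh) * transpose_mat (transpose_mat Y * Kh) = transpose_mat X * K * Y"
proof -
  have "transpose_mat (transpose_mat Y * Kh) = Kh * Y"
    using assms carriers by (simp add: transpose_mult[of _ m' n _ n] Kh_sym)
  moreover have "(transpose_mat X * Kh) * (Kh * Y) = transpose_mat X * (Kh * Kh) * Y"
    using assms carriers by (simp add: assoc_mult_mat[of _ m n _ n _ m'] assoc_mult_mat[of _ m n _ n _ n] assoc_mult_mat[of _ n n _ n _ m'])
  ultimately show ?thesis using K_gram by (simp add: Kh_sym)
qed

lemma K_blocks:
  "C1 * transpose_mat C1 = K11" "C2 * transpose_mat C1 = K21" "C2 * transpose_mat C2 = K22"
  unfolding C1_def C2_def K11_def K21_def K22_def using carriers by (intro gram_blocks; simp)+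

lemma K12: "C1 * transpose_mat C2 = transpose_mat K21"
  unfolding K_blocks(2)[symmetric] using carriers by (simp add: transpose_mult[of _ r n _ k])

lemma C_entries:
  assumes "l < n"
  shows "a < k \<Longrightarrow> C1 $$ (a, l) = Cm $$ (a, l)" "b < r \<Longrightarrow> C2 $$ (b, l) = Cm $$ (b + k, l)"
proof -
  show "C1 $$ (a, l) = Cm $$ (a, l)" if "a < k"
  proof -
    have "C1 $$ (a, l) = (\<Sum>m<n. transpose_mat U1 $$ (a, m) * Kh $$ (m, l))"
      unfolding C1_def by (rule index_mult_mat_sum) (use carriers that assms in auto)
    also have "\<dots> = (\<Sum>m<n. transpose_mat U $$ (a, m) * Kh $$ (m, l))"
      using that k_le carriers by (intro sum.cong) (auto simp: U1_def block_def)
    also have "\<dots> = Cm $$ (a, l)"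
      unfolding Cm_def by (rule index_mult_mat_sum[symmetric, of _ n]) (use carriers that k_le assms in auto)
    finally show ?thesis .
  qed
  show "C2 $$ (b, l) = Cm $$ (b + k, l)" if "b < r"
  proof -
    have "C2 $$ (b, l) = (\<Sum>m<n. transpose_mat U2 $$ (b, m) * Kh $$ (m, l))"
      unfolding C2_def by (rule index_mult_mat_sum) (use carriers that assms in auto)
    also have "\<dots> = (\<Sum>m<n. transpose_mat U $$ (b + k, m) * Kh $$ (m, l))"
      using that k_le carriers by (intro sum.cong) (auto simp: U2_def block_def r_def)
    also have "\<dots> = Cm $$ (b + k, l)"
      unfolding Cm_def by (rule index_mult_mat_sum[symmetric, of _ n]) (use carriers that k_le assms in \<open>auto simp: r_def\<close>)
    finally show ?thesis .
  qed
qed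

lemma J: "Jm \<in> carrier_mat k k" "K11 * Jm = 1\<^sub>m k" "Jm * K11 = 1\<^sub>m k"
proof -
  obtain B where B: "inverts_mat K11 B" "inverts_mat B K11"
    using K11_inv by (auto simp: invertible_mat_def K11_def U1_def)
  have KB: "K11 * B = 1\<^sub>m k" using B(1) carriers by (simp add: inverts_mat_def)
  have "dim_row B = k" using B(2) carriers by (metis carrier_matD(2) index_mult_mat(3) index_one_mat(3) inverts_mat_def)
  moreover have "dim_col B = k" using KB by (metis index_mult_mat(3) index_one_mat(3))
  ultimately have Bc: "B \<in> carrier_mat k k" by auto
  have BK: "B * K11 = 1\<^sub>m k" using B(2) Bc by (simp add: inverts_mat_def)
  \<comment> \<open>\<open>minv\<close> extracts the value of an option, so the success of the
    elimination has to be known first: it fails only on non-units of the matrix ring.\<close>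
  have "K11 \<in> Units (ring_mat TYPE(real) k ())"
    unfolding Units_def using KB BK Bc carriers by (auto simp: ring_mat_def)
  then obtain X where "mat_inverse K11 = Some X" using mat_inverse(1)[OF carriers(12), of "()"] by (cases "mat_inverse K11") auto
  then show "Jm \<in> carrier_mat k k" "K11 * Jm = 1\<^sub>m k" "Jm * K11 = 1\<^sub>m k"
    using mat_inverse(2)[OF carriers(12)] by (auto simp: Jm_def minv_def)
qed

lemma K11_sym: "transpose_mat K11 = K11"
  using psd_matD(2)[OF gram_psd[OF carriers(10)]] by (simp add: K_blocks)

lemma J_sym: "transpose_mat Jm = Jm"
proof -
  have "transpose_mat (K11 * Jm) = transpose_mat Jm * transpose_mat K11"
    using carriers J(1) by (intro transpose_mult) auto
  then have "transpose_mat Jm * K11 = 1\<^sub>m k" by (simp add: J K11_sym)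
  then have "(transpose_mat Jm * K11) * Jm = Jm" using J by simp
  then show ?thesis using J carriers by (simp add: assoc_mult_mat[of _ k k _ k _ k])
qed

text \<open>J = J K11 J is the Gram matrix of J C1.\<close>

lemma J_psd: "psd_mat k Jm"
proof -
  have JC: "Jm * C1 \<in> carrier_mat k n" using J carriers by simp
  have "(Jm * C1) * transpose_mat (Jm * C1) = (Jm * C1) * (transpose_mat C1 * Jm)"
    using J carriers by (simp add: transpose_mult[of _ k k _ n] J_sym)
  also have "\<dots> = Jm * (C1 * transpose_mat C1) * Jm"
    using J(1) carriers by (simp add: assoc_mult_mat[of _ k k _ n _ k] assoc_mult_mat[of _ k k _ k _ k] assoc_mult_mat[of _ k n _ k _ k])
  also have "\<dots> = Jm" using J by (simp add: K_blocks)
  finally show ?thesis using gram_psd[OF JC] by simp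
qed

lemma K_form:
  assumes "v \<in> carrier_vec k"
  shows "v \<bullet> (K11 *\<^sub>v v) = (\<Sum>l<n. (\<Sum>a<k. v $ a * C1 $$ (a, l))\<^sup>2)"
  using gram_form[OF carriers(10) assms] by (simp add: K_blocks)

text \<open>This is \<open>psd_apply_sq\<close> for J, the inverse of \<open>K11\<close>, at the
  vector K11 v. It provides the constant \<kappa> of the locale \<open>ridge\<close>.\<close>

lemma K_coercive:
  assumes v: "v \<in> carrier_vec k" shows "v \<bullet> v \<le> \<kappa> * (v \<bullet> (K11 *\<^sub>v v))"
proof -
  have Kv: "K11 *\<^sub>v v \<in> carrier_vec k" using carriers v by simp
  have "Jm *\<^sub>v (K11 *\<^sub>v v) = (Jm * K11) *\<^sub>v v" using J(1) carriers v by (simp add: assoc_mult_mat_vec[of _ k k _ k])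
  then have JK: "Jm *\<^sub>v (K11 *\<^sub>v v) = v" using v by (simp add: J)
  have "v \<bullet> v \<le> \<kappa> * ((K11 *\<^sub>v v) \<bullet> v)" using psd_apply_sq[OF J_psd Kv] by (simp add: JK \<kappa>_def)
  then show ?thesis using v Kv by (simp add: comm_scalar_prod[of _ k])
qed

lemma kappa_pos: "0 < \<kappa>"
proof -
  have "unit_vec k 0 \<bullet> unit_vec k 0 \<le> \<kappa> * (unit_vec k 0 \<bullet> (K11 *\<^sub>v unit_vec k 0))" by (rule K_coercive) simp
  then have "1 \<le> \<kappa> * (unit_vec k 0 \<bullet> (K11 *\<^sub>v unit_vec k 0))" using k_pos by simp
  moreover have "0 \<le> unit_vec k 0 \<bullet> (K11 *\<^sub>v unit_vec k 0)" by (subst K_form) (auto simp: sum_nonneg)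
  ultimately show ?thesis by (metis mult_nonpos_nonneg not_le not_one_le_zero order_trans)
qed

lemma Lm: "Lm \<in> carrier_mat r k" and Sm: "Sm \<in> carrier_mat r n"
  using carriers J by (auto simp: Lm_def Sm_def)

lemma Lm_gram: "Lm * transpose_mat Lm = Sh * K21 * Jm * Jm * transpose_mat K21 * Sh"
proof -
  have K: "transpose_mat K21 \<in> carrier_mat k r" using carriers by simp
  have "transpose_mat Lm = (Jm * transpose_mat K21) * Sh"
    unfolding Lm_def using carriers J by (simp add: transpose_mult[of _ r r _ k] transpose_mult[of _ r k _ k] J_sym Sh_def)
  then show ?thesis unfolding Lm_def using carriers(8,13) J(1) K
    by (simp add: assoc_mult_mat[of _ r r _ k _ k] assoc_mult_mat[of _ r k _ k _ k] assoc_mult_mat[of _ r k _ k _ r]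
        assoc_mult_mat[of _ k k _ k _ r] assoc_mult_mat[of _ k r _ r _ r] assoc_mult_mat[of _ k k _ r _ r] assoc_mult_mat[of _ r k _ r _ r]
        assoc_mult_mat[of _ r r _ k _ r] assoc_mult_mat[of _ r r _ r _ r]
        mult_carrier_mat[of _ r k _ r] mult_carrier_mat[of _ k k _ r])
qed

lemma Lm_K11: "Lm * K11 = Sh * K21"
proof -
  have "Lm * K11 = Sh * (K21 * (Jm * K11))"
    unfolding Lm_def using carriers J(1)
    by (simp add: assoc_mult_mat[of _ r r _ k _ k] assoc_mult_mat[of _ r k _ k _ k])
  then show ?thesis using carriers by (simp add: J)
qed

text \<open>The normal equations of the regression, \<open>Lm_K11\<close>. They say that Sm G is
  uncorrelated with Omega_1 = C1 G.\<close>

lemma Sm_C1: "Sm * transpose_mat C1 = 0\<^sub>m r k"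
proof -
  have c: "transpose_mat C1 \<in> carrier_mat n k" using carriers by simp
  have "Sm * transpose_mat C1 = Sh * C2 * transpose_mat C1 - Lm * C1 * transpose_mat C1"
    unfolding Sm_def using carriers Lm c by (intro minus_mult_distrib_mat) auto
  also have "Sh * C2 * transpose_mat C1 = Sh * (C2 * transpose_mat C1)"
    using carriers c by (intro assoc_mult_mat) auto
  also have "Lm * C1 * transpose_mat C1 = Lm * (C1 * transpose_mat C1)"
    using carriers Lm c by (intro assoc_mult_mat) auto
  finally have "Sm * transpose_mat C1 = Sh * K21 - Sh * K21" by (simp add: K_blocks Lm_K11)
  also have "\<dots> = 0\<^sub>m r k" using carriers by (intro minus_r_inv_mat) auto
  finally show ?thesis .
qed

text \<open>Since \<open>Sm\<close> is orthogonal to \<open>C1\<close>, only Sm C2^T Sh survives,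
  which is the weighted Schur complement.\<close>

lemma Sm_gram: "Sm * transpose_mat Sm = Sh * (K22 - K21 * Jm * transpose_mat K21) * Sh"
proof -
  have c: "transpose_mat C1 \<in> carrier_mat n k" "transpose_mat C2 \<in> carrier_mat n r" "transpose_mat Lm \<in> carrier_mat k r"
    "transpose_mat K21 \<in> carrier_mat k r"
    using carriers Lm by auto
  have t: "transpose_mat Sm = transpose_mat C2 * Sh - transpose_mat C1 * transpose_mat Lm"
  proof -
    have "transpose_mat Sm = transpose_mat (Sh * C2) - transpose_mat (Lm * C1)"
      unfolding Sm_def using carriers Lm by (intro transpose_minus[of _ r n]) auto
    moreover have "transpose_mat (Sh * C2) = transpose_mat C2 * Sh"
      using carriers by (simp add: transpose_mult[of _ r r _ n] Sh_def)
    moreover have "transpose_mat (Lm * C1) = transpose_mat C1 * transpose_mat Lm"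
      using carriers Lm by (intro transpose_mult) auto
    ultimately show ?thesis by simp
  qed
  have e1: "Sm * transpose_mat Sm = Sm * (transpose_mat C2 * Sh) - Sm * (transpose_mat C1 * transpose_mat Lm)"
    unfolding t by (rule mult_minus_distrib_mat[OF Sm mult_carrier_mat[OF c(2) carriers(8)] mult_carrier_mat[OF c(1,3)]])
  have e2: "Sm * (transpose_mat C1 * transpose_mat Lm) = 0\<^sub>m r r"
  proof -
    have "Sm * (transpose_mat C1 * transpose_mat Lm) = (Sm * transpose_mat C1) * transpose_mat Lm"
      by (rule assoc_mult_mat[OF Sm c(1,3), symmetric])
    then show ?thesis using c by (simp add: Sm_C1)
  qed
  have e3: "Sm * (transpose_mat C2 * Sh) = (Sm * transpose_mat C2) * Sh"
    by (rule assoc_mult_mat[OF Sm c(2) carriers(8), symmetric])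
  have e4: "Sm * transpose_mat C2 = Sh * (K22 - K21 * Jm * transpose_mat K21)"
  proof -
    have KJ: "K21 * Jm \<in> carrier_mat r k" using carriers(13) J(1) by (rule mult_carrier_mat)
    have "Sm * transpose_mat C2 = Sh * C2 * transpose_mat C2 - Lm * C1 * transpose_mat C2"
      unfolding Sm_def
      by (rule minus_mult_distrib_mat[OF mult_carrier_mat[OF carriers(8,11)] mult_carrier_mat[OF Lm carriers(10)] c(2)])
    moreover have "Sh * C2 * transpose_mat C2 = Sh * K22"
      unfolding K_blocks[symmetric] by (rule assoc_mult_mat[OF carriers(8,11) c(2)])
    moreover have "Lm * C1 * transpose_mat C2 = Lm * transpose_mat K21"
      unfolding K12[symmetric] by (rule assoc_mult_mat[OF Lm carriers(10) c(2)])
    moreover have "Lm * transpose_mat K21 = Sh * (K21 * Jm * transpose_mat K21)"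
      unfolding Lm_def by (rule assoc_mult_mat[OF carriers(8) KJ c(4)])
    moreover have "Sh * (K22 - K21 * Jm * transpose_mat K21) = Sh * K22 - Sh * (K21 * Jm * transpose_mat K21)"
      by (rule mult_minus_distrib_mat[OF carriers(8,14) mult_carrier_mat[OF KJ c(4)]])
    ultimately show ?thesis by simp
  qed
  have "Sm * transpose_mat Sm = Sh * (K22 - K21 * Jm * transpose_mat K21) * Sh - 0\<^sub>m r r"
    by (simp only: e1 e2 e3 e4)
  moreover have "Sh * (K22 - K21 * Jm * transpose_mat K21) * Sh \<in> carrier_mat r r"
    by (rule mult_carrier_mat[OF mult_carrier_mat[OF carriers(8) minus_carrier_mat[OF
          mult_carrier_mat[OF mult_carrier_mat[OF carriers(13) J(1)] c(4)]]] carriers(8)])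
  moreover have "X - 0\<^sub>m r r = X" if "X \<in> carrier_mat r r" for X :: "real mat"
    using that by (intro eq_matI) auto
  ultimately show ?thesis by simp
qed

end

context nystrom_problem
begin

lemma K11_entry:
  assumes "a < k" "b < k" shows "K11 $$ (a, b) = (\<Sum>l<n. C1 $$ (a, l) * C1 $$ (b, l))"
proof -
  have "K11 $$ (a, b) = (\<Sum>l<n. C1 $$ (a, l) * transpose_mat C1 $$ (l, b))"
    unfolding K_blocks(1)[symmetric] by (rule index_mult_mat_sum) (use assms carriers in auto)
  also have "\<dots> = (\<Sum>l<n. C1 $$ (a, l) * C1 $$ (b, l))"
    using assms carriers by (intro sum.cong) auto
  finally show ?thesis .
qed

text \<open>The squared Frobenius norm of \<open>K11\<close>, which bounds |H v|^2 by Cauchy-Schwarz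
  in \<open>resid_sq\<close>.\<close>

definition hF :: real where
  "hF = (\<Sum>a<k. \<Sum>b<k. (K11 $$ (a, b))\<^sup>2)"

lemma hF_nonneg: "0 \<le> hF" by (simp add: hF_def sum_nonneg)

end

section \<open>The error form evaluated with the regularized right inverse\<close>

locale nystrom_regularized = nystrom_problem +
  fixes e :: real
  assumes e_pos: "0 < e"
begin

sublocale rg: ridge n "k + p" k "\<lambda>a l. C1 $$ (a, l)" "\<lambda>a b. Jm $$ (a, b)" e \<kappa>
proof
  show "0 < e" by (rule e_pos)
  show "0 < \<kappa>" by (rule kappa_pos)
  show "(\<Sum>b<k. (\<Sum>l<n. C1 $$ (a, l) * C1 $$ (b, l)) * Jm $$ (b, c)) = (if a = c then 1 else 0)"
    if "a < k" "c < k" for a c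
  proof -
    have "(K11 * Jm) $$ (a, c) = (\<Sum>b<k. K11 $$ (a, b) * Jm $$ (b, c))"
      by (rule index_mult_mat_sum) (use that carriers J in auto)
    then show ?thesis using that by (simp add: J K11_entry)
  qed
  fix v :: "nat \<Rightarrow> real"
  have v: "vec k v \<in> carrier_vec k" by simp
  have "(\<Sum>a<k. (v a)\<^sup>2) = vec k v \<bullet> vec k v"
    by (subst scalar_prod_sum[OF v]) (simp add: power2_eq_square)
  also have "\<dots> \<le> \<kappa> * (vec k v \<bullet> (K11 *\<^sub>v vec k v))" by (rule K_coercive[OF v])
  finally show "(\<Sum>a<k. (v a)\<^sup>2) \<le> \<kappa> * (\<Sum>l<n. (\<Sum>a<k. v a * C1 $$ (a, l))\<^sup>2)"
    by (simp add: K_form[OF v])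
qed

text \<open>The defect u - Omega_1 Omega_1^T R u of the regularized right inverse, see
  \<open>rg.w_\<alpha>\<close>.\<close>

definition resid :: "(nat \<Rightarrow> real) \<Rightarrow> (nat \<times> nat \<Rightarrow> real) \<Rightarrow> nat \<Rightarrow> real" where
  "resid u x a = e * (\<Sum>b<k. rg.H a b * (\<Sum>c<k. rg.R x b c * u c))"

definition trR :: "(nat \<times> nat \<Rightarrow> real) \<Rightarrow> real" where
  "trR x = (\<Sum>c<k. rg.R x c c)"

lemma hF_eq: "hF = (\<Sum>a<k. \<Sum>b<k. (rg.H a b)\<^sup>2)"
  unfolding hF_def by (intro sum.cong refl) (simp add: K11_entry rg.H_def)

lemma trR_nonneg: "0 \<le> trR x" by (auto simp: trR_def intro!: sum_nonneg rg.R_diag_nonneg)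

text \<open>Of the factor e^2, one e is spent on \<open>rg.R_apply_sq\<close> and one remains, so
  the mean of the defect vanishes with e.\<close>

lemma resid_sq: "(\<Sum>a<k. (resid u x a)\<^sup>2) \<le> e * (hF * \<kappa> * trR x) * (\<Sum>b<k. (u b)\<^sup>2)"
proof -
  let ?s = "\<lambda>b. \<Sum>c<k. rg.R x b c * u c"
  have HS: "(\<Sum>a<k. (\<Sum>b<k. rg.H a b * ?s b)\<^sup>2) \<le> hF * (\<Sum>b<k. (?s b)\<^sup>2)"
  proof -
    have "hF * (\<Sum>b<k. (?s b)\<^sup>2) = (\<Sum>a<k. (\<Sum>b<k. (rg.H a b)\<^sup>2) * (\<Sum>b<k. (?s b)\<^sup>2))"
      unfolding hF_eq by (rule sum_distrib_right)
    moreover have "(\<Sum>a<k. (\<Sum>b<k. rg.H a b * ?s b)\<^sup>2) \<le> (\<Sum>a<k. (\<Sum>b<k. (rg.H a b)\<^sup>2) * (\<Sum>b<k. (?s b)\<^sup>2))"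
      by (intro sum_mono Cauchy_Schwarz_ineq_sum)
    ultimately show ?thesis by (simp only:)
  qed
  have "(\<Sum>a<k. (resid u x a)\<^sup>2) = e\<^sup>2 * (\<Sum>a<k. (\<Sum>b<k. rg.H a b * ?s b)\<^sup>2)"
    by (simp only: resid_def power_mult_distrib sum_distrib_left[of "e\<^sup>2"])
  then have "(\<Sum>a<k. (resid u x a)\<^sup>2) \<le> e\<^sup>2 * (hF * (\<Sum>b<k. (?s b)\<^sup>2))"
    using HS by (simp add: mult_left_mono)
  moreover have "e\<^sup>2 * (hF * (\<Sum>b<k. (?s b)\<^sup>2)) = e * hF * (e * (\<Sum>b<k. (?s b)\<^sup>2))"
    by (simp only: power2_eq_square mult_ac)
  moreover have "e * hF * (e * (\<Sum>b<k. (?s b)\<^sup>2)) \<le> e * hF * (\<kappa> * (\<Sum>c<k. rg.R x c c) * (\<Sum>b<k. (u b)\<^sup>2))"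
    using e_pos hF_nonneg by (intro mult_left_mono rg.R_apply_sq) auto
  moreover have "e * (hF * \<kappa> * trR x) * (\<Sum>b<k. (u b)\<^sup>2) = e * hF * (\<kappa> * (\<Sum>c<k. rg.R x c c) * (\<Sum>b<k. (u b)\<^sup>2))"
    by (simp only: trR_def mult_ac)
  ultimately show ?thesis by linarith
qed

abbreviation Lf :: "nat \<Rightarrow> nat \<Rightarrow> real" where "Lf b a \<equiv> Lm $$ (b, a)"
abbreviation Sf :: "nat \<Rightarrow> nat \<Rightarrow> real" where "Sf b l \<equiv> Sm $$ (b, l)"

lemma Sf_eq:
  assumes "b < r" "l < n"
  shows "Sf b l = sqrt (\<sigma> (b + k)) * Cm $$ (b + k, l) - (\<Sum>a<k. Lf b a * C1 $$ (a, l))"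
proof -
  have "(Sh * C2) $$ (b, l) = (\<Sum>m<r. Sh $$ (b, m) * C2 $$ (m, l))"
    by (rule index_mult_mat_sum) (use assms carriers in auto)
  also have "\<dots> = (\<Sum>m<r. if m = b then sqrt (\<sigma> (b + k)) * C2 $$ (b, l) else 0)"
    using assms by (intro sum.cong) (auto simp: Sh_def diag_m_def)
  also have "\<dots> = sqrt (\<sigma> (b + k)) * Cm $$ (b + k, l)" using assms by (simp add: C_entries)
  finally have 1: "(Sh * C2) $$ (b, l) = sqrt (\<sigma> (b + k)) * Cm $$ (b + k, l)" .
  have "(Lm * C1) $$ (b, l) = (\<Sum>a<k. Lf b a * C1 $$ (a, l))"
    by (rule index_mult_mat_sum) (use assms carriers Lm in auto)
  then show ?thesis using 1 assms carriers Lm by (simp add: Sm_def)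
qed

lemma Sf_orth:
  assumes "a < k" "b < r" shows "(\<Sum>l<n. C1 $$ (a, l) * Sf b l) = 0"
proof -
  have "(Sm * transpose_mat C1) $$ (b, a) = (\<Sum>l<n. Sf b l * transpose_mat C1 $$ (l, a))"
    by (rule index_mult_mat_sum) (use assms carriers Sm in auto)
  also have "\<dots> = (\<Sum>l<n. C1 $$ (a, l) * Sf b l)"
    using assms carriers by (intro sum.cong) auto
  finally show ?thesis using assms by (simp add: Sm_C1)
qed

definition En :: "(nat \<times> nat \<Rightarrow> real) \<Rightarrow> real mat" where
  "En x = A - nystrom A (cov_sample K (k + p) x)"

lemma cov_sample_eq: "cov_sample K (k + p) x = Kh * mat n (k + p) x"
  using carriers by (simp add: cov_sample_def Kh_def)

lemma En_psd: "psd_mat n (En x)"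
  unfolding En_def cov_sample_eq using carriers by (intro nystrom_residual(1)[OF A_psd, of _ "k + p"]) auto

text \<open>\<open>nystrom_residual\<close> with z = Omega_1^T R y_1, where y_1 is the first block
  of y = U^T v. In the eigenbasis the first k coordinates of v - Om z are the defect
  \<open>resid\<close>. In the others Sh C2 = Sm + Lm C1 and Omega_1 z = y_1 - resid separate the
  regression part from the part uncorrelated with Omega_1.\<close>

lemma En_core:
  fixes y :: "nat \<Rightarrow> real"
  defines "v \<equiv> U *\<^sub>v vec n y"
  shows "v \<bullet> (En x *\<^sub>v v) \<le> (\<Sum>i<k. \<sigma> i * (resid y x i)\<^sup>2)
     + (\<Sum>b<r. (sqrt (\<sigma> (b + k)) * y (b + k) - ((\<Sum>a<k. Lf b a * y a) + rg.bilinear (Sf b) y x)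
          + (\<Sum>a<k. Lf b a * resid y x a))\<^sup>2)"
proof -
  let ?N = "k + p"
  define X where "X = mat n ?N x"
  define z where "z = vec ?N (\<lambda>j. rg.\<alpha> y x j)"
  define Om where "Om = Kh * X"
  have c: "X \<in> carrier_mat n ?N" "z \<in> carrier_vec ?N" "Om \<in> carrier_mat n ?N" "v \<in> carrier_vec n" "transpose_mat U \<in> carrier_mat n n"
    using carriers by (auto simp: X_def z_def Om_def v_def)
  define d where "d = v - Om *\<^sub>v z"
  have d: "d \<in> carrier_vec n" using c by (simp add: d_def)
  define q where "q = (\<lambda>i. \<Sum>j<?N. (\<Sum>l<n. Cm $$ (i, l) * x (l, j)) * rg.\<alpha> y x j)"
  have Ud: "(transpose_mat U *\<^sub>v d) $ i = y i - q i" if i: "i < n" for i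
  proof -
    have "transpose_mat U *\<^sub>v d = transpose_mat U *\<^sub>v v - transpose_mat U *\<^sub>v (Om *\<^sub>v z)"
      unfolding d_def using c by (intro mult_minus_distrib_mat_vec) auto
    moreover have "transpose_mat U *\<^sub>v v = vec n y"
    proof -
      have "transpose_mat U *\<^sub>v v = (transpose_mat U * U) *\<^sub>v vec n y"
        unfolding v_def using carriers c by (intro assoc_mult_mat_vec[symmetric]) auto
      then show ?thesis by (simp add: orthD[OF U_orth])
    qed
    moreover have "transpose_mat U *\<^sub>v (Om *\<^sub>v z) = Cm *\<^sub>v (X *\<^sub>v z)"
    proof -
      have "Om *\<^sub>v z = Kh *\<^sub>v (X *\<^sub>v z)" unfolding Om_def using carriers c by (intro assoc_mult_mat_vec) auto
      moreover have "Cm *\<^sub>v (X *\<^sub>v z) = transpose_mat U *\<^sub>v (Kh *\<^sub>v (X *\<^sub>v z))"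
        unfolding Cm_def using carriers c by (intro assoc_mult_mat_vec) auto
      ultimately show ?thesis by simp
    qed
    moreover have "(Cm *\<^sub>v (X *\<^sub>v z)) $ i = q i"
    proof -
      have "(Cm *\<^sub>v (X *\<^sub>v z)) $ i = (\<Sum>l<n. Cm $$ (i, l) * (X *\<^sub>v z) $ l)"
        by (rule index_mult_mat_vec_sum) (use carriers c i in auto)
      also have "\<dots> = (\<Sum>l<n. Cm $$ (i, l) * (\<Sum>j<?N. x (l, j) * rg.\<alpha> y x j))"
      proof (intro sum.cong refl arg_cong2[of _ _ _ _ "(*)"])
        fix l assume l: "l \<in> {..<n}"
        have "(X *\<^sub>v z) $ l = (\<Sum>j<?N. X $$ (l, j) * z $ j)"
          by (rule index_mult_mat_vec_sum) (use c l in auto)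
        then show "(X *\<^sub>v z) $ l = (\<Sum>j<?N. x (l, j) * rg.\<alpha> y x j)" using l by (simp add: X_def z_def)
      qed
      also have "\<dots> = (\<Sum>l<n. \<Sum>j<?N. Cm $$ (i, l) * x (l, j) * rg.\<alpha> y x j)"
        by (simp only: sum_distrib_left mult.assoc)
      also have "\<dots> = (\<Sum>j<?N. \<Sum>l<n. Cm $$ (i, l) * x (l, j) * rg.\<alpha> y x j)" by (rule sum.swap)
      also have "\<dots> = q i" by (simp only: q_def sum_distrib_right)
      finally show ?thesis .
    qed
    ultimately show ?thesis using i c carriers by simp
  qed
  have qw: "(\<Sum>j<?N. rg.w x a j * rg.\<alpha> y x j) = y a - resid y x a" if "a < k" for a
    using rg.w_\<alpha>[OF that] by (simp add: resid_def)
  have low: "y i - q i = resid y x i" if "i < k" for i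
  proof -
    have "q i = (\<Sum>j<?N. rg.w x i j * rg.\<alpha> y x j)"
      unfolding q_def rg.w_def using that by (intro sum.cong refl arg_cong2[of _ _ _ _ "(*)"]) (simp add: C_entries)
    then show ?thesis using qw[OF that] by simp
  qed
  have high: "sqrt (\<sigma> (b + k)) * (y (b + k) - q (b + k)) = sqrt (\<sigma> (b + k)) * y (b + k)
      - ((\<Sum>a<k. Lf b a * y a) + rg.bilinear (Sf b) y x) + (\<Sum>a<k. Lf b a * resid y x a)" if b: "b < r" for b
  proof -
    have "rg.bilinear (Sf b) y x
       = (\<Sum>j<?N. (\<Sum>l<n. (sqrt (\<sigma> (b + k)) * Cm $$ (b + k, l) - (\<Sum>a<k. Lf b a * C1 $$ (a, l))) * x (l, j)) * rg.\<alpha> y x j)"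
      unfolding rg.bilinear_def using Sf_eq[OF b] by (intro sum.cong refl arg_cong2[of _ _ _ _ "(*)"]) simp
    also have "\<dots> = (\<Sum>j<?N. sqrt (\<sigma> (b + k)) * ((\<Sum>l<n. Cm $$ (b + k, l) * x (l, j)) * rg.\<alpha> y x j)
        - (\<Sum>a<k. Lf b a * (rg.w x a j * rg.\<alpha> y x j)))"
    proof (intro sum.cong refl)
      fix j
      have "(\<Sum>l<n. (\<Sum>a<k. Lf b a * C1 $$ (a, l)) * x (l, j)) = (\<Sum>a<k. Lf b a * rg.w x a j)"
      proof -
        have "(\<Sum>l<n. (\<Sum>a<k. Lf b a * C1 $$ (a, l)) * x (l, j)) = (\<Sum>l<n. \<Sum>a<k. Lf b a * (C1 $$ (a, l) * x (l, j)))"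
          by (simp only: sum_distrib_right mult.assoc)
        also have "\<dots> = (\<Sum>a<k. \<Sum>l<n. Lf b a * (C1 $$ (a, l) * x (l, j)))" by (rule sum.swap)
        finally show ?thesis by (simp only: rg.w_def sum_distrib_left)
      qed
      then have "(\<Sum>l<n. (sqrt (\<sigma> (b + k)) * Cm $$ (b + k, l) - (\<Sum>a<k. Lf b a * C1 $$ (a, l))) * x (l, j))
          = sqrt (\<sigma> (b + k)) * (\<Sum>l<n. Cm $$ (b + k, l) * x (l, j)) - (\<Sum>a<k. Lf b a * rg.w x a j)"
        by (simp only: left_diff_distrib sum_subtractf mult.assoc sum_distrib_left)
      then show "(\<Sum>l<n. (sqrt (\<sigma> (b + k)) * Cm $$ (b + k, l) - (\<Sum>a<k. Lf b a * C1 $$ (a, l))) * x (l, j)) * rg.\<alpha> y x j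
          = sqrt (\<sigma> (b + k)) * ((\<Sum>l<n. Cm $$ (b + k, l) * x (l, j)) * rg.\<alpha> y x j) - (\<Sum>a<k. Lf b a * (rg.w x a j * rg.\<alpha> y x j))"
        by (simp only: left_diff_distrib mult.assoc sum_distrib_right)
    qed
    also have "\<dots> = sqrt (\<sigma> (b + k)) * q (b + k) - (\<Sum>j<?N. \<Sum>a<k. Lf b a * (rg.w x a j * rg.\<alpha> y x j))"
      by (simp only: sum_subtractf q_def sum_distrib_left)
    also have "(\<Sum>j<?N. \<Sum>a<k. Lf b a * (rg.w x a j * rg.\<alpha> y x j)) = (\<Sum>a<k. \<Sum>j<?N. Lf b a * (rg.w x a j * rg.\<alpha> y x j))"
      by (rule sum.swap)
    also have "\<dots> = (\<Sum>a<k. Lf b a * (y a - resid y x a))"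
      by (intro sum.cong refl) (simp add: sum_distrib_left[symmetric] qw)
    also have "\<dots> = (\<Sum>a<k. Lf b a * y a) - (\<Sum>a<k. Lf b a * resid y x a)"
      by (simp add: right_diff_distrib sum_subtractf)
    finally show ?thesis by (simp add: right_diff_distrib)
  qed
  have "v \<bullet> (En x *\<^sub>v v) \<le> d \<bullet> (A *\<^sub>v d)"
    unfolding En_def cov_sample_eq d_def Om_def[symmetric] X_def[symmetric]
    by (rule nystrom_residual(2)[OF A_psd c(3,4,2)])
  also have "\<dots> = (\<Sum>i<n. \<sigma> i * ((transpose_mat U *\<^sub>v d) $ i)\<^sup>2)"
    unfolding A_eig by (rule conj_diag_form[OF U_orth d])
  also have "\<dots> = (\<Sum>i<n. \<sigma> i * (y i - q i)\<^sup>2)" by (simp add: Ud)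
  also have "\<dots> = (\<Sum>i<k. \<sigma> i * (y i - q i)\<^sup>2) + (\<Sum>b<r. \<sigma> (b + k) * (y (b + k) - q (b + k))\<^sup>2)"
    unfolding r_def by (rule sum_split_at[OF k_le])
  also have "(\<Sum>b<r. \<sigma> (b + k) * (y (b + k) - q (b + k))\<^sup>2) = (\<Sum>b<r. (sqrt (\<sigma> (b + k)) * (y (b + k) - q (b + k)))\<^sup>2)"
    using sigma_nonneg by (intro sum.cong refl) (auto simp: power_mult_distrib r_def)
  finally show ?thesis using low high by simp
qed

end

text \<open>The trace is invariant under orthogonal conjugation. At the columns of U the bound of
  \<open>En_core\<close> becomes explicit.\<close>

lemma trace_orth:
  assumes U: "orth n U" and E: "E \<in> carrier_mat n n"
  shows "(\<Sum>i<n. E $$ (i, i)) = (\<Sum>i<n. (U *\<^sub>v unit_vec n i) \<bullet> (E *\<^sub>v (U *\<^sub>v unit_vec n i)))"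
proof -
  note c = orthD(1,2)[OF U]
  have entry: "(U *\<^sub>v unit_vec n i) \<bullet> (E *\<^sub>v (U *\<^sub>v unit_vec n i)) = (\<Sum>a<n. \<Sum>b<n. E $$ (a, b) * (U $$ (a, i) * U $$ (b, i)))"
    if i: "i < n" for i
  proof -
    define v where "v = U *\<^sub>v unit_vec n i"
    have v: "v \<in> carrier_vec n" using c by (simp add: v_def)
    have va: "v $ a = U $$ (a, i)" if "a < n" for a
      using that i c by (simp add: v_def scalar_prod_right_unit)
    have "v \<bullet> (E *\<^sub>v v) = (\<Sum>a<n. v $ a * (E *\<^sub>v v) $ a)"
      using E v by (intro scalar_prod_sum) auto
    also have "\<dots> = (\<Sum>a<n. v $ a * (\<Sum>b<n. E $$ (a, b) * v $ b))"
      by (intro sum.cong refl arg_cong2[of _ _ _ _ "(*)"] index_mult_mat_vec_sum[OF E v]) auto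
    also have "\<dots> = (\<Sum>a<n. \<Sum>b<n. E $$ (a, b) * (U $$ (a, i) * U $$ (b, i)))"
      by (simp add: va sum_distrib_left mult_ac)
    finally show ?thesis by (simp add: v_def)
  qed
  have UU: "(\<Sum>i<n. U $$ (a, i) * U $$ (b, i)) = (if a = b then 1 else 0)" if "a < n" "b < n" for a b
  proof -
    have "(U * transpose_mat U) $$ (a, b) = (\<Sum>i<n. U $$ (a, i) * transpose_mat U $$ (i, b))"
      by (rule index_mult_mat_sum) (use c that in auto)
    then show ?thesis using that c by (simp add: orthD(4)[OF U])
  qed
  have "(\<Sum>i<n. (U *\<^sub>v unit_vec n i) \<bullet> (E *\<^sub>v (U *\<^sub>v unit_vec n i)))
      = (\<Sum>i<n. \<Sum>a<n. \<Sum>b<n. E $$ (a, b) * (U $$ (a, i) * U $$ (b, i)))"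
    by (intro sum.cong refl entry) auto
  also have "\<dots> = (\<Sum>a<n. \<Sum>i<n. \<Sum>b<n. E $$ (a, b) * (U $$ (a, i) * U $$ (b, i)))" by (rule sum.swap)
  also have "\<dots> = (\<Sum>a<n. \<Sum>b<n. \<Sum>i<n. E $$ (a, b) * (U $$ (a, i) * U $$ (b, i)))" by (intro sum.cong refl sum.swap)
  also have "\<dots> = (\<Sum>a<n. \<Sum>b<n. E $$ (a, b) * (if a = b then 1 else 0))"
    by (intro sum.cong refl) (simp add: sum_distrib_left[symmetric] UU)
  also have "\<dots> = (\<Sum>i<n. E $$ (i, i))" by (simp add: if_distrib[of "\<lambda>z. _ * z"] cong: if_cong)
  finally show ?thesis ..
qed

lemma diag_m_psd:
  assumes "\<And>i. i < m \<Longrightarrow> 0 \<le> d i" shows "psd_mat m (diag_m d m)"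
proof -
  have o: "orth m (1\<^sub>m m)" by (rule orthI) auto
  have "1\<^sub>m m * diag_m d m * transpose_mat (1\<^sub>m m) = diag_m d m"
    by (simp add: left_mult_one_mat[OF diag_m_carrier] right_mult_one_mat[OF diag_m_carrier])
  then show ?thesis using psd_conj_diag[OF o, of d] assms by simp
qed

lemma gram_entry:
  fixes X :: "real mat"
  assumes X: "X \<in> carrier_mat m n" and "a < m" "b < m"
  shows "(X * transpose_mat X) $$ (a, b) = (\<Sum>l<n. X $$ (a, l) * X $$ (b, l))"
proof -
  have "(X * transpose_mat X) $$ (a, b) = (\<Sum>l<n. X $$ (a, l) * transpose_mat X $$ (l, b))"
    by (rule index_mult_mat_sum) (use assms in auto)
  also have "\<dots> = (\<Sum>l<n. X $$ (a, l) * X $$ (b, l))" using assms by (intro sum.cong) auto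
  finally show ?thesis .
qed

section \<open>The constants of the bounds and the quadratic forms behind them\<close>

context nystrom_problem
begin

definition "S2 = diag_m (\<lambda>i. \<sigma> (i + k)) r"
definition "s1 = (\<Sum>i<n. \<sigma> i)"
definition "s2 = spec_norm S2"
definition "sn = nuc_norm S2"
definition "d2 = spec_norm (Lm * transpose_mat Lm)"
definition "dn = nuc_norm (Lm * transpose_mat Lm)"
definition "b2 = spec_norm (Sm * transpose_mat Sm)"
definition "c2 = nuc_norm (Sm * transpose_mat Sm)"
text \<open>The coefficient of e tr R in the error caused by the ridge. It contains 1 / \<eta>,
  which is why e is chosen after \<eta>.\<close>

definition "c\<eta> \<eta> = (s1 + (1 + 1 / \<eta>) * d2) * (hF * \<kappa>)"

lemma S2_psd: "psd_mat r S2"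
  unfolding S2_def using sigma_nonneg by (intro diag_m_psd) (auto simp: r_def)

lemma constants_nonneg: "0 \<le> s1" "0 \<le> s2" "0 \<le> d2" "0 \<le> b2"
  using sigma_nonneg spec_norm_nonneg[OF psd_matD(1)[OF S2_psd]]
    spec_norm_nonneg[OF psd_matD(1)[OF gram_psd[OF Lm]]] spec_norm_nonneg[OF psd_matD(1)[OF gram_psd[OF Sm]]]
  by (auto simp: s1_def s2_def d2_def b2_def intro!: sum_nonneg)

lemma c\<eta>_nonneg: "0 < \<eta> \<Longrightarrow> 0 \<le> c\<eta> \<eta>"
  using constants_nonneg hF_nonneg kappa_pos by (simp add: c\<eta>_def)

lemma S2_form: "(\<Sum>b<r. (sqrt (\<sigma> (b + k)) * y b)\<^sup>2) \<le> s2 * (\<Sum>b<r. (y b)\<^sup>2)"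
proof -
  have v: "vec r y \<in> carrier_vec r" by simp
  have "vec r y \<bullet> (S2 *\<^sub>v vec r y) = (\<Sum>b<r. y b * (S2 *\<^sub>v vec r y) $ b)"
    by (subst scalar_prod_sum[of _ r]) (auto simp: S2_def mult_mat_vec_carrier[OF diag_m_carrier])
  also have "\<dots> = (\<Sum>b<r. (sqrt (\<sigma> (b + k)) * y b)\<^sup>2)"
  proof (intro sum.cong refl)
    fix b assume "b \<in> {..<r}"
    then show "y b * (S2 *\<^sub>v vec r y) $ b = (sqrt (\<sigma> (b + k)) * y b)\<^sup>2"
      using sigma_nonneg[of "b + k"] diag_m_mult_vec[OF v, of b "\<lambda>i. \<sigma> (i + k)"]
      by (simp add: S2_def r_def power_mult_distrib power2_eq_square)
  qed
  finally show ?thesis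
    using spec_norm_form[OF S2_psd v] scalar_prod_sum[OF v, of "vec r y"] by (simp add: s2_def power2_eq_square)
qed

lemma sn_eq: "sn = (\<Sum>b<r. \<sigma> (b + k))"
  using nuc_norm_psd[OF S2_psd] by (simp add: sn_def S2_def diag_m_def)

lemma L_form: "(\<Sum>b<r. (\<Sum>a<k. Lm $$ (b, a) * u a)\<^sup>2) \<le> d2 * (\<Sum>a<k. (u a)\<^sup>2)"
proof -
  have v: "vec k u \<in> carrier_vec k" by simp
  have Lv: "Lm *\<^sub>v vec k u \<in> carrier_vec r" using Lm by simp
  have "(Lm *\<^sub>v vec k u) $ b = (\<Sum>a<k. Lm $$ (b, a) * u a)" if "b < r" for b
    using index_mult_mat_vec_sum[OF Lm v that] by simp
  then have "(Lm *\<^sub>v vec k u) \<bullet> (Lm *\<^sub>v vec k u) = (\<Sum>b<r. (\<Sum>a<k. Lm $$ (b, a) * u a)\<^sup>2)"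
    by (subst scalar_prod_sum[OF Lv]) (simp add: power2_eq_square)
  then show ?thesis
    using transpose_gram_form_le[OF Lm v] scalar_prod_sum[OF v, of "vec k u"] by (simp add: d2_def power2_eq_square)
qed

lemma dn_eq: "dn = (\<Sum>b<r. \<Sum>a<k. (Lm $$ (b, a))\<^sup>2)"
  using nuc_norm_psd[OF gram_psd[OF Lm]] by (simp add: dn_def gram_entry[OF Lm] power2_eq_square del: index_mult_mat)

lemma c2_eq: "c2 = (\<Sum>b<r. \<Sum>l<n. (Sm $$ (b, l))\<^sup>2)"
  using nuc_norm_psd[OF gram_psd[OF Sm]] by (simp add: c2_def gram_entry[OF Sm] power2_eq_square del: index_mult_mat)

lemma nuc_nonneg: "0 \<le> sn" "0 \<le> dn" "0 \<le> c2"
  using sigma_nonneg by (auto simp: sn_eq dn_eq c2_eq r_def intro!: sum_nonneg)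

lemma S_apply: "(\<Sum>b<r. (\<Sum>b'<r. (\<Sum>l<n. Sm $$ (b, l) * Sm $$ (b', l)) * h b')\<^sup>2)
    \<le> b2 * (\<Sum>l<n. (\<Sum>b<r. h b * Sm $$ (b, l))\<^sup>2)"
proof -
  let ?P = "Sm * transpose_mat Sm"
  have P: "psd_mat r ?P" by (rule gram_psd[OF Sm])
  have v: "vec r h \<in> carrier_vec r" by simp
  have Pv: "?P *\<^sub>v vec r h \<in> carrier_vec r" by (rule mult_mat_vec_carrier[OF psd_matD(1)[OF P] v])
  have "(?P *\<^sub>v vec r h) $ b = (\<Sum>b'<r. (\<Sum>l<n. Sm $$ (b, l) * Sm $$ (b', l)) * h b')" if "b < r" for b
    unfolding index_mult_mat_vec_sum[OF psd_matD(1)[OF P] v that]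
    using that by (intro sum.cong refl arg_cong2[of _ _ _ _ "(*)"] gram_entry[OF Sm]) auto
  then have "(?P *\<^sub>v vec r h) \<bullet> (?P *\<^sub>v vec r h) = (\<Sum>b<r. (\<Sum>b'<r. (\<Sum>l<n. Sm $$ (b, l) * Sm $$ (b', l)) * h b')\<^sup>2)"
    unfolding scalar_prod_sum[OF Pv] by (intro sum.cong refl) (simp add: power2_eq_square del: index_mult_mat_vec)
  moreover have "vec r h \<bullet> (?P *\<^sub>v vec r h) = (\<Sum>l<n. (\<Sum>b<r. h b * Sm $$ (b, l))\<^sup>2)"
    unfolding gram_form[OF Sm v] by (intro sum.cong refl arg_cong[of _ _ "\<lambda>z. z\<^sup>2"]) simp
  ultimately show ?thesis using psd_apply_sq[OF P v] by (simp only: b2_def)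
qed

lemma J_entry_sym: "a < k \<Longrightarrow> b < k \<Longrightarrow> Jm $$ (a, b) = Jm $$ (b, a)"
  using arg_cong[OF J_sym, of "\<lambda>M. M $$ (b, a)"] J(1) by simp

lemma J_trace: "(\<Sum>a<k. Jm $$ (a, a)) \<le> real k * \<kappa>"
proof -
  have "Jm $$ (a, a) \<le> \<kappa>" if "a < k" for a
  proof -
    have "Jm $$ (a, a) = unit_vec k a \<bullet> (Jm *\<^sub>v unit_vec k a)"
      using that J(1) by (simp add: scalar_prod_left_unit scalar_prod_right_unit)
    also have "\<dots> \<le> \<kappa> * (unit_vec k a \<bullet> unit_vec k a)" unfolding \<kappa>_def by (rule spec_norm_form[OF J_psd]) simp
    finally show ?thesis using that by simp
  qed
  then have "(\<Sum>a<k. Jm $$ (a, a)) \<le> (\<Sum>a<k. \<kappa>)" by (intro sum_mono) auto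
  then show ?thesis by simp
qed

end

section \<open>Expected error for a fixed ridge parameter\<close>

context nystrom_regularized
begin

abbreviation "\<Gamma> \<equiv> gauss_on ({..<n} \<times> {..<k + p})"

lemma J_norm: "(\<Sum>a<k. (\<Sum>b<k. Jm $$ (a, b) * v b)\<^sup>2) \<le> \<kappa> * rg.J_form v"
proof -
  have v: "vec k v \<in> carrier_vec k" by simp
  have Jv: "Jm *\<^sub>v vec k v \<in> carrier_vec k" by (rule mult_mat_vec_carrier[OF J(1) v])
  have e: "(Jm *\<^sub>v vec k v) $ a = (\<Sum>b<k. Jm $$ (a, b) * v b)" if "a < k" for a
    using index_mult_mat_vec_sum[OF J(1) v that] by simp
  have "(Jm *\<^sub>v vec k v) \<bullet> (Jm *\<^sub>v vec k v) = (\<Sum>a<k. (\<Sum>b<k. Jm $$ (a, b) * v b)\<^sup>2)"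
    unfolding scalar_prod_sum[OF Jv] by (intro sum.cong refl) (simp add: e power2_eq_square del: index_mult_mat_vec)
  moreover have "vec k v \<bullet> (Jm *\<^sub>v vec k v) = rg.J_form v"
    unfolding scalar_prod_sum[OF Jv] rg.J_form_def by (intro sum.cong refl) (simp add: e del: index_mult_mat_vec)
  ultimately show ?thesis using psd_apply_sq[OF J_psd v] by (simp only: \<kappa>_def)
qed

lemma tame_trR: "tame ({..<n} \<times> {..<k + p}) trR"
  unfolding trR_def by (intro tame_sum rg.tame_R) auto

lemma trR_mean: "(\<integral>x. trR x \<partial>\<Gamma>) \<le> real k * \<kappa> / (real p - 1)"
proof -
  have "(\<integral>x. trR x \<partial>\<Gamma>) \<le> (\<Sum>a<k. Jm $$ (a, a)) / (real p - 1)"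
    unfolding trR_def by (rule rg.R_trace_mean[OF refl p_ge])
  also have "\<dots> \<le> real k * \<kappa> / (real p - 1)" using p_ge by (intro divide_right_mono J_trace) auto
  finally show ?thesis .
qed

lemma resid_cost:
  assumes "0 < \<eta>"
  shows "(\<Sum>i<k. \<sigma> i * (resid y x i)\<^sup>2) + (1 + 1 / \<eta>) * (\<Sum>b<r. (\<Sum>a<k. Lf b a * resid y x a)\<^sup>2)
    \<le> c\<eta> \<eta> * e * trR x * (\<Sum>a<k. (y a)\<^sup>2)"
proof -
  let ?q = "\<Sum>i<k. (resid y x i)\<^sup>2"
  have "(\<Sum>i<k. \<sigma> i * (resid y x i)\<^sup>2) \<le> (\<Sum>i<k. s1 * (resid y x i)\<^sup>2)"
    using k_le sigma_nonneg by (intro sum_mono mult_right_mono) (auto simp: s1_def intro!: member_le_sum)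
  also have "\<dots> = s1 * ?q" by (simp add: sum_distrib_left)
  finally have 1: "(\<Sum>i<k. \<sigma> i * (resid y x i)\<^sup>2) \<le> s1 * ?q" .
  have 2: "(1 + 1 / \<eta>) * (\<Sum>b<r. (\<Sum>a<k. Lf b a * resid y x a)\<^sup>2) \<le> (1 + 1 / \<eta>) * (d2 * ?q)"
    using assms by (intro mult_left_mono L_form) auto
  have 3: "(s1 + (1 + 1 / \<eta>) * d2) * ?q \<le> (s1 + (1 + 1 / \<eta>) * d2) * (e * (hF * \<kappa> * trR x) * (\<Sum>a<k. (y a)\<^sup>2))"
    using assms constants_nonneg by (intro mult_left_mono resid_sq) auto
  have "(s1 + (1 + 1 / \<eta>) * d2) * ?q = s1 * ?q + (1 + 1 / \<eta>) * (d2 * ?q)" by (simp add: distrib_right)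
  moreover have "(s1 + (1 + 1 / \<eta>) * d2) * (e * (hF * \<kappa> * trR x) * (\<Sum>a<k. (y a)\<^sup>2)) = c\<eta> \<eta> * e * trR x * (\<Sum>a<k. (y a)\<^sup>2)"
    by (simp only: c\<eta>_def mult_ac)
  ultimately show ?thesis using 1 2 3 by linarith
qed

text \<open>The error form is at most g(x) |v|^2 for every v, with g affine in
  \<open>\<Lambda>\<close> and tr R, so taking means needs only their first moments. The weight
  \<eta> separates the terms that contain the defect.\<close>

lemma spectral_mean:
  assumes eta: "0 < \<eta>" and q: "0 < q" "2 * q \<le> p" and t: "0 < t"
    and cond: "(\<Prod>i<q. c2 + 2 * real i * b2) * (\<Prod>i<q. real k + 2 * real i) * \<kappa> ^ q
        \<le> (\<Prod>i<q. 2 * real i + 1) * (\<Prod>i<q. real p - 1 - 2 * real i) * t ^ q"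
  shows "(\<integral>\<^sup>+x. ennreal (spec_norm (En x)) \<partial>\<Gamma>)
    \<le> ennreal ((1 + \<eta>) * (s2 + 3 * d2) + (1 + \<eta>) * (3 / 2) * t + c\<eta> \<eta> * e * (real k * \<kappa> / (real p - 1)))"
proof -
  obtain \<Lambda> where L: "\<Lambda> \<in> borel_measurable \<Gamma>" "\<And>x. 0 \<le> \<Lambda> x" "(\<integral>\<^sup>+x. ennreal (\<Lambda> x) \<partial>\<Gamma>) \<le> ennreal t"
    "\<And>x u. (\<Sum>b<r. (rg.bilinear (Sf b) u x)\<^sup>2) \<le> \<Lambda> x * (\<Sum>a<k. (u a)\<^sup>2)"
    using rg.operator_bound[OF refl q, where S = Sf and r = r and ?c2.0 = c2 and ?b2.0 = b2,
        OF Sf_orth _ constants_nonneg(4) S_apply J_entry_sym J_trace J_norm t cond] c2_eq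
    by auto
  define g where "g = (\<lambda>x. (1 + \<eta>) * (s2 + (3 * d2 + 3 / 2 * \<Lambda> x)) + c\<eta> \<eta> * e * trR x)"
  have g_nonneg: "0 \<le> g x" for x
    using eta constants_nonneg L(2)[of x] c\<eta>_nonneg[OF eta] e_pos trR_nonneg[of x] by (simp add: g_def)
  have le: "spec_norm (En x) \<le> g x" for x
  proof (rule spec_norm_le[OF En_psd g_nonneg])
    fix v :: "real vec" assume v: "v \<in> carrier_vec n"
    define yv where "yv = transpose_mat U *\<^sub>v v"
    define y where "y = (\<lambda>i. yv $ i)"
    have yv: "yv \<in> carrier_vec n" using carriers(1) v by (simp add: yv_def)
    have "vec n y = yv" using yv by (intro eq_vecI) (auto simp: y_def)
    moreover have "U *\<^sub>v yv = v"
    proof -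
      have "U *\<^sub>v yv = (U * transpose_mat U) *\<^sub>v v"
        unfolding yv_def using carriers(1) v by (intro assoc_mult_mat_vec[symmetric]) auto
      then show ?thesis using v by (simp add: orthD(4)[OF U_orth])
    qed
    ultimately have vy: "U *\<^sub>v vec n y = v" by simp
    have norm: "v \<bullet> v = (\<Sum>a<k. (y a)\<^sup>2) + (\<Sum>b<r. (y (b + k))\<^sup>2)"
      using orth_norm[OF U_orth v] sum_split_at[OF k_le, of "\<lambda>i. (y i)\<^sup>2"] by (simp add: y_def yv_def r_def)
    let ?f = "\<lambda>b. sqrt (\<sigma> (b + k)) * y (b + k) - ((\<Sum>a<k. Lf b a * y a) + rg.bilinear (Sf b) y x)"
    let ?g = "\<lambda>b. \<Sum>a<k. Lf b a * resid y x a"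
    have lm: "(\<Sum>b<r. ((\<Sum>a<k. Lf b a * y a) + rg.bilinear (Sf b) y x)\<^sup>2) \<le> (3 * d2 + 3 / 2 * \<Lambda> x) * (\<Sum>a<k. (y a)\<^sup>2)"
    proof -
      \<comment> \<open>The weight 2 gives 1 + 2 = 3, the factor of \<delta>, and 1 + 1/2 = 3/2,
        which turns the factors 2 of \<open>moment_order\<close> into the 3s of the \<beta>
        terms.\<close>
      have "(\<Sum>b<r. ((\<Sum>a<k. Lf b a * y a) + rg.bilinear (Sf b) y x)\<^sup>2)
          \<le> (1 + 2) * (\<Sum>b<r. (\<Sum>a<k. Lf b a * y a)\<^sup>2) + (1 + 1 / 2) * (\<Sum>b<r. (rg.bilinear (Sf b) y x)\<^sup>2)"
        by (rule sum_sq_add_le) simp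
      also have "\<dots> \<le> (1 + 2) * (d2 * (\<Sum>a<k. (y a)\<^sup>2)) + (1 + 1 / 2) * (\<Lambda> x * (\<Sum>a<k. (y a)\<^sup>2))"
        by (intro add_mono mult_left_mono L_form L(4)) auto
      finally show ?thesis by (simp add: algebra_simps)
    qed
    have f: "(\<Sum>b<r. (?f b)\<^sup>2) \<le> (s2 + (3 * d2 + 3 / 2 * \<Lambda> x)) * ((\<Sum>b<r. (y (b + k))\<^sup>2) + (\<Sum>a<k. (y a)\<^sup>2))"
      using constants_nonneg L(2)[of x] by (intro sum_sq_diff_le S2_form[of "\<lambda>b. y (b + k)"] lm) (auto simp: sum_nonneg)
    have "v \<bullet> (En x *\<^sub>v v) \<le> (\<Sum>i<k. \<sigma> i * (resid y x i)\<^sup>2) + (\<Sum>b<r. (?f b + ?g b)\<^sup>2)"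
      using En_core[of y x] by (simp only: vy)
    also have "\<dots> \<le> (\<Sum>i<k. \<sigma> i * (resid y x i)\<^sup>2) + ((1 + \<eta>) * (\<Sum>b<r. (?f b)\<^sup>2) + (1 + 1 / \<eta>) * (\<Sum>b<r. (?g b)\<^sup>2))"
      by (intro add_left_mono sum_sq_add_le eta)
    finally have 1: "v \<bullet> (En x *\<^sub>v v) \<le> (1 + \<eta>) * (\<Sum>b<r. (?f b)\<^sup>2) + c\<eta> \<eta> * e * trR x * (\<Sum>a<k. (y a)\<^sup>2)"
      using resid_cost[OF eta, of y x] by linarith
    have 2: "(1 + \<eta>) * (\<Sum>b<r. (?f b)\<^sup>2) \<le> (1 + \<eta>) * ((s2 + (3 * d2 + 3 / 2 * \<Lambda> x)) * (v \<bullet> v))"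
      using f eta unfolding norm by (intro mult_left_mono) (auto simp: add.commute)
    have "0 \<le> c\<eta> \<eta> * e * trR x" using c\<eta>_nonneg[OF eta] e_pos trR_nonneg[of x] by simp
    then have 3: "c\<eta> \<eta> * e * trR x * (\<Sum>a<k. (y a)\<^sup>2) \<le> c\<eta> \<eta> * e * trR x * (v \<bullet> v)"
      unfolding norm by (intro mult_left_mono) (simp_all add: sum_nonneg)
    show "v \<bullet> (En x *\<^sub>v v) \<le> g x * (v \<bullet> v)"
      using 1 2 3 unfolding g_def by (simp only: distrib_right mult.assoc)
  qed
  let ?a = "(1 + \<eta>) * (s2 + 3 * d2)" and ?b = "(1 + \<eta>) * (3 / 2)" and ?c = "c\<eta> \<eta> * e"
  have nn: "0 \<le> ?a" "0 \<le> ?b" "0 \<le> ?c" using eta constants_nonneg c\<eta>_nonneg[OF eta] e_pos by auto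
  have m: "trR \<in> borel_measurable \<Gamma>" by (rule tame_measurable[OF tame_trR])
  interpret G: prob_space \<Gamma> by (rule prob_space_gauss_on)
  have "(\<integral>\<^sup>+x. ennreal (spec_norm (En x)) \<partial>\<Gamma>) \<le> (\<integral>\<^sup>+x. ennreal (g x) \<partial>\<Gamma>)"
    by (intro nn_integral_mono ennreal_leI le)
  also have "\<dots> = (\<integral>\<^sup>+x. ennreal ?a + (ennreal ?b * ennreal (\<Lambda> x) + ennreal ?c * ennreal (trR x)) \<partial>\<Gamma>)"
  proof (intro nn_integral_cong)
    fix x
    have "g x = ?a + (?b * \<Lambda> x + ?c * trR x)" by (simp add: g_def algebra_simps)
    then show "ennreal (g x) = ennreal ?a + (ennreal ?b * ennreal (\<Lambda> x) + ennreal ?c * ennreal (trR x))"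
      by (simp only: ennreal_plus[OF nn(1) add_nonneg_nonneg[OF mult_nonneg_nonneg[OF nn(2) L(2)] mult_nonneg_nonneg[OF nn(3) trR_nonneg]]]
          ennreal_plus[OF mult_nonneg_nonneg[OF nn(2) L(2)] mult_nonneg_nonneg[OF nn(3) trR_nonneg]]
          ennreal_mult[OF nn(2) L(2)] ennreal_mult[OF nn(3) trR_nonneg])
  qed
  also have "\<dots> = ennreal ?a + (ennreal ?b * (\<integral>\<^sup>+x. ennreal (\<Lambda> x) \<partial>\<Gamma>) + ennreal ?c * (\<integral>\<^sup>+x. ennreal (trR x) \<partial>\<Gamma>))"
    using L(1) m by (simp add: nn_integral_add nn_integral_cmult G.emeasure_space_1)
  also have "\<dots> \<le> ennreal ?a + (ennreal ?b * ennreal t + ennreal ?c * ennreal (real k * \<kappa> / (real p - 1)))"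
  proof (intro add_left_mono add_mono mult_left_mono L(3))
    have "(\<integral>\<^sup>+x. ennreal (trR x) \<partial>\<Gamma>) = ennreal (\<integral>x. trR x \<partial>\<Gamma>)"
      by (intro nn_integral_eq_integral tame_integrable tame_trR) (auto simp: trR_nonneg)
    then show "(\<integral>\<^sup>+x. ennreal (trR x) \<partial>\<Gamma>) \<le> ennreal (real k * \<kappa> / (real p - 1))"
      using trR_mean by (simp add: ennreal_leI)
  qed auto
  also have "\<dots> = ennreal (?a + (?b * t + ?c * (real k * \<kappa> / (real p - 1))))"
  proof -
    have t0: "0 \<le> t" "0 \<le> real k * \<kappa> / (real p - 1)" using t kappa_pos p_ge by auto
    show ?thesis
      by (simp only: ennreal_plus[OF nn(1) add_nonneg_nonneg[OF mult_nonneg_nonneg[OF nn(2) t0(1)] mult_nonneg_nonneg[OF nn(3) t0(2)]]]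
          ennreal_plus[OF mult_nonneg_nonneg[OF nn(2) t0(1)] mult_nonneg_nonneg[OF nn(3) t0(2)]]
          ennreal_mult[OF nn(2) t0(1)] ennreal_mult[OF nn(3) t0(2)])
  qed
  finally show ?thesis by (simp only: add.assoc)
qed

text \<open>The norm of the positive semidefinite residual is its trace, summed over the eigenbasis
  of A. The first k basis vectors contribute the entrywise second moments of the regression and
  uncorrelated parts, the others at most their eigenvalue.\<close>

lemma nuclear_mean:
  assumes eta: "0 < \<eta>"
  shows "(\<integral>\<^sup>+x. ennreal (nuc_norm (En x)) \<partial>\<Gamma>)
    \<le> ennreal (sn + (1 + \<eta>) * (dn + c2 * (real k * \<kappa> / (real p - 1))) + real k * (c\<eta> \<eta> * e) * (real k * \<kappa> / (real p - 1)))"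
proof -
  let ?\<delta> = "\<lambda>i j. if j = (i :: nat) then 1 else (0 :: real)"
  define h where "h = (\<lambda>x i b. (Lf b i + rg.bilinear (Sf b) (?\<delta> i) x)\<^sup>2)"
  define g where "g = (\<lambda>x. sn + (1 + \<eta>) * (\<Sum>i<k. \<Sum>b<r. h x i b) + real k * (c\<eta> \<eta> * e) * trR x)"
  have unit: "vec n (?\<delta> i) = unit_vec n i" for i by (rule eq_vecI) (auto simp: unit_vec_def)
  have low: "(U *\<^sub>v unit_vec n i) \<bullet> (En x *\<^sub>v (U *\<^sub>v unit_vec n i)) \<le> (1 + \<eta>) * (\<Sum>b<r. h x i b) + c\<eta> \<eta> * e * trR x"
    if i: "i < k" for i x
  proof -
    let ?f = "\<lambda>b. - (Lf b i + rg.bilinear (Sf b) (?\<delta> i) x)"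
    let ?g = "\<lambda>b. \<Sum>a<k. Lf b a * resid (?\<delta> i) x a"
    have one: "(\<Sum>a<k. (?\<delta> i a)\<^sup>2) = 1" using i by (simp add: if_distrib[of "\<lambda>z. z\<^sup>2"] cong: if_cong)
    have Li: "(\<Sum>a<k. Lf b a * ?\<delta> i a) = Lf b i" for b
      using i by (simp add: if_distrib[of "\<lambda>z. _ * z"] cong: if_cong)
    have "(U *\<^sub>v unit_vec n i) \<bullet> (En x *\<^sub>v (U *\<^sub>v unit_vec n i))
        \<le> (\<Sum>j<k. \<sigma> j * (resid (?\<delta> i) x j)\<^sup>2) + (\<Sum>b<r. (?f b + ?g b)\<^sup>2)"
      using En_core[of "?\<delta> i" x] i unfolding unit Li by simp
    also have "\<dots> \<le> (\<Sum>j<k. \<sigma> j * (resid (?\<delta> i) x j)\<^sup>2) + ((1 + \<eta>) * (\<Sum>b<r. (?f b)\<^sup>2) + (1 + 1 / \<eta>) * (\<Sum>b<r. (?g b)\<^sup>2))"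
      by (intro add_left_mono sum_sq_add_le eta)
    also have "(\<Sum>b<r. (?f b)\<^sup>2) = (\<Sum>b<r. h x i b)" unfolding h_def power2_minus ..
    finally show ?thesis using resid_cost[OF eta, of "?\<delta> i" x] unfolding one by linarith
  qed
  \<comment> \<open>Beyond index k the test vector has no component in the range of U1, so z = 0 and
    only its own eigenvalue remains.\<close>
  have high: "(U *\<^sub>v unit_vec n (c + k)) \<bullet> (En x *\<^sub>v (U *\<^sub>v unit_vec n (c + k))) \<le> \<sigma> (c + k)"
    if c: "c < r" for c x
  proof -
    let ?y = "?\<delta> (c + k)"
    have R0: "(\<Sum>d<k. rg.R x b d * ?y d) = 0" for b by (intro sum.neutral) auto
    have r0: "resid ?y x a = 0" for a unfolding resid_def R0 by simp
    have b0: "rg.bilinear (Sf b) ?y x = 0" for b unfolding rg.bilinear_eq_\<beta> by (intro sum.neutral) auto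
    have L0: "(\<Sum>a<k. Lf b a * ?y a) = 0" for b by (intro sum.neutral) auto
    have "(U *\<^sub>v unit_vec n (c + k)) \<bullet> (En x *\<^sub>v (U *\<^sub>v unit_vec n (c + k))) \<le> (\<Sum>b<r. (sqrt (\<sigma> (b + k)) * ?y (b + k))\<^sup>2)"
      using En_core[of ?y x] unfolding unit r0 b0 L0 by simp
    also have "\<dots> = (\<Sum>b<r. if b = c then \<sigma> (c + k) else 0)"
      using sigma_nonneg[of "c + k"] c by (intro sum.cong refl) (auto simp: r_def)
    finally show ?thesis using c by simp
  qed
  have le: "nuc_norm (En x) \<le> g x" for x
  proof -
    let ?F = "\<lambda>i. (U *\<^sub>v unit_vec n i) \<bullet> (En x *\<^sub>v (U *\<^sub>v unit_vec n i))"
    have "nuc_norm (En x) = (\<Sum>i<k. ?F i) + (\<Sum>c<r. ?F (c + k))"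
      unfolding nuc_norm_psd[OF En_psd] trace_orth[OF U_orth psd_matD(1)[OF En_psd]] r_def by (rule sum_split_at[OF k_le])
    also have "\<dots> \<le> (\<Sum>i<k. (1 + \<eta>) * (\<Sum>b<r. h x i b) + c\<eta> \<eta> * e * trR x) + (\<Sum>c<r. \<sigma> (c + k))"
      by (intro add_mono sum_mono low high) auto
    also have "\<dots> = g x" by (simp add: g_def sn_eq sum.distrib sum_distrib_left)
    finally show ?thesis .
  qed
  have th: "tame ({..<n} \<times> {..<k + p}) (\<lambda>x. h x i b)" for i b
    unfolding h_def by (intro tame_power tame_add tame_const rg.tame_bilinear)
  have tg: "tame ({..<n} \<times> {..<k + p}) g"
    unfolding g_def by (intro tame_add tame_mult tame_const tame_sum th tame_trR)
  have mean_h: "(\<integral>x. h x i b \<partial>\<Gamma>) \<le> (Lf b i)\<^sup>2 + (\<Sum>l<n. (Sf b l)\<^sup>2) * (Jm $$ (i, i) / (real p - 1))" if "i < k" "b < r" for i b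
    using rg.bilinear_second_moment[OF Sf_orth[OF _ that(2)] refl p_ge, of "Lf b i" "?\<delta> i"] that
    by (simp add: h_def rg.J_form_unit)
  have "(\<integral>\<^sup>+x. ennreal (nuc_norm (En x)) \<partial>\<Gamma>) \<le> (\<integral>\<^sup>+x. ennreal (g x) \<partial>\<Gamma>)"
    by (intro nn_integral_mono ennreal_leI le)
  also have "\<dots> = ennreal (\<integral>x. g x \<partial>\<Gamma>)"
  proof (intro nn_integral_eq_integral tame_integrable tg AE_I2)
    show "0 \<le> g x" for x
      using nuc_nonneg(1) eta c\<eta>_nonneg[OF eta] e_pos trR_nonneg[of x]
      by (auto simp: g_def h_def intro!: add_nonneg_nonneg mult_nonneg_nonneg sum_nonneg)
  qed auto
  also have "\<dots> \<le> ennreal (sn + (1 + \<eta>) * (dn + c2 * (real k * \<kappa> / (real p - 1))) + real k * (c\<eta> \<eta> * e) * (real k * \<kappa> / (real p - 1)))"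
  proof (rule ennreal_leI)
    interpret G: prob_space \<Gamma> by (rule prob_space_gauss_on)
    have ih: "integrable \<Gamma> (\<lambda>x. h x i b)" for i b by (intro tame_integrable th) auto
    have iR: "integrable \<Gamma> trR" by (intro tame_integrable tame_trR) auto
    have "(\<integral>x. g x \<partial>\<Gamma>) = sn + (1 + \<eta>) * (\<Sum>i<k. \<Sum>b<r. \<integral>x. h x i b \<partial>\<Gamma>) + real k * (c\<eta> \<eta> * e) * (\<integral>x. trR x \<partial>\<Gamma>)"
      unfolding g_def using ih iR by (simp add: G.prob_space)
    moreover have "(\<Sum>i<k. \<Sum>b<r. \<integral>x. h x i b \<partial>\<Gamma>) \<le> dn + c2 * (real k * \<kappa> / (real p - 1))"
    proof -
      have "(\<Sum>i<k. \<Sum>b<r. \<integral>x. h x i b \<partial>\<Gamma>) \<le> (\<Sum>i<k. \<Sum>b<r. (Lf b i)\<^sup>2 + (\<Sum>l<n. (Sf b l)\<^sup>2) * (Jm $$ (i, i) / (real p - 1)))"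
        by (intro sum_mono mean_h) auto
      also have "\<dots> = (\<Sum>i<k. \<Sum>b<r. (Lf b i)\<^sup>2) + (\<Sum>i<k. c2 * (Jm $$ (i, i) / (real p - 1)))"
        by (simp only: sum.distrib c2_eq sum_distrib_right)
      also have "(\<Sum>i<k. \<Sum>b<r. (Lf b i)\<^sup>2) = dn" unfolding dn_eq by (rule sum.swap)
      also have "(\<Sum>i<k. c2 * (Jm $$ (i, i) / (real p - 1))) = c2 * ((\<Sum>i<k. Jm $$ (i, i)) / (real p - 1))"
        by (simp only: sum_distrib_left[symmetric] sum_divide_distrib)
      finally have "(\<Sum>i<k. \<Sum>b<r. \<integral>x. h x i b \<partial>\<Gamma>) \<le> dn + c2 * ((\<Sum>i<k. Jm $$ (i, i)) / (real p - 1))" .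
      moreover have "c2 * ((\<Sum>i<k. Jm $$ (i, i)) / (real p - 1)) \<le> c2 * (real k * \<kappa> / (real p - 1))"
        using p_ge nuc_nonneg by (intro mult_left_mono divide_right_mono J_trace) auto
      ultimately show ?thesis by linarith
    qed
    then have "(1 + \<eta>) * (\<Sum>i<k. \<Sum>b<r. \<integral>x. h x i b \<partial>\<Gamma>) \<le> (1 + \<eta>) * (dn + c2 * (real k * \<kappa> / (real p - 1)))"
      using eta by (intro mult_left_mono) auto
    moreover have "real k * (c\<eta> \<eta> * e) * (\<integral>x. trR x \<partial>\<Gamma>) \<le> real k * (c\<eta> \<eta> * e) * (real k * \<kappa> / (real p - 1))"
      using c\<eta>_nonneg[OF eta] e_pos by (intro mult_left_mono trR_mean) auto
    ultimately show "(\<integral>x. g x \<partial>\<Gamma>) \<le> sn + (1 + \<eta>) * (dn + c2 * (real k * \<kappa> / (real p - 1))) + real k * (c\<eta> \<eta> * e) * (real k * \<kappa> / (real p - 1))"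
      by linarith
  qed
  finally show ?thesis .
qed

end

text \<open>Passage to the limit \<eta> to 0. The restriction \<eta> \<le> 1 lets the callers absorb
  \<eta>^2 into \<eta>.\<close>

lemma ennreal_le_perturb:
  assumes W: "0 \<le> W" and le: "\<And>\<eta>. 0 < \<eta> \<Longrightarrow> \<eta> \<le> 1 \<Longrightarrow> I \<le> ennreal (V + \<eta> * W)" and V: "0 \<le> V"
  shows "I \<le> ennreal V"
proof (rule ennreal_le_epsilon)
  fix \<epsilon> :: real assume eps: "0 < \<epsilon>"
  define \<eta> where "\<eta> = min 1 (\<epsilon> / (W + 1))"
  have eta: "0 < \<eta>" "\<eta> \<le> 1" using eps W by (auto simp: \<eta>_def)
  have "\<eta> * W \<le> \<epsilon> / (W + 1) * (W + 1)" using eta W eps by (intro mult_mono) (auto simp: \<eta>_def)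
  also have "\<dots> = \<epsilon>" using W by simp
  finally have "ennreal (V + \<eta> * W) \<le> ennreal (V + \<epsilon>)" by (intro ennreal_leI) simp
  also have "\<dots> = ennreal V + ennreal \<epsilon>" using V eps by (simp add: ennreal_plus)
  finally show "I \<le> ennreal V + ennreal \<epsilon>" using le[OF eta] by (rule order_trans[rotated])
qed

section \<open>Removing the ridge, and the case of a vanishing tail\<close>

context nystrom_problem
begin

lemma small_regularization:
  fixes c \<eta> :: real
  assumes "0 \<le> c" "0 < \<eta>"
  obtains e where "0 < e" "c * e \<le> \<eta>"
proof
  show "0 < \<eta> / (c + 1)" using assms by simp
  have "c * (\<eta> / (c + 1)) \<le> (c + 1) * (\<eta> / (c + 1))" using assms by (intro mult_right_mono) auto
  then show "c * (\<eta> / (c + 1)) \<le> \<eta>" using assms by simp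
qed

lemma gauss_entries_eq: "gauss_entries n (k + p) = gauss_on ({..<n} \<times> {..<k + p})"
  by (simp add: gauss_entries_def gauss_on_def)

text \<open>The order of choices is q from \<open>moment_order\<close>, which sees neither \<eta>
  nor e, then \<eta>, and last e so small that the ridge error is at most \<eta>.\<close>

theorem expected_spectral:
  assumes k: "2 \<le> k"
  shows "(\<integral>\<^sup>+x. ennreal (spec_norm (A - nystrom A (cov_sample K (k + p) x))) \<partial>gauss_entries n (k + p))
    \<le> ennreal (s2 + 3 * d2 + 3 / 2 * (\<kappa> * (2 * real k / (real p - 1) * b2 + 2 * exp 2 * real (k + p) / ((real p)\<^sup>2 - 1) * c2)))"
proof -
  define T where "T = 2 * real k / (real p - 1) * b2 + 2 * exp 2 * real (k + p) / ((real p)\<^sup>2 - 1) * c2"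
  have p1: "0 \<le> real p - 1" "0 \<le> (real p)\<^sup>2 - 1" using p_ge by (auto intro: one_le_power)
  have T: "0 \<le> T" using p1 constants_nonneg nuc_nonneg by (simp add: T_def)
  obtain q where q: "0 < q" "2 * q \<le> p"
    and cond: "(\<Prod>i<q. c2 + 2 * real i * b2) * (\<Prod>i<q. real k + 2 * real i)
       \<le> (\<Prod>i<q. 2 * real i + 1) * (\<Prod>i<q. real p - 1 - 2 * real i) * T ^ q"
    using moment_order[OF k p_ge constants_nonneg(4) nuc_nonneg(3)] unfolding T_def by blast
  define X where "X = s2 + 3 * d2 + 3 / 2 * (\<kappa> * T)"
  have X: "0 \<le> X" using T kappa_pos constants_nonneg by (simp add: X_def)
  have D0: "0 \<le> (\<Prod>i<q. 2 * real i + 1) * (\<Prod>i<q. real p - 1 - 2 * real i)"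
    using q by (intro mult_nonneg_nonneg prod_nonneg) auto
  have "(\<integral>\<^sup>+x. ennreal (spec_norm (A - nystrom A (cov_sample K (k + p) x))) \<partial>gauss_entries n (k + p)) \<le> ennreal X"
  proof (rule ennreal_le_perturb)
    \<comment> \<open>The 4 is 3/2 + 3/2 + 1: the \<eta> added to t, its product with the factor 1 +
      \<eta>, and the ridge error.\<close>
    show "0 \<le> X + 4" "0 \<le> X" using X by auto
    fix \<eta> :: real assume eta: "0 < \<eta>" "\<eta> \<le> 1"
    \<comment> \<open>\<open>T\<close> may be zero, while Young's inequality in
      \<open>operator_bound\<close> divides by powers of t; hence the added \<eta>.\<close>
    define t where "t = \<kappa> * T + \<eta>"
    have t: "0 < t" using T kappa_pos eta by (simp add: t_def add_nonneg_pos)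
    have cond': "(\<Prod>i<q. c2 + 2 * real i * b2) * (\<Prod>i<q. real k + 2 * real i) * \<kappa> ^ q
        \<le> (\<Prod>i<q. 2 * real i + 1) * (\<Prod>i<q. real p - 1 - 2 * real i) * t ^ q"
    proof -
      have "(\<Prod>i<q. c2 + 2 * real i * b2) * (\<Prod>i<q. real k + 2 * real i) * \<kappa> ^ q
        \<le> (\<Prod>i<q. 2 * real i + 1) * (\<Prod>i<q. real p - 1 - 2 * real i) * T ^ q * \<kappa> ^ q"
        using cond kappa_pos by (intro mult_right_mono) auto
      also have "\<dots> = (\<Prod>i<q. 2 * real i + 1) * (\<Prod>i<q. real p - 1 - 2 * real i) * (\<kappa> * T) ^ q"
        by (simp add: power_mult_distrib mult_ac)
      also have "\<dots> \<le> (\<Prod>i<q. 2 * real i + 1) * (\<Prod>i<q. real p - 1 - 2 * real i) * t ^ q"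
        using D0 T kappa_pos eta by (intro mult_left_mono power_mono) (auto simp: t_def)
      finally show ?thesis .
    qed
    have c0: "0 \<le> c\<eta> \<eta> * (real k * \<kappa> / (real p - 1))" using c\<eta>_nonneg[OF eta(1)] kappa_pos p1 by simp
    obtain e where e: "0 < e" "c\<eta> \<eta> * (real k * \<kappa> / (real p - 1)) * e \<le> \<eta>"
      using small_regularization[OF c0 eta(1)] by blast
    interpret reg: nystrom_regularized A K U \<sigma> n k p e by unfold_locales (rule e)
    have "(\<integral>\<^sup>+x. ennreal (spec_norm (A - nystrom A (cov_sample K (k + p) x))) \<partial>gauss_entries n (k + p))
      \<le> ennreal ((1 + \<eta>) * (s2 + 3 * d2) + (1 + \<eta>) * (3 / 2) * t + c\<eta> \<eta> * e * (real k * \<kappa> / (real p - 1)))"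
      using reg.spectral_mean[OF eta(1) q t cond'] by (simp only: reg.En_def gauss_entries_eq)
    also have "\<dots> \<le> ennreal (X + \<eta> * (X + 4))"
    proof (rule ennreal_leI)
      have "(1 + \<eta>) * (s2 + 3 * d2) + (1 + \<eta>) * (3 / 2) * t = X + \<eta> * X + 3 / 2 * \<eta> + 3 / 2 * \<eta> * \<eta>"
        by (simp add: X_def t_def algebra_simps)
      moreover have "\<eta> * \<eta> \<le> \<eta>" using eta by (simp add: mult_le_cancel_left1)
      moreover have "c\<eta> \<eta> * e * (real k * \<kappa> / (real p - 1)) \<le> \<eta>" using e(2) by (simp add: mult_ac)
      moreover have "\<eta> * (X + 4) = \<eta> * X + 4 * \<eta>" by (simp add: algebra_simps)
      ultimately show "(1 + \<eta>) * (s2 + 3 * d2) + (1 + \<eta>) * (3 / 2) * t + c\<eta> \<eta> * e * (real k * \<kappa> / (real p - 1)) \<le> X + \<eta> * (X + 4)"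
        by linarith
    qed
    finally show "(\<integral>\<^sup>+x. ennreal (spec_norm (A - nystrom A (cov_sample K (k + p) x))) \<partial>gauss_entries n (k + p)) \<le> ennreal (X + \<eta> * (X + 4))" .
  qed
  then show ?thesis by (simp only: X_def T_def)
qed

theorem expected_nuclear:
  "(\<integral>\<^sup>+x. ennreal (nuc_norm (A - nystrom A (cov_sample K (k + p) x))) \<partial>gauss_entries n (k + p))
    \<le> ennreal (sn + dn + c2 * (real k * \<kappa> / (real p - 1)))"
proof -
  define X where "X = sn + dn + c2 * (real k * \<kappa> / (real p - 1))"
  have p1: "0 \<le> real p - 1" using p_ge by auto
  have X: "0 \<le> X" using nuc_nonneg kappa_pos p1 by (simp add: X_def)
  have "(\<integral>\<^sup>+x. ennreal (nuc_norm (A - nystrom A (cov_sample K (k + p) x))) \<partial>gauss_entries n (k + p)) \<le> ennreal X"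
  proof (rule ennreal_le_perturb)
    show "0 \<le> X + 1" "0 \<le> X" using X by auto
    fix \<eta> :: real assume eta: "0 < \<eta>" "\<eta> \<le> 1"
    have c0: "0 \<le> real k * c\<eta> \<eta> * (real k * \<kappa> / (real p - 1))" using c\<eta>_nonneg[OF eta(1)] kappa_pos p1 by simp
    obtain e where e: "0 < e" "real k * c\<eta> \<eta> * (real k * \<kappa> / (real p - 1)) * e \<le> \<eta>"
      using small_regularization[OF c0 eta(1)] by blast
    interpret reg: nystrom_regularized A K U \<sigma> n k p e by unfold_locales (rule e)
    have "(\<integral>\<^sup>+x. ennreal (nuc_norm (A - nystrom A (cov_sample K (k + p) x))) \<partial>gauss_entries n (k + p))
      \<le> ennreal (sn + (1 + \<eta>) * (dn + c2 * (real k * \<kappa> / (real p - 1))) + real k * (c\<eta> \<eta> * e) * (real k * \<kappa> / (real p - 1)))"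
      using reg.nuclear_mean[OF eta(1)] by (simp only: reg.En_def gauss_entries_eq)
    also have "\<dots> \<le> ennreal (X + \<eta> * (X + 1))"
    proof (rule ennreal_leI)
      have "sn + (1 + \<eta>) * (dn + c2 * Z) = (sn + dn + c2 * Z) + \<eta> * (sn + dn + c2 * Z) - \<eta> * sn" for Z
        by (simp add: algebra_simps)
      then have "sn + (1 + \<eta>) * (dn + c2 * (real k * \<kappa> / (real p - 1))) = X + \<eta> * X - \<eta> * sn"
        unfolding X_def .
      moreover have "0 \<le> \<eta> * sn" using eta nuc_nonneg by simp
      moreover have "real k * (c\<eta> \<eta> * e) * (real k * \<kappa> / (real p - 1)) \<le> \<eta>" using e(2) by (simp add: mult_ac)
      moreover have "\<eta> * (X + 1) = \<eta> * X + \<eta>" by (simp add: algebra_simps)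
      ultimately show "sn + (1 + \<eta>) * (dn + c2 * (real k * \<kappa> / (real p - 1))) + real k * (c\<eta> \<eta> * e) * (real k * \<kappa> / (real p - 1)) \<le> X + \<eta> * (X + 1)"
        by linarith
    qed
    finally show "(\<integral>\<^sup>+x. ennreal (nuc_norm (A - nystrom A (cov_sample K (k + p) x))) \<partial>gauss_entries n (k + p)) \<le> ennreal (X + \<eta> * (X + 1))" .
  qed
  then show ?thesis by (simp only: X_def)
qed

text \<open>If \<open>\<Sigma>\<^sub>2 = 0\<close> the ratios in \<open>\<beta>\<close> and \<open>\<delta>\<close> are the junk value \<open>x / 0 = 0\<close>.\<close>
lemma degenerate_tail:
  assumes "\<And>b. b < r \<Longrightarrow> \<sigma> (b + k) = 0"
  shows "b2 = 0" "c2 = 0" "d2 = 0" "dn = 0"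
proof -
  have Sh0: "Sh = 0\<^sub>m r r" using assms by (auto intro!: eq_matI simp: Sh_def diag_m_def)
  have KJ: "K21 * Jm \<in> carrier_mat r k" using carriers(13) J(1) by (rule mult_carrier_mat)
  have L0: "Lm = 0\<^sub>m r k" unfolding Lm_def Sh0 by (rule left_mult_zero_mat[OF KJ])
  have S0: "Sm = 0\<^sub>m r n"
    unfolding Sm_def L0 Sh0 left_mult_zero_mat[OF carriers(11)] left_mult_zero_mat[OF carriers(10)]
    by (intro eq_matI) auto
  have spec0: "spec_norm M = 0" if M: "psd_mat r M" and M0: "\<And>x. x \<in> carrier_vec r \<Longrightarrow> x \<bullet> (M *\<^sub>v x) = 0" for M
    using spec_norm_le[OF M, of 0] spec_norm_nonneg[OF psd_matD(1)[OF M]] M0 by auto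
  show "b2 = 0" unfolding b2_def
  proof (rule spec0[OF gram_psd[OF Sm]])
    fix x :: "real vec" assume x: "x \<in> carrier_vec r"
    show "x \<bullet> ((Sm * transpose_mat Sm) *\<^sub>v x) = 0" unfolding gram_form[OF Sm x] by (simp add: S0)
  qed
  show "d2 = 0" unfolding d2_def
  proof (rule spec0[OF gram_psd[OF Lm]])
    fix x :: "real vec" assume x: "x \<in> carrier_vec r"
    show "x \<bullet> ((Lm * transpose_mat Lm) *\<^sub>v x) = 0" unfolding gram_form[OF Lm x] by (simp add: L0)
  qed
  show "c2 = 0" by (simp add: c2_eq S0)
  show "dn = 0" by (simp add: dn_eq L0)
qed

lemma tail_zero_if_s2_zero:
  assumes s: "s2 = 0" and b: "b < r" shows "\<sigma> (b + k) = 0"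
proof -
  have bn: "b + k < n" using b by (simp add: r_def)
  have "(sqrt (\<sigma> (b + k)) * 1)\<^sup>2 \<le> (\<Sum>c<r. (sqrt (\<sigma> (c + k)) * 1)\<^sup>2)"
    using b by (intro member_le_sum) auto
  also have "\<dots> \<le> 0" using S2_form[of "\<lambda>_. 1"] by (simp add: s)
  finally show ?thesis using sigma_nonneg[OF bn] by simp
qed

lemma tail_zero_if_sn_zero:
  assumes "sn = 0" and b: "b < r" shows "\<sigma> (b + k) = 0"
proof -
  have "\<sigma> (b + k) \<le> (\<Sum>c<r. \<sigma> (c + k))"
    using b sigma_nonneg by (intro member_le_sum) (auto simp: r_def)
  moreover have "0 \<le> \<sigma> (b + k)" using b by (intro sigma_nonneg) (simp add: r_def)
  ultimately show ?thesis using assms(1) by (simp add: sn_eq)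
qed

end

theorem theorem2p1:
  fixes A K U :: "real mat" and \<sigma> :: "nat \<Rightarrow> real" and n k p :: nat
  assumes A_psd: "psd_mat n A"
    and k_ge: "2 \<le> k" and k_le: "k \<le> vec_space.rank n A"
    and p_ge: "2 \<le> p"
    and K_psd: "psd_mat n K"
    and U_carrier: "U \<in> carrier_mat n n"
    and U_orth: "transpose_mat U * U = 1\<^sub>m n"
    and A_eig: "A = U * diag_m \<sigma> n * transpose_mat U"
    and \<sigma>_sorted: "\<forall>i j. i \<le> j \<longrightarrow> j < n \<longrightarrow> \<sigma> j \<le> \<sigma> i"
    and \<sigma>_nonneg: "\<forall>i < n. 0 \<le> \<sigma> i"
  defines "U1 \<equiv> block U n k 0 0"
    and "U2 \<equiv> block U n (n - k) 0 k"
    and "\<Sigma>2 \<equiv> diag_m (\<lambda>i. \<sigma> (i + k)) (n - k)"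
    and "\<Sigma>2h \<equiv> diag_m (\<lambda>i. sqrt (\<sigma> (i + k))) (n - k)"
  defines "K11 \<equiv> transpose_mat U1 * K * U1"
    and "K21 \<equiv> transpose_mat U2 * K * U1"
    and "K22 \<equiv> transpose_mat U2 * K * U2"
  assumes K11_inv: "invertible_mat K11"
  defines "K221 \<equiv> K22 - K21 * minv K11 * transpose_mat K21"
  defines "\<beta>2 \<equiv> spec_norm (\<Sigma>2h * K221 * \<Sigma>2h) / spec_norm \<Sigma>2 * spec_norm (minv K11)"
    and "\<beta>nuc \<equiv> nuc_norm (\<Sigma>2h * K221 * \<Sigma>2h) / nuc_norm \<Sigma>2 * spec_norm (minv K11)"
    and "\<delta>2 \<equiv> spec_norm (\<Sigma>2h * K21 * minv K11 * minv K11 * transpose_mat K21 * \<Sigma>2h)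
                 / spec_norm \<Sigma>2"
    and "\<delta>nuc \<equiv> nuc_norm (\<Sigma>2h * K21 * minv K11 * minv K11 * transpose_mat K21 * \<Sigma>2h)
                 / nuc_norm \<Sigma>2"
  shows "((\<integral>\<^sup>+ G. ennreal (spec_norm (A - nystrom A (cov_sample K (k + p) G)))
            \<partial>gauss_entries n (k + p))
         \<le> ennreal ((1 + 3 * real k / (real p - 1) * \<beta>2 + 3 * \<delta>2) * spec_norm \<Sigma>2
              + 3 * exp 2 * real (k + p) / ((real p)^2 - 1) * \<beta>nuc * nuc_norm \<Sigma>2))
     \<and> ((\<integral>\<^sup>+ G. ennreal (nuc_norm (A - nystrom A (cov_sample K (k + p) G)))
            \<partial>gauss_entries n (k + p))
         \<le> ennreal ((1 + real k / (real p - 1) * \<beta>nuc + \<delta>nuc) * nuc_norm \<Sigma>2))"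
proof -
  have kn: "k \<le> n"
    using k_le vec_space.rank_le_nc[OF psd_matD(1)[OF A_psd]] by linarith
  interpret np: nystrom_problem A K U \<sigma> n k p
  proof
    show "invertible_mat (transpose_mat (block U n k 0 0) * K * block U n k 0 0)"
      using K11_inv by (simp only: K11_def U1_def)
    show "0 < k" using k_ge by simp
  qed (use A_psd kn p_ge K_psd orthI[OF U_carrier U_orth] A_eig \<sigma>_nonneg in auto)
  have U12: "np.U1 = U1" "np.U2 = U2"
    by (simp_all only: np.U1_def np.U2_def np.r_def U1_def U2_def)
  have blocks: "np.K11 = K11" "np.K21 = K21" "np.K22 = K22"
    by (simp_all only: np.K11_def np.K21_def np.K22_def K11_def K21_def K22_def U12)
  have diag: "np.S2 = \<Sigma>2" "np.Sh = \<Sigma>2h"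
    by (simp_all only: np.S2_def np.Sh_def np.r_def \<Sigma>2_def \<Sigma>2h_def)
  have Jm: "np.Jm = minv K11" by (simp only: np.Jm_def blocks)
  define b where "b = spec_norm (\<Sigma>2h * K221 * \<Sigma>2h)"
  define c where "c = nuc_norm (\<Sigma>2h * K221 * \<Sigma>2h)"
  define d where "d = spec_norm (\<Sigma>2h * K21 * minv K11 * minv K11 * transpose_mat K21 * \<Sigma>2h)"
  define d' where "d' = nuc_norm (\<Sigma>2h * K21 * minv K11 * minv K11 * transpose_mat K21 * \<Sigma>2h)"
  define \<kappa> where "\<kappa> = spec_norm (minv K11)"
  define s where "s = spec_norm \<Sigma>2"
  define s' where "s' = nuc_norm \<Sigma>2"
  have np_eqs: "np.b2 = b" "np.c2 = c" "np.d2 = d" "np.dn = d'" "np.\<kappa> = \<kappa>" "np.s2 = s" "np.sn = s'"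
    by (simp_all only: np.b2_def np.c2_def np.d2_def np.dn_def np.\<kappa>_def np.s2_def np.sn_def np.Sm_gram np.Lm_gram
        blocks diag Jm b_def c_def d_def d'_def \<kappa>_def s_def s'_def K221_def)
  \<comment> \<open>If the norm of \<Sigma>2 is nonzero it cancels. If it is zero, both sides
    vanish: the left as a multiple of 0, the right by \<open>degenerate_tail\<close>.\<close>
  have 2: "\<beta>2 * s = b * \<kappa>" "\<delta>2 * s = d"
    using np.degenerate_tail[OF np.tail_zero_if_s2_zero] unfolding np_eqs
    by (cases "s = 0"; simp add: \<beta>2_def \<delta>2_def b_def[symmetric] d_def[symmetric] \<kappa>_def[symmetric] s_def[symmetric])+
  have nuc: "\<beta>nuc * s' = c * \<kappa>" "\<delta>nuc * s' = d'"
    using np.degenerate_tail[OF np.tail_zero_if_sn_zero] unfolding np_eqs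
    by (cases "s' = 0"; simp add: \<beta>nuc_def \<delta>nuc_def c_def[symmetric] d'_def[symmetric] \<kappa>_def[symmetric] s'_def[symmetric])+
  have "(1 + 3 * real k / (real p - 1) * \<beta>2 + 3 * \<delta>2) * s + 3 * exp 2 * real (k + p) / ((real p)\<^sup>2 - 1) * \<beta>nuc * s'
      = s + 3 * real k / (real p - 1) * (\<beta>2 * s) + 3 * (\<delta>2 * s) + 3 * exp 2 * real (k + p) / ((real p)\<^sup>2 - 1) * (\<beta>nuc * s')"
    by (simp only: distrib_right mult.assoc mult_1_left)
  also have "\<dots> = s + 3 * d + 3 / 2 * (\<kappa> * (2 * real k / (real p - 1) * b + 2 * exp 2 * real (k + p) / ((real p)\<^sup>2 - 1) * c))"
    unfolding 2 nuc by (simp add: distrib_left mult_ac)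
  finally have spec: "(1 + 3 * real k / (real p - 1) * \<beta>2 + 3 * \<delta>2) * s + 3 * exp 2 * real (k + p) / ((real p)\<^sup>2 - 1) * \<beta>nuc * s'
      = s + 3 * d + 3 / 2 * (\<kappa> * (2 * real k / (real p - 1) * b + 2 * exp 2 * real (k + p) / ((real p)\<^sup>2 - 1) * c))" .
  have "(1 + real k / (real p - 1) * \<beta>nuc + \<delta>nuc) * s' = s' + real k / (real p - 1) * (\<beta>nuc * s') + \<delta>nuc * s'"
    by (simp only: distrib_right mult.assoc mult_1_left)
  also have "\<dots> = s' + d' + c * (real k * \<kappa> / (real p - 1))"
    unfolding nuc by simp
  finally have nuclear: "(1 + real k / (real p - 1) * \<beta>nuc + \<delta>nuc) * s' = s' + d' + c * (real k * \<kappa> / (real p - 1))" .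
  show ?thesis
    unfolding s_def[symmetric] s'_def[symmetric] spec nuclear
    using np.expected_spectral[OF k_ge] np.expected_nuclear unfolding np_eqs by blast
qed

end
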